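(* There exist a flat torus $\mathbb T^2$, a $2$-dimensional simplicial complex $T$ whose underlying space $|T|$ is homeomorphic to $\mathbb T^2$, and a map $\psi:T^{(1)}\to\mathbb T^2$ which is the restriction to the 1-skeleton $T^{(1)}$ of a (marking) homeomorphism $|T|\to\mathbb T^2$, such that the deformation space $X(T,\psi)$ of Delaunay geodesic triangulations of $\mathbb T^2$ of combinatorial type $(T,\psi)$ is not connected.
   Context: A flat torus is a torus $\mathbb T^2$ with a flat Riemannian metric. $T=(V,E,F)$ denotes a $2$-dimensional simplicial complex with vertex set $V$, edge set $E$ and set of triangles $F$; each edge is identified with the closed interval $[0,1]$. $T^{(1)}$ is the 1-skeleton of $T$ and $|T|$ is its underlying space. $X(T,\psi)$ is the set of all embeddings $\varphi:T^{(1)}\to\mathbb T^2$ such that: (a) the restriction of $\varphi$ to each edge, identified with $[0,1]$, is a geodesic parametrized with constant speed; (b) $\varphi$ is homotopic to $\psi$; (c) for every edge of $T$, $b+c+b'+c'-a-a'>0$, where $a,a'$ are the inner angles opposite to the edge in the two adjacent geodesic triangles and $b,c,b',c'$ are the remaining inner angles of those two triangles (equivalently, in the flat case, $a+a'<\pi$). $X(T,\psi)$ carries its natural topology as a space of maps $T^{(1)}\to\mathbb T^2$ (e.g. the topology of uniform convergence). *)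

theory Defs
  imports "HOL-Analysis.Analysis"
begin

section \<open>Flat tori\<close>

text \<open>
  By the Killing--Hopf theorem every flat torus is isometric to a quotient of the Euclidean plane
  (here \<^typ>\<open>complex\<close> with its real inner product) by a lattice, that is, by the subgroup generated
  by two vectors that are linearly independent over the reals.  A point of the torus is a coset of
  the lattice, as a set of complex numbers.
\<close>

definition is_lattice :: "complex set \<Rightarrow> bool" where
  "is_lattice \<Lambda> \<longleftrightarrow>
     (\<exists>\<omega>\<^sub>1 \<omega>\<^sub>2. \<omega>\<^sub>1 \<noteq> \<omega>\<^sub>2 \<and> independent {\<omega>\<^sub>1, \<omega>\<^sub>2} \<and>
        \<Lambda> = {of_int m * \<omega>\<^sub>1 + of_int n * \<omega>\<^sub>2 | m n. True})"

definition torus_proj :: "complex set \<Rightarrow> complex \<Rightarrow> complex set" where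
  "torus_proj \<Lambda> z = (\<lambda>l. z + l) ` \<Lambda>"

text \<open>
  The Riemannian distance of the quotient is the infimum of the Euclidean distances between lifts,
  which for two cosets is their \<^const>\<open>setdist\<close>.
\<close>

definition flat_torus :: "complex set \<Rightarrow> complex set metric" where
  "flat_torus \<Lambda> = metric (range (torus_proj \<Lambda>), setdist)"

lemma is_lattice_add_closed:
  assumes "is_lattice \<Lambda>"
  shows "0 \<in> \<Lambda>" and "x \<in> \<Lambda> \<Longrightarrow> y \<in> \<Lambda> \<Longrightarrow> x + y \<in> \<Lambda>" and "x \<in> \<Lambda> \<Longrightarrow> - x \<in> \<Lambda>"
proof -
  obtain a b where L: "\<Lambda> = {of_int m * a + of_int n * b | m n. True}"
    using assms unfolding is_lattice_def by blast
  show "0 \<in> \<Lambda>" unfolding L by (auto intro!: exI[of _ 0])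
  show "x + y \<in> \<Lambda>" if xy: "x \<in> \<Lambda>" "y \<in> \<Lambda>"
  proof -
    obtain m n m' n' where "x = of_int m * a + of_int n * b" "y = of_int m' * a + of_int n' * b"
      using xy unfolding L by blast
    then have "x + y = of_int (m + m') * a + of_int (n + n') * b" by (simp add: algebra_simps)
    then show ?thesis unfolding L by blast
  qed
  show "- x \<in> \<Lambda>" if x: "x \<in> \<Lambda>"
  proof -
    obtain m n where "x = of_int m * a + of_int n * b"
      using x unfolding L by blast
    then have "- x = of_int (- m) * a + of_int (- n) * b" by simp
    then show ?thesis unfolding L by blast
  qed
qed

lemma is_lattice_closed:
  assumes "is_lattice \<Lambda>" shows "closed \<Lambda>"
proof -
  obtain a b where ab: "a \<noteq> b" "independent {a, b}"
    and L: "\<Lambda> = {of_int m * a + of_int n * b | m n. True}"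
    using assms unfolding is_lattice_def by blast
  define f :: "real \<times> real \<Rightarrow> complex" where "f = (\<lambda>(s, t). s *\<^sub>R a + t *\<^sub>R b)"
  have lin: "linear f"
    unfolding f_def by (intro linearI) (auto simp: algebra_simps)
  have inj: "inj f"
    unfolding linear_injective_0[OF lin]
  proof clarify
    fix s t assume "f (s, t) = 0"
    then have *: "s *\<^sub>R a + t *\<^sub>R b = 0" by (simp add: f_def)
    have "a \<noteq> 0" "b \<noteq> 0" using ab(2) dependent_zero by blast+
    have "s = 0"
    proof (rule ccontr)
      assume "s \<noteq> 0"
      have "s *\<^sub>R a = (- t) *\<^sub>R b" using * by (simp add: eq_neg_iff_add_eq_0)
      then have "(inverse s) *\<^sub>R (s *\<^sub>R a) = (inverse s) *\<^sub>R ((- t) *\<^sub>R b)" by (rule arg_cong)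
      then have "a = (- t / s) *\<^sub>R b" using \<open>s \<noteq> 0\<close> by (simp add: divide_inverse mult.commute)
      then have "a \<in> span {b}" by (metis span_base span_scale singletonI)
      then have "dependent {a, b}" using ab(1) by (auto simp: dependent_def)
      then show False using ab(2) by simp
    qed
    then show "(s, t) = 0" using * \<open>b \<noteq> 0\<close> by (simp add: zero_prod_def)
  qed
  have "\<Lambda> = f ` (\<int> \<times> \<int>)"
  proof (intro equalityI subsetI)
    fix x assume "x \<in> \<Lambda>"
    then obtain m n where "x = of_int m * a + of_int n * b" unfolding L by blast
    then have "x = f (of_int m, of_int n)" by (simp add: f_def scaleR_conv_of_real)
    then show "x \<in> f ` (\<int> \<times> \<int>)" by auto
  next
    fix x assume "x \<in> f ` (\<int> \<times> \<int>)"
    then obtain m n :: int where "x = f (of_int m, of_int n)" by (auto elim!: Ints_cases)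
    then have "x = of_int m * a + of_int n * b" by (simp add: f_def scaleR_conv_of_real)
    then show "x \<in> \<Lambda>" unfolding L by blast
  qed
  moreover have "closed ((\<int> :: real set) \<times> (\<int> :: real set))"
    by (intro closed_Times closed_Ints)
  ultimately show ?thesis
    using closed_injective_linear_image[OF _ lin inj] by simp
qed

lemma torus_proj_eq_iff:
  assumes "is_lattice \<Lambda>"
  shows "torus_proj \<Lambda> z = torus_proj \<Lambda> w \<longleftrightarrow> w - z \<in> \<Lambda>"
proof
  assume "torus_proj \<Lambda> z = torus_proj \<Lambda> w"
  moreover have "w \<in> torus_proj \<Lambda> w"
    using is_lattice_add_closed(1)[OF assms] by (force simp: torus_proj_def)
  ultimately have "w \<in> torus_proj \<Lambda> z" by simp
  then show "w - z \<in> \<Lambda>" by (auto simp: torus_proj_def)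
next
  assume wz: "w - z \<in> \<Lambda>"
  show "torus_proj \<Lambda> z = torus_proj \<Lambda> w"
  proof (intro equalityI subsetI)
    fix x assume "x \<in> torus_proj \<Lambda> z"
    then obtain l where l: "l \<in> \<Lambda>" "x = z + l" by (auto simp: torus_proj_def)
    have "- (w - z) + l \<in> \<Lambda>" using is_lattice_add_closed[OF assms] wz l by blast
    then show "x \<in> torus_proj \<Lambda> w" unfolding torus_proj_def l
      by (intro image_eqI[of _ _ "- (w - z) + l"]) auto
  next
    fix x assume "x \<in> torus_proj \<Lambda> w"
    then obtain l where l: "l \<in> \<Lambda>" "x = w + l" by (auto simp: torus_proj_def)
    have "(w - z) + l \<in> \<Lambda>" using is_lattice_add_closed[OF assms] wz l by blast
    then show "x \<in> torus_proj \<Lambda> z" unfolding torus_proj_def l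
      by (intro image_eqI[of _ _ "(w - z) + l"]) auto
  qed
qed

lemma setdist_torus_proj:
  assumes "is_lattice \<Lambda>"
  shows "setdist (torus_proj \<Lambda> z) (torus_proj \<Lambda> w) = setdist {z} (torus_proj \<Lambda> w)"
proof -
  have ne: "\<Lambda> \<noteq> {}" using is_lattice_add_closed(1)[OF assms] by blast
  have z: "z \<in> torus_proj \<Lambda> z"
    using is_lattice_add_closed(1)[OF assms] by (force simp: torus_proj_def)
  have "setdist {z} (torus_proj \<Lambda> w) \<le> dist x y"
    if xy: "x \<in> torus_proj \<Lambda> z" "y \<in> torus_proj \<Lambda> w" for x y
  proof -
    obtain k l where kl: "k \<in> \<Lambda>" "l \<in> \<Lambda>" "x = z + k" "y = w + l"
      using xy by (auto simp: torus_proj_def)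
    have "l + - k \<in> \<Lambda>" using is_lattice_add_closed[OF assms] kl by blast
    then have "w + (l + - k) \<in> torus_proj \<Lambda> w" by (auto simp: torus_proj_def)
    then have "setdist {z} (torus_proj \<Lambda> w) \<le> dist z (w + (l + - k))"
      by (intro setdist_le_dist) auto
    also have "\<dots> = dist x y" by (simp add: kl dist_norm algebra_simps)
    finally show ?thesis .
  qed
  then have "setdist {z} (torus_proj \<Lambda> w) \<le> setdist (torus_proj \<Lambda> z) (torus_proj \<Lambda> w)"
    using ne by (intro le_setdistI) (auto simp: torus_proj_def)
  moreover have "setdist (torus_proj \<Lambda> z) (torus_proj \<Lambda> w) \<le> setdist {z} (torus_proj \<Lambda> w)"
    using z by (intro setdist_subset_left) auto
  ultimately show ?thesis by simp
qed

lemma Metric_space_flat_torus: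
  assumes L: "is_lattice \<Lambda>"
  shows "Metric_space (range (torus_proj \<Lambda>)) setdist"
proof
  show "0 \<le> setdist x y" for x y :: "complex set" by simp
  show "setdist x y = setdist y x" for x y :: "complex set" by (rule setdist_sym)
  show "setdist x y = 0 \<longleftrightarrow> x = y" if xy: "x \<in> range (torus_proj \<Lambda>)" "y \<in> range (torus_proj \<Lambda>)" for x y
  proof -
    obtain z w where zw: "x = torus_proj \<Lambda> z" "y = torus_proj \<Lambda> w" using xy by blast
    have cl: "closed (torus_proj \<Lambda> w)"
      unfolding torus_proj_def by (intro closed_translation is_lattice_closed L)
    have ne: "torus_proj \<Lambda> w \<noteq> {}"
      using is_lattice_add_closed(1)[OF L] by (auto simp: torus_proj_def)
    have "setdist x y = 0 \<longleftrightarrow> z \<in> torus_proj \<Lambda> w"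
      using setdist_eq_0_closed[OF cl] ne by (simp add: zw setdist_torus_proj[OF L])
    also have "\<dots> \<longleftrightarrow> z - w \<in> \<Lambda>"
      by (auto simp: torus_proj_def image_iff) (metis add.commute diff_add_cancel)
    also have "\<dots> \<longleftrightarrow> y = x" by (simp add: zw torus_proj_eq_iff[OF L])
    finally show ?thesis by auto
  qed
  show "setdist x z \<le> setdist x y + setdist y z"
    if xyz: "x \<in> range (torus_proj \<Lambda>)" "y \<in> range (torus_proj \<Lambda>)" "z \<in> range (torus_proj \<Lambda>)" for x y z
  proof -
    obtain b where b: "y = torus_proj \<Lambda> b" using xyz by blast
    obtain c where c: "z = torus_proj \<Lambda> c" using xyz by blast
    obtain a where a: "x = torus_proj \<Lambda> a" using xyz by blast
    have "setdist x z \<le> setdist x {b} + setdist {b} z" by (rule setdist_triangle)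
    also have "setdist {b} z = setdist y z" by (simp add: b c setdist_torus_proj[OF L])
    also have "setdist x {b} = setdist x y"
      by (metis a b setdist_sym setdist_torus_proj[OF L])
    finally show ?thesis .
  qed
qed

lemma
  assumes "is_lattice \<Lambda>"
  shows mspace_flat_torus: "mspace (flat_torus \<Lambda>) = range (torus_proj \<Lambda>)"
    and mdist_flat_torus: "mdist (flat_torus \<Lambda>) = setdist"
  using Metric_space_flat_torus[OF assms]
  by (simp_all add: flat_torus_def Metric_space.mspace_metric Metric_space.mdist_metric)

lemma quotient_map_torus_proj:
  assumes L: "is_lattice \<Lambda>"
  shows "quotient_map euclidean (mtopology_of (flat_torus \<Lambda>)) (torus_proj \<Lambda>)"
proof -
  interpret Metric_space "range (torus_proj \<Lambda>)" setdist by (rule Metric_space_flat_torus[OF L])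
  have top: "mtopology_of (flat_torus \<Lambda>) = mtopology"
    by (simp add: mtopology_of_def mspace_flat_torus[OF L] mdist_flat_torus[OF L])
  have self: "z \<in> torus_proj \<Lambda> z" for z
    using is_lattice_add_closed(1)[OF L] by (force simp: torus_proj_def)
  have ball: "mball (torus_proj \<Lambda> z) e = torus_proj \<Lambda> ` ball z e" for z e
  proof (intro equalityI subsetI)
    fix y assume "y \<in> mball (torus_proj \<Lambda> z) e"
    then obtain w where y: "y = torus_proj \<Lambda> w" and "setdist {z} (torus_proj \<Lambda> w) < e"
      by (auto simp: setdist_torus_proj[OF L])
    then obtain w' where w': "w' \<in> torus_proj \<Lambda> w" "dist z w' < e"
      using self[of w] by (auto elim!: setdist_ltE)
    then have "torus_proj \<Lambda> w = torus_proj \<Lambda> w'"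
      unfolding torus_proj_eq_iff[OF L] by (auto simp: torus_proj_def)
    then show "y \<in> torus_proj \<Lambda> ` ball z e" using w' y by auto
  next
    fix y assume "y \<in> torus_proj \<Lambda> ` ball z e"
    then obtain w where w: "y = torus_proj \<Lambda> w" "dist z w < e" by auto
    have "setdist (torus_proj \<Lambda> z) (torus_proj \<Lambda> w) \<le> dist z w"
      by (intro setdist_le_dist self)
    then show "y \<in> mball (torus_proj \<Lambda> z) e" using w by auto
  qed
  have "continuous_map euclidean mtopology (torus_proj \<Lambda>)"
    unfolding continuous_map_to_metric
  proof (intro ballI allI impI)
    fix z :: complex and e :: real assume "e > 0"
    then show "\<exists>U. openin euclidean U \<and> z \<in> U \<and> (\<forall>y\<in>U. torus_proj \<Lambda> y \<in> mball (torus_proj \<Lambda> z) e)"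
      by (intro exI[of _ "ball z e"]) (auto simp: ball simp del: in_mball)
  qed
  moreover have "open_map euclidean mtopology (torus_proj \<Lambda>)"
    unfolding open_map_def
  proof (intro allI impI)
    fix U :: "complex set" assume U: "openin euclidean U"
    show "openin mtopology (torus_proj \<Lambda> ` U)"
      unfolding openin_mtopology
    proof (intro conjI allI impI)
      fix x assume "x \<in> torus_proj \<Lambda> ` U"
      then obtain z where z: "z \<in> U" "x = torus_proj \<Lambda> z" by blast
      then obtain e where "e > 0" "ball z e \<subseteq> U"
        using U by (metis open_openin open_contains_ball)
      then show "\<exists>r>0. mball x r \<subseteq> torus_proj \<Lambda> ` U"
        unfolding z(2) ball by blast
    qed auto
  qed
  ultimately show ?thesis
    unfolding top by (intro continuous_open_imp_quotient_map) auto
qed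

section \<open>Geodesics and angles\<close>

text \<open>
  Since the projection is a local isometry, the geodesics of constant speed in the quotient are
  the projections of the affinely parametrized segments in the plane.
\<close>

definition geodesic_from :: "complex set \<Rightarrow> (real \<Rightarrow> complex set) \<Rightarrow> complex \<Rightarrow> complex \<Rightarrow> bool" where
  "geodesic_from \<Lambda> \<gamma> p d \<longleftrightarrow> (\<forall>t\<in>{0..1}. \<gamma> t = torus_proj \<Lambda> (p + t *\<^sub>R d))"

definition is_geodesic :: "complex set \<Rightarrow> (real \<Rightarrow> complex set) \<Rightarrow> bool" where
  "is_geodesic \<Lambda> \<gamma> \<longleftrightarrow> (\<exists>p d. geodesic_from \<Lambda> \<gamma> p d)"

text \<open>
  The velocity vector of a geodesic, in the global parallel frame of the torus; it does not depend
  on the lift.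
\<close>

definition velocity :: "complex set \<Rightarrow> (real \<Rightarrow> complex set) \<Rightarrow> complex" where
  "velocity \<Lambda> \<gamma> = (THE d. \<exists>p. geodesic_from \<Lambda> \<gamma> p d)"

lemma velocity_eq:
  assumes L: "is_lattice \<Lambda>" and g: "geodesic_from \<Lambda> \<gamma> p d"
  shows "velocity \<Lambda> \<gamma> = d"
  unfolding velocity_def
proof (rule the_equality)
  show "\<exists>p. geodesic_from \<Lambda> \<gamma> p d" using g by blast
next
  fix d' assume "\<exists>p. geodesic_from \<Lambda> \<gamma> p d'"
  then obtain p' where g': "geodesic_from \<Lambda> \<gamma> p' d'" by blast
  let ?f = "\<lambda>t::real. (p' + t *\<^sub>R d') - (p + t *\<^sub>R d)"
  have "?f t \<in> \<Lambda>" if "t \<in> {0..1}" for t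
  proof -
    have "torus_proj \<Lambda> (p + t *\<^sub>R d) = torus_proj \<Lambda> (p' + t *\<^sub>R d')"
      using g g' that by (simp add: geodesic_from_def)
    then show ?thesis by (simp add: torus_proj_eq_iff[OF L])
  qed
  then have sub: "?f ` {0..1} \<subseteq> \<Lambda>" by blast
  obtain a b where "\<Lambda> = {of_int m * a + of_int n * b | m n. True}"
    using L unfolding is_lattice_def by blast
  then have "\<Lambda> = range (\<lambda>(m, n). of_int m * a + of_int n * b)" by auto
  then have "countable \<Lambda>" by (metis countable_image countableI_type)
  then have cnt: "countable (?f ` {0..1})" using sub countable_subset by blast
  show "d' = d"
  proof (rule ccontr)
    assume ne: "d' \<noteq> d"
    have "inj_on ?f {0..1}"
    proof (rule inj_onI)
      fix s t assume "?f s = ?f t"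
      then have "(s - t) *\<^sub>R (d' - d) = 0" by (simp add: algebra_simps)
      then show "s = t" using ne by simp
    qed
    then have "countable {0..1::real}" using cnt countable_image_inj_on by blast
    then show False using uncountable_closed_interval[of 0 "1::real"] by simp
  qed
qed

definition vec_angle :: "complex \<Rightarrow> complex \<Rightarrow> real" where
  "vec_angle x y = arccos ((x \<bullet> y) / (norm x * norm y))"

section \<open>Two-dimensional simplicial complexes\<close>

text \<open>
  The library's simplicial complexes are finite and consist of simplices in a Euclidean space (the
  empty one included).  Every finite 2-dimensional complex has a realization in five-dimensional
  space, so \<^typ>\<open>real ^ 5\<close> is a fully general ambient space; and a complex with compact
  underlying space, such as a torus, is finite.
\<close>

definition two_dim_complex :: "'a::euclidean_space set set \<Rightarrow> bool" where
  "two_dim_complex T \<longleftrightarrow>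
     simplicial_complex T \<and> (\<forall>S\<in>T. aff_dim S \<le> 2) \<and> (\<exists>S\<in>T. aff_dim S = 2)"

definition edges :: "'a::euclidean_space set set \<Rightarrow> 'a set set" where
  "edges T = {S \<in> T. 1 simplex S}"

definition triangles :: "'a::euclidean_space set set \<Rightarrow> 'a set set" where
  "triangles T = {S \<in> T. 2 simplex S}"

definition one_skeleton :: "'a::euclidean_space set set \<Rightarrow> 'a set" where
  "one_skeleton T = \<Union>{S \<in> T. aff_dim S \<le> 1}"

section \<open>The deformation space of Delaunay geodesic triangulations\<close>

text \<open>
  The edge with endpoints \<open>u\<close>, \<open>v\<close> is \<open>convex hull {u, v}\<close>, and \<^const>\<open>linepath\<close> is its
  identification with the unit interval; both orientations are covered, since \<open>u\<close> and \<open>v\<close> are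
  arbitrary.
\<close>

definition edges_geodesic ::
  "complex set \<Rightarrow> 'a::euclidean_space set set \<Rightarrow> ('a \<Rightarrow> complex set) \<Rightarrow> bool" where
  "edges_geodesic \<Lambda> T \<phi> \<longleftrightarrow>
     (\<forall>u v. convex hull {u, v} \<in> edges T \<longrightarrow> is_geodesic \<Lambda> (\<phi> \<circ> linepath u v))"

text \<open>
  The angle at \<open>v\<close> between the geodesic edges from \<open>v\<close> to \<open>u\<close> and from \<open>v\<close> to \<open>w\<close>.  If \<open>u v w\<close> is a
  triangle of \<open>T\<close> and \<open>\<phi>\<close> is homotopic to the restriction of a homeomorphism on \<open>|T|\<close>, the geodesic
  triangle with these edges is contractible and lifts to a Euclidean triangle, whose inner angles
  are less than pi; so this value, in the interval from 0 to pi, is the inner angle.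
\<close>

definition inner_angle ::
  "complex set \<Rightarrow> ('a::euclidean_space \<Rightarrow> complex set) \<Rightarrow> 'a \<Rightarrow> 'a \<Rightarrow> 'a \<Rightarrow> real" where
  "inner_angle \<Lambda> \<phi> u v w =
     vec_angle (velocity \<Lambda> (\<phi> \<circ> linepath v u)) (velocity \<Lambda> (\<phi> \<circ> linepath v w))"

text \<open>
  Below, \<open>u v\<close> is the edge, \<open>w\<close> and \<open>w'\<close> are the opposite vertices of its two adjacent triangles, and
  the last two summands are the angles opposite to the edge.
\<close>

definition delaunay ::
  "complex set \<Rightarrow> 'a::euclidean_space set set \<Rightarrow> ('a \<Rightarrow> complex set) \<Rightarrow> bool" where
  "delaunay \<Lambda> T \<phi> \<longleftrightarrow>
     (\<forall>u v w w'. convex hull {u, v} \<in> edges T \<and> w \<noteq> w' \<and>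
        convex hull {u, v, w} \<in> triangles T \<and> convex hull {u, v, w'} \<in> triangles T \<longrightarrow>
        inner_angle \<Lambda> \<phi> v u w + inner_angle \<Lambda> \<phi> u v w
          + inner_angle \<Lambda> \<phi> v u w' + inner_angle \<Lambda> \<phi> u v w'
          - inner_angle \<Lambda> \<phi> u w v - inner_angle \<Lambda> \<phi> u w' v > 0)"

text \<open>
  The ambient space of maps from the 1-skeleton is the library's space of bounded continuous
  functions with the supremum metric (extensional outside the 1-skeleton, so that maps agreeing
  there are equal); boundedness is automatic, as the 1-skeleton of a finite complex is compact.
\<close>

definition delaunay_maps ::
  "complex set \<Rightarrow> 'a::euclidean_space set set \<Rightarrow> ('a \<Rightarrow> complex set) \<Rightarrow> ('a \<Rightarrow> complex set) set" where
  "delaunay_maps \<Lambda> T \<psi> =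
     {\<phi> \<in> mspace (cfunspace (top_of_set (one_skeleton T)) (flat_torus \<Lambda>)).
        embedding_map (top_of_set (one_skeleton T)) (mtopology_of (flat_torus \<Lambda>)) \<phi> \<and>
        edges_geodesic \<Lambda> T \<phi> \<and>
        homotopic_with (\<lambda>_. True) (top_of_set (one_skeleton T)) (mtopology_of (flat_torus \<Lambda>)) \<phi> \<psi> \<and>
        delaunay \<Lambda> T \<phi>}"

definition delaunay_space ::
  "complex set \<Rightarrow> 'a::euclidean_space set set \<Rightarrow> ('a \<Rightarrow> complex set) \<Rightarrow> ('a \<Rightarrow> complex set) topology" where
  "delaunay_space \<Lambda> T \<psi> =
     subtopology (mtopology_of (cfunspace (top_of_set (one_skeleton T)) (flat_torus \<Lambda>)))
       (delaunay_maps \<Lambda> T \<psi>)"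

end

(*
  The complex is the quotient of the triangulated plane with vertices in the integer lattice and
  edges in the directions (1,0), (0,1), (1,1) by {(x,y) : x + 3y = 0 mod 10}; it has ten vertices,
  labelled by x + 3y.  The torus is long (100) and thin (circumference 10): its vertices lie on
  horizontal rows, and moving every second row horizontally by a gives geodesic triangulations
  that are Delaunay exactly when 2499 < a^2 < 2500.  For a close to -50 (or to 50) the ten
  vertices gather in one nearly vertical ring, and the two signs of a pair them differently.

  These two configurations lie in different components.  In the configuration with a < 0 twenty
  edges cross the long empty gap between two lifts of the ring.  The Delaunay condition says that
  the circumcenters on the two sides of an edge differ by a positive multiple of the edge turned
  by a right angle.  For the crossing edges this makes the circumcenters increase in height as one
  goes around the strip, so within one turn they stay close together; for the ring edges it then
  says that the edge is almost vertical.  Hence rough bounds on the crossing edges imply much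
  better ones, so the rough bounds define an open and closed set: degenerate triangles, the only
  other way to leave it, are excluded by injectivity on the 1-skeleton.
*)
theory Submission
  imports Defs
begin

section \<open>Circumcenters in a thin strip\<close>

text \<open>The angles in \<open>delaunay\<close> are unsigned. They become the sign of a dual edge
  once the triangles are known to be positively oriented. Orientation is therefore carried along as
  part of the inequalities that cut out the open and closed set, next to the rough bounds on the
  crossing edges, and each of these inequalities has to be recovered strictly. The constants fit
  together as follows. The rough bounds (real part at least 50, imaginary part at most 100 in
  modulus) put every dual edge into a cone around the vertical in which the horizontal change is at
  most twice the vertical one. One turn climbs exactly 10, so within a turn circumcenters drift by
  at most 20. Across a ring edge the translation by \<open>100 + 4 * \<i>\<close> leaves a
  horizontal gap of at least 80 against a vertical one of at most 10; the ring edge, perpendicular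
  to it, has horizontal part at most 1/8 of its rise. A ring of height 10 thus has width at most
  5/4, and the crossing edges have real part within 5/4 of 100 and imaginary part at most 14 = 10 +
  4.\<close>

definition cross2 :: "complex \<Rightarrow> complex \<Rightarrow> real" where
  "cross2 x y = Re x * Im y - Im x * Re y"

text \<open>Cotangent of the angle at \<open>w\<close>, counted positive for a counterclockwise
  triangle \<open>u v w\<close> with an acute angle there; it is rational in the
  coordinates.\<close>

definition cot_at :: "complex \<Rightarrow> complex \<Rightarrow> complex \<Rightarrow> real" where
  "cot_at w u v = ((u - w) \<bullet> (v - w)) / cross2 (u - w) (v - w)"

text \<open>By the inscribed angle theorem the circumcenter lies on the perpendicular bisector of
  \<open>u v\<close>, at signed distance half the edge length times the cotangent of the opposite
  angle. Written from one edge, the centers on its two sides can be subtracted directly.\<close>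

definition circumcenter :: "complex \<Rightarrow> complex \<Rightarrow> complex \<Rightarrow> complex" where
  "circumcenter u v w = (u + v) / 2 + (cot_at w u v / 2) *\<^sub>R (\<i> * (v - u))"

text \<open>The formula singles out an edge. Clearing the common denominator \<open>D\<close>, twice
  the signed area, turns independence of that choice into a polynomial identity.\<close>

lemma circumcenter_cyclic:
  assumes "cross2 (v - u) (w - u) > 0"
  shows "circumcenter u v w = circumcenter v w u"
proof -
  define D where "D = cross2 (v - u) (w - u)"
  define k where "k = cot_at w u v"
  define l where "l = cot_at u v w"
  have D: "cross2 (u - w) (v - w) = D" "cross2 (v - u) (w - u) = D" "D > 0"
    using assms by (simp_all add: D_def cross2_def algebra_simps)
  have k: "D * k = (u - w) \<bullet> (v - w)" and l: "D * l = (v - u) \<bullet> (w - u)"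
    using D(3) by (simp_all add: k_def l_def cot_at_def D less_imp_neq[symmetric])
  have "D * (Re u + Re v - k * (Im v - Im u)) = D * (Re u + Re v) - (D * k) * (Im v - Im u)"
    by (simp add: right_diff_distrib)
  also have "\<dots> = D * (Re v + Re w) - (D * l) * (Im w - Im v)"
    unfolding k l by (simp add: inner_complex_def D_def cross2_def algebra_simps)
  also have "\<dots> = D * (Re v + Re w - l * (Im w - Im v))"
    by (simp add: right_diff_distrib)
  finally have "Re u + Re v - k * (Im v - Im u) = Re v + Re w - l * (Im w - Im v)"
    using D(3) by simp
  moreover have "D * (Im u + Im v + k * (Re v - Re u)) = D * (Im u + Im v) + (D * k) * (Re v - Re u)"
    by (simp add: distrib_left)
  then have "D * (Im u + Im v + k * (Re v - Re u)) = D * (Im v + Im w) + (D * l) * (Re w - Re v)"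
    unfolding k l by (simp add: inner_complex_def D_def cross2_def algebra_simps)
  then have "D * (Im u + Im v + k * (Re v - Re u)) = D * (Im v + Im w + l * (Re w - Re v))"
    by (simp add: distrib_left)
  then have "Im u + Im v + k * (Re v - Re u) = Im v + Im w + l * (Re w - Re v)"
    using D(3) by simp
  ultimately show ?thesis
    by (simp add: circumcenter_def complex_eq_iff field_simps flip: k_def l_def)
qed

lemma circumcenter_translate: "circumcenter (u + a) (v + a) (w + a) = circumcenter u v w + a"
proof -
  have *: "(u + a + (v + a)) / 2 = (u + v) / 2 + a" by (simp add: field_simps)
  show ?thesis by (simp add: circumcenter_def cot_at_def *)
qed

text \<open>For counterclockwise triangles \<open>u v w\<close> and \<open>v u w'\<close> with
  opposite angles a and a', the sum is sin (a + a') / (sin a * sin a'), so positivity means a + a' <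
  \<pi>. It is also twice the ratio of the signed dual edge to the edge.\<close>

definition locally_delaunay :: "complex \<Rightarrow> complex \<Rightarrow> complex \<Rightarrow> complex \<Rightarrow> bool" where
  "locally_delaunay u v w w' \<longleftrightarrow> cot_at w u v + cot_at w' v u > 0"

lemma circumcenter_dual_edge:
  assumes "locally_delaunay u v w w'"
  obtains k where "k > 0" "circumcenter u v w - circumcenter v u w' = k *\<^sub>R (\<i> * (v - u))"
proof
  show "(cot_at w u v + cot_at w' v u) / 2 > 0"
    using assms by (simp add: locally_delaunay_def)
  show "circumcenter u v w - circumcenter v u w' =
    ((cot_at w u v + cot_at w' v u) / 2) *\<^sub>R (\<i> * (v - u))"
    by (simp add: circumcenter_def scaleR_conv_of_real field_simps)
qed

text \<open>The order of a convex cone, hence transitive and fit for chaining around the strip. The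
  factor 2 = 100 / 50 is the steepest slope that the rough bounds allow a crossing edge; the dual
  edge is turned by a right angle.\<close>

definition up_cone :: "complex \<Rightarrow> complex \<Rightarrow> bool" where
  "up_cone x y \<longleftrightarrow> \<bar>Re y - Re x\<bar> \<le> 2 * (Im y - Im x)"

lemma up_cone_trans [trans]: "up_cone x y \<Longrightarrow> up_cone y z \<Longrightarrow> up_cone x z"
  unfolding up_cone_def by (smt (verit))

lemma up_cone_dual_edge:
  assumes "locally_delaunay u v w w'" "Re (v - u) \<ge> 50" "\<bar>Im (v - u)\<bar> \<le> 100"
  shows "up_cone (circumcenter v u w') (circumcenter u v w)"
proof -
  obtain k where k: "k > 0" "circumcenter u v w - circumcenter v u w' = k *\<^sub>R (\<i> * (v - u))"
    using assms(1) circumcenter_dual_edge by blast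
  have "Re (circumcenter u v w) - Re (circumcenter v u w') = - k * Im (v - u)"
       "Im (circumcenter u v w) - Im (circumcenter v u w') = k * Re (v - u)"
    using arg_cong[OF k(2), of Re] arg_cong[OF k(2), of Im] by (simp_all add: algebra_simps)
  moreover have "k * \<bar>Im (v - u)\<bar> \<le> k * (2 * Re (v - u))"
    using assms k by (intro mult_left_mono) auto
  ultimately show ?thesis
    using k(1) by (simp add: up_cone_def abs_mult)
qed

text \<open>The difference of the circumcenters is nearly horizontal, and perpendicular to the edge.\<close>

lemma steep_edge:
  assumes "locally_delaunay u v w w'"
    and "circumcenter u v w - circumcenter v u w' = y - x - (100 + 4 * \<i>)"
    and "up_cone x y" "up_cone y (x + 10 * \<i>)"
  shows "Im (v - u) > 0" "\<bar>Re (v - u)\<bar> \<le> Im (v - u) / 8"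
proof -
  obtain k where k: "k > 0" "circumcenter u v w - circumcenter v u w' = k *\<^sub>R (\<i> * (v - u))"
    using assms(1) circumcenter_dual_edge by blast
  have "k *\<^sub>R (\<i> * (v - u)) = y - x - (100 + 4 * \<i>)" using k assms(2) by simp
  then have "- k * Im (v - u) = Re y - Re x - 100" "k * Re (v - u) = Im y - Im x - 4"
    by (auto simp: complex_eq_iff algebra_simps)
  \<comment> \<open>\<open>Im y - Im x\<close> lies between 0 and 10, hence
    \<open>Re y - Re x\<close> between -20 and 20; the vertical difference after subtracting 4 lies
    between -4 and 6.\<close>
  with assms(3,4) have *: "k * Im (v - u) \<ge> 80" "\<bar>k * Re (v - u)\<bar> \<le> 10"
    by (simp_all add: up_cone_def)
  then show "Im (v - u) > 0" using k(1) by (smt (verit) mult_nonneg_nonpos)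
  have "k * \<bar>Re (v - u)\<bar> = \<bar>k * Re (v - u)\<bar>" "k * (Im (v - u) / 8) = k * Im (v - u) / 8"
    using k(1) by (simp_all add: abs_mult)
  then have "k * \<bar>Re (v - u)\<bar> \<le> k * (Im (v - u) / 8)" using * by linarith
  then show "\<bar>Re (v - u)\<bar> \<le> Im (v - u) / 8" using k(1) by (rule mult_left_le_imp_le)
qed

text \<open>The points \<open>p r\<close> are the vertices of the ring in vertical order and \<open>q r\<close> those of its right
  translate, numbered so that \<open>p r\<close> and \<open>q r\<close> have about the same height.  For even \<open>r\<close> the strip
  between them consists, from bottom to top, of the triangles \<open>(p r, q r, p (r + 1))\<close>,
  \<open>(p (r + 1), q r, q (r + 1))\<close>, \<open>(p (r + 1), q (r + 1), q (r + 2))\<close> and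
  \<open>(p (r + 1), q (r + 2), p (r + 2))\<close>, with circumcenters \<open>U\<close>, \<open>V\<close>, \<open>W\<close>, \<open>Z\<close> below.\<close>

locale thin_strip =
  fixes p q :: "int \<Rightarrow> complex"
  assumes period: "p (r + 10) = p r + 10 * \<i>"
    and q_def: "q r = p (r - 4) + (100 + 4 * \<i>)"
    and orient:
      "even r \<Longrightarrow> cross2 (q r - p r) (p (r + 1) - p r) > 0"
      "even r \<Longrightarrow> cross2 (q r - p (r + 1)) (q (r + 1) - p (r + 1)) > 0"
      "even r \<Longrightarrow> cross2 (q (r + 1) - p (r + 1)) (q (r + 2) - p (r + 1)) > 0"
      "even r \<Longrightarrow> cross2 (q (r + 2) - p (r + 1)) (p (r + 2) - p (r + 1)) > 0"
    and delaunay_crossing: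
      "even r \<Longrightarrow> locally_delaunay (p r) (q r) (p (r + 1)) (p (r - 1))"
      "even r \<Longrightarrow> locally_delaunay (p (r + 1)) (q r) (q (r + 1)) (p r)"
      "even r \<Longrightarrow> locally_delaunay (p (r + 1)) (q (r + 1)) (q (r + 2)) (q r)"
      "even r \<Longrightarrow> locally_delaunay (p (r + 1)) (q (r + 2)) (p (r + 2)) (q (r + 1))"
    and delaunay_ring:
      "even r \<Longrightarrow> locally_delaunay (p r) (p (r + 1)) (p (r + 5) - (100 + 4 * \<i>)) (q r)"
      "even r \<Longrightarrow> locally_delaunay (p (r + 1)) (p (r + 2)) (p (r + 5) - (100 + 4 * \<i>)) (q (r + 2))"
    and crossing:
      "even r \<Longrightarrow> Re (q r - p r) \<ge> 50 \<and> \<bar>Im (q r - p r)\<bar> \<le> 100"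
      "even r \<Longrightarrow> Re (q r - p (r + 1)) \<ge> 50 \<and> \<bar>Im (q r - p (r + 1))\<bar> \<le> 100"
      "even r \<Longrightarrow> Re (q (r + 1) - p (r + 1)) \<ge> 50 \<and> \<bar>Im (q (r + 1) - p (r + 1))\<bar> \<le> 100"
      "even r \<Longrightarrow> Re (q (r + 2) - p (r + 1)) \<ge> 50 \<and> \<bar>Im (q (r + 2) - p (r + 1))\<bar> \<le> 100"
begin

section \<open>Circumcenters climbing around the strip\<close>

definition U where "U r = circumcenter (p r) (q r) (p (r + 1))"
definition V where "V r = circumcenter (p (r + 1)) (q r) (q (r + 1))"
definition W where "W r = circumcenter (p (r + 1)) (q (r + 1)) (q (r + 2))"
definition Z where "Z r = circumcenter (p (r + 1)) (q (r + 2)) (p (r + 2))"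

lemma q_period: "q (r + 10) = q r + 10 * \<i>"
  using period[of "r - 4"] by (simp add: q_def algebra_simps)

lemma U_period: "U (r + 10) = U r + 10 * \<i>"
  using period[of "r + 1"] unfolding U_def
  by (simp add: period q_period circumcenter_translate add.commute add.left_commute)

lemma Z_period: "Z (r + 10) = Z r + 10 * \<i>"
  using period[of "r + 1"] period[of "r + 2"] q_period[of "r + 2"] unfolding Z_def
  by (simp add: circumcenter_translate add.commute add.left_commute)

context fixes r :: int assumes r: "even r"
begin

text \<open>The two triangles share the crossing edge from \<open>p (r + 1)\<close> to
  \<open>q r\<close>. It points to the right, so its Delaunay condition pushes the center on the
  left side upward. The next three lemmas treat the other crossing edges of a period of two
  indices.\<close>

lemma up_UV: "up_cone (U r) (V r)"
proof -
  have "circumcenter (q r) (p (r + 1)) (p r) = U r"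
    using circumcenter_cyclic[OF orient(1)[OF r]] by (simp add: U_def)
  then show ?thesis
    using up_cone_dual_edge[OF delaunay_crossing(2)[OF r]] crossing(2)[OF r] by (simp add: V_def)
qed

lemma up_VW: "up_cone (V r) (W r)"
proof -
  have "circumcenter (q (r + 1)) (p (r + 1)) (q r) = V r"
    using circumcenter_cyclic[OF orient(2)[OF r]] circumcenter_cyclic[of "q (r + 1)" "q r" "p (r + 1)"]
      orient(2)[OF r]
    by (simp add: V_def cross2_def algebra_simps)
  then show ?thesis
    using up_cone_dual_edge[OF delaunay_crossing(3)[OF r]] crossing(3)[OF r] by (simp add: W_def)
qed

lemma up_WZ: "up_cone (W r) (Z r)"
proof -
  have "circumcenter (q (r + 2)) (p (r + 1)) (q (r + 1)) = W r"
    using circumcenter_cyclic[OF orient(3)[OF r]] circumcenter_cyclic[of "q (r + 2)" "q (r + 1)" "p (r + 1)"]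
      orient(3)[OF r]
    by (simp add: W_def cross2_def algebra_simps)
  then show ?thesis
    using up_cone_dual_edge[OF delaunay_crossing(4)[OF r]] crossing(4)[OF r] by (simp add: Z_def)
qed

lemma up_ZU: "up_cone (Z r) (U (r + 2))"
proof -
  have r2: "even (r + 2)" using r by simp
  have "circumcenter (q (r + 2)) (p (r + 2)) (p (r + 1)) = Z r"
    using circumcenter_cyclic[OF orient(4)[OF r]] by (simp add: Z_def)
  moreover have "p (r + 2 - 1) = p (r + 1)" by (simp add: algebra_simps)
  ultimately show ?thesis
    using up_cone_dual_edge[OF delaunay_crossing(1)[OF r2]] crossing(1)[OF r2] by (simp add: U_def)
qed

lemma up_UU: "up_cone (U r) (U (r + 2))"
  using up_UV up_VW up_WZ up_ZU up_cone_trans by blast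

end

text \<open>To the right of the edge lies the triangle of \<open>U r\<close>; to its left, the
  translate by \<open>- (100 + 4 * \<i>)\<close> of the triangle of \<open>V (r + 4)\<close>, with
  apex \<open>p (r + 5)\<close>. \<open>V (r + 4)\<close> is reached from \<open>U r\<close> within
  one turn, as \<open>steep_edge\<close> requires. Odd edges use \<open>Z r\<close> and
  \<open>W (r + 4)\<close> in the same way.\<close>

lemma ring_edge_even:
  assumes r: "even r"
  shows "Im (p (r + 1) - p r) > 0" "\<bar>Re (p (r + 1) - p r)\<bar> \<le> Im (p (r + 1) - p r) / 8"
proof -
  have e: "even (r + 2)" "even (r + 4)" "even (r + 6)" "even (r + 8)" using r by auto
  have uu: "up_cone (U r) (U (r + 2))" "up_cone (U (r + 2)) (U (r + 4))" "up_cone (U (r + 4)) (U (r + 6))"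
     "up_cone (U (r + 6)) (U (r + 8))" "up_cone (U (r + 8)) (U (r + 10))"
    using up_UU[OF r] up_UU[OF e(1)] up_UU[OF e(2)] up_UU[OF e(3)] up_UU[OF e(4)]
    by (simp_all add: algebra_simps)
  have 1: "up_cone (U r) (V (r + 4))"
    using uu(1,2) up_UV[OF e(2)] up_cone_trans by blast
  have "up_cone (V (r + 4)) (U (r + 6))"
    using up_cone_trans[OF up_VW[OF e(2)] up_cone_trans[OF up_WZ[OF e(2)] up_ZU[OF e(2)]]]
    by (simp add: algebra_simps)
  then have 2: "up_cone (V (r + 4)) (U r + 10 * \<i>)"
    using uu(4,5) up_cone_trans unfolding U_period by blast
  have qq: "q (r + 4) = p r + (100 + 4 * \<i>)" "q (r + 5) = p (r + 1) + (100 + 4 * \<i>)"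
    by (simp_all add: q_def algebra_simps)
  have "circumcenter (p r) (p (r + 1)) (p (r + 5) - (100 + 4 * \<i>)) + (100 + 4 * \<i>) = V (r + 4)"
    using circumcenter_cyclic[OF orient(2)[OF e(2)]] qq
      circumcenter_translate[of "p r" "100 + 4 * \<i>" "p (r + 1)" "p (r + 5) - (100 + 4 * \<i>)"]
    by (simp add: V_def add.assoc)
  moreover have "circumcenter (p (r + 1)) (p r) (q r) = U r"
    using circumcenter_cyclic[OF orient(1)[OF r]]
      circumcenter_cyclic[of "p (r + 1)" "q r" "p r"] orient(1)[OF r]
    by (simp add: U_def cross2_def algebra_simps)
  ultimately have "circumcenter (p r) (p (r + 1)) (p (r + 5) - (100 + 4 * \<i>))
      - circumcenter (p (r + 1)) (p r) (q r) = V (r + 4) - U r - (100 + 4 * \<i>)"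
    by (simp add: algebra_simps)
  from steep_edge[OF delaunay_ring(1)[OF r] this 1 2]
  show "Im (p (r + 1) - p r) > 0" "\<bar>Re (p (r + 1) - p r)\<bar> \<le> Im (p (r + 1) - p r) / 8" by simp_all
qed

lemma ring_edge_odd:
  assumes r: "even r"
  shows "Im (p (r + 2) - p (r + 1)) > 0"
    "\<bar>Re (p (r + 2) - p (r + 1))\<bar> \<le> Im (p (r + 2) - p (r + 1)) / 8"
proof -
  have e: "even (r + 2)" "even (r + 4)" "even (r + 6)" "even (r + 8)" "even (r + 10)" using r by auto
  have uu: "up_cone (U r) (U (r + 2))" "up_cone (U (r + 2)) (U (r + 4))" "up_cone (U (r + 4)) (U (r + 6))"
     "up_cone (U (r + 6)) (U (r + 8))" "up_cone (U (r + 8)) (U (r + 10))"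
    using up_UU[OF r] up_UU[OF e(1)] up_UU[OF e(2)] up_UU[OF e(3)] up_UU[OF e(4)]
    by (simp_all add: algebra_simps)
  have "up_cone (U (r + 4)) (W (r + 4))"
    using up_UV[OF e(2)] up_VW[OF e(2)] up_cone_trans by blast
  then have 1: "up_cone (Z r) (W (r + 4))"
    using uu(2) up_ZU[OF r] up_cone_trans by blast
  have "up_cone (W (r + 4)) (U (r + 6))"
    using up_cone_trans[OF up_WZ[OF e(2)] up_ZU[OF e(2)]] by (simp add: algebra_simps)
  moreover have "up_cone (U (r + 10)) (Z (r + 10))"
    using up_UV[OF e(5)] up_VW[OF e(5)] up_WZ[OF e(5)] up_cone_trans by blast
  ultimately have 2: "up_cone (W (r + 4)) (Z r + 10 * \<i>)"
    using uu(4,5) up_cone_trans unfolding Z_period by blast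
  have qq: "q (r + 5) = p (r + 1) + (100 + 4 * \<i>)" "q (r + 6) = p (r + 2) + (100 + 4 * \<i>)"
    by (simp_all add: q_def algebra_simps)
  have "circumcenter (p (r + 1)) (p (r + 2)) (p (r + 5) - (100 + 4 * \<i>)) + (100 + 4 * \<i>) = W (r + 4)"
    using circumcenter_cyclic[OF orient(3)[OF e(2)]] qq
      circumcenter_translate[of "p (r + 1)" "100 + 4 * \<i>" "p (r + 2)" "p (r + 5) - (100 + 4 * \<i>)"]
    by (simp add: W_def add.assoc)
  moreover have "circumcenter (p (r + 2)) (p (r + 1)) (q (r + 2)) = Z r"
    using circumcenter_cyclic[OF orient(4)[OF r]]
      circumcenter_cyclic[of "p (r + 2)" "q (r + 2)" "p (r + 1)"] orient(4)[OF r]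
    by (simp add: Z_def cross2_def algebra_simps)
  ultimately have "circumcenter (p (r + 1)) (p (r + 2)) (p (r + 5) - (100 + 4 * \<i>))
      - circumcenter (p (r + 2)) (p (r + 1)) (q (r + 2)) = W (r + 4) - Z r - (100 + 4 * \<i>)"
    by (simp add: algebra_simps)
  from steep_edge[OF delaunay_ring(2)[OF r] this 1 2]
  show "Im (p (r + 2) - p (r + 1)) > 0"
    "\<bar>Re (p (r + 2) - p (r + 1))\<bar> \<le> Im (p (r + 2) - p (r + 1)) / 8" by simp_all
qed

lemma ring_edge:
  "Im (p (r + 1)) > Im (p r)" "\<bar>Re (p (r + 1)) - Re (p r)\<bar> \<le> (Im (p (r + 1)) - Im (p r)) / 8"
proof -
  have "Im (p (r + 1)) > Im (p r) \<and> \<bar>Re (p (r + 1)) - Re (p r)\<bar> \<le> (Im (p (r + 1)) - Im (p r)) / 8"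
  proof (cases "even r")
    case True then show ?thesis using ring_edge_even[of r] by simp
  next
    case False
    then have "even (r - 1)" by simp
    from ring_edge_odd[OF this] show ?thesis by (simp add: add.commute)
  qed
  then show "Im (p (r + 1)) > Im (p r)"
    "\<bar>Re (p (r + 1)) - Re (p r)\<bar> \<le> (Im (p (r + 1)) - Im (p r)) / 8" by auto
qed

lemma ring_path:
  assumes "r \<le> s"
  shows "\<bar>Re (p s) - Re (p r)\<bar> \<le> (Im (p s) - Im (p r)) / 8"
  using assms
proof (induction s rule: int_ge_induct)
  case base then show ?case by simp
next
  case (step i) then show ?case using ring_edge(2)[of i] ring_edge(1)[of i] by (smt (verit) diff_divide_distrib)
qed

text \<open>The path estimate makes every climb nonnegative, and a full turn climbs exactly 10; so
  part of a turn climbs at most 10 and drifts at most 10 / 8.\<close>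

lemma ring_close:
  assumes "r \<le> s" "s \<le> r + 10"
  shows "\<bar>Re (p s) - Re (p r)\<bar> \<le> 5 / 4" "\<bar>Im (p s) - Im (p r)\<bar> \<le> 10"
proof -
  have "Re (p (r + 10)) = Re (p r)" "Im (p (r + 10)) = Im (p r) + 10" by (simp_all add: period)
  with ring_path[OF assms(1)] ring_path[OF assms(2)]
  show "\<bar>Re (p s) - Re (p r)\<bar> \<le> 5 / 4" "\<bar>Im (p s) - Im (p r)\<bar> \<le> 10"
    by argo+
qed

text \<open>A crossing edge joins a ring point to the translate of a ring point at most five indices
  earlier, so it equals \<open>100 + 4 * \<i>\<close> minus a part of one turn.\<close>

lemma crossing_close:
  shows "\<bar>Re (q r - p r) - 100\<bar> \<le> 5 / 4" "\<bar>Im (q r - p r)\<bar> \<le> 14"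
    and "\<bar>Re (q r - p (r + 1)) - 100\<bar> \<le> 5 / 4" "\<bar>Im (q r - p (r + 1))\<bar> \<le> 14"
    and "\<bar>Re (q (r + 2) - p (r + 1)) - 100\<bar> \<le> 5 / 4" "\<bar>Im (q (r + 2) - p (r + 1))\<bar> \<le> 14"
proof -
  show "\<bar>Re (q r - p r) - 100\<bar> \<le> 5 / 4" "\<bar>Im (q r - p r)\<bar> \<le> 14"
    using ring_close[of "r - 4" r] by (auto simp: q_def abs_minus_commute)
  show "\<bar>Re (q r - p (r + 1)) - 100\<bar> \<le> 5 / 4" "\<bar>Im (q r - p (r + 1))\<bar> \<le> 14"
    using ring_close[of "r - 4" "r + 1"] by (auto simp: q_def abs_minus_commute)
  have *: "r + 2 - 4 = r - 2" by simp
  show "\<bar>Re (q (r + 2) - p (r + 1)) - 100\<bar> \<le> 5 / 4" "\<bar>Im (q (r + 2) - p (r + 1))\<bar> \<le> 14"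
    using ring_close[of "r - 2" "r + 1"] unfolding q_def * by (auto simp: abs_minus_commute)
qed

end

section \<open>Angles and the local Delaunay condition\<close>

text \<open>The arccosine forgets the sign of the sine; positive orientation restores it, so the
  angle is an argument of \<open>cnj x * y\<close> and angles can be added by multiplying.\<close>

lemma cis_vec_angle:
  assumes "cross2 x y > 0"
  shows "cis (vec_angle x y) = cnj x * y / (norm x * norm y)"
    and "0 < vec_angle x y" "vec_angle x y < pi"
proof -
  have nz: "x \<noteq> 0" "y \<noteq> 0" using assms by (auto simp: cross2_def)
  define N where "N = norm x * norm y"
  have N: "N > 0" using nz by (simp add: N_def)
  have sq: "(x \<bullet> y)\<^sup>2 + (cross2 x y)\<^sup>2 = N\<^sup>2"
    unfolding N_def power_mult_distrib cmod_power2
    by (simp add: inner_complex_def cross2_def power2_eq_square algebra_simps)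
  define c where "c = (x \<bullet> y) / N"
  have c2: "1 - c\<^sup>2 = (cross2 x y / N)\<^sup>2"
    using sq N by (simp add: c_def power_divide field_simps)
  then have "c\<^sup>2 < 1" using assms N by (smt (verit) divide_pos_pos zero_less_power)
  then have c1: "-1 < c" "c < 1" using abs_square_less_1[of c] by auto
  have va: "vec_angle x y = arccos c" by (simp add: vec_angle_def c_def N_def)
  show "0 < vec_angle x y" "vec_angle x y < pi"
    using arccos_lt_bounded[OF c1] va by auto
  have "cos (vec_angle x y) = c" "sin (vec_angle x y) = cross2 x y / N"
    using c1 va c2 assms N by (simp_all add: sin_arccos)
  then show "cis (vec_angle x y) = cnj x * y / (norm x * norm y)"
    by (simp add: complex_eq_iff c_def cross2_def inner_complex_def N_def[symmetric]
        of_real_mult[symmetric] del: of_real_mult)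
qed

lemma vec_angle_commute: "vec_angle x y = vec_angle y x"
  by (simp add: vec_angle_def inner_commute mult.commute)

text \<open>In the product of the three unit numbers every edge meets its own conjugate with
  opposite sign, which leaves -1. The sum is thus an odd multiple of \<pi>, and it lies strictly
  between 0 and 3\<pi>.\<close>

lemma triangle_angle_sum:
  assumes "cross2 (v - u) (w - u) > 0"
  shows "vec_angle (v - u) (w - u) + vec_angle (w - v) (u - v) + vec_angle (u - w) (v - w) = pi"
proof -
  have cr: "cross2 (w - v) (u - v) > 0" "cross2 (u - w) (v - w) > 0"
    using assms by (simp_all add: cross2_def algebra_simps)
  let ?s = "vec_angle (v - u) (w - u) + vec_angle (w - v) (u - v) + vec_angle (u - w) (v - w)"
  have n: "norm (u - w) = norm (w - u)" "norm (u - v) = norm (v - u)" "norm (v - w) = norm (w - v)"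
    by (simp_all add: norm_minus_commute)
  have nz: "w \<noteq> u" "v \<noteq> u" "w \<noteq> v" using assms by (auto simp: cross2_def)
  have "cis ?s = cnj (v - u) * (w - u) / (norm (v - u) * norm (w - u)) *
      (cnj (w - v) * (u - v) / (norm (w - v) * norm (u - v))) *
      (cnj (u - w) * (v - w) / (norm (u - w) * norm (v - w)))"
    by (simp only: cis_vec_angle(1)[OF assms] cis_vec_angle(1)[OF cr(1)] cis_vec_angle(1)[OF cr(2)]
        flip: cis_mult)
  also have "\<dots> = - (((v - u) * cnj (v - u)) * ((w - v) * cnj (w - v)) * ((w - u) * cnj (w - u)))
      / (of_real ((norm (v - u))\<^sup>2) * of_real ((norm (w - v))\<^sup>2) * of_real ((norm (w - u))\<^sup>2))"
    unfolding n by (simp add: power2_eq_square field_simps)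
  also have "\<dots> = -1"
    using nz unfolding complex_norm_square by simp
  finally have "cos ?s = -1" by (simp add: complex_eq_iff)
  then obtain k :: int where k: "?s = (2 * of_int k + 1) * pi"
    unfolding cos_eq_minus1 by (auto simp: algebra_simps)
  have "?s > 0" "?s < 3 * pi"
    using cis_vec_angle(2,3)[OF assms] cis_vec_angle(2,3)[OF cr(1)] cis_vec_angle(2,3)[OF cr(2)] by linarith+
  then have "(2 * of_int k + 1) * pi > 0 * pi" "(2 * of_int k + 1) * pi < 3 * pi" using k by auto
  then have "2 * real_of_int k + 1 > 0" "2 * real_of_int k + 1 < 3"
    unfolding mult_less_cancel_right using pi_gt_zero by auto
  then have "k = 0" by linarith
  then show ?thesis using k by simp
qed

text \<open>By the two angle sums the six-term expression equals 2 * (\<pi> - a - a') for the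
  opposite angles a and a'; the sign of \<pi> - a - a' is that of sin (a + a'), hence of the
  cotangent sum.\<close>

lemma delaunay_angles_iff:
  assumes l: "cross2 (v - u) (w - u) > 0" and r: "cross2 (v - u) (w' - u) < 0"
  shows "vec_angle (v - u) (w - u) + vec_angle (u - v) (w - v)
      + vec_angle (v - u) (w' - u) + vec_angle (u - v) (w' - v)
      - vec_angle (u - w) (v - w) - vec_angle (u - w') (v - w') > 0
    \<longleftrightarrow> locally_delaunay u v w w'"
proof -
  let ?a = "vec_angle (u - w) (v - w)" and ?b = "vec_angle (v - w') (u - w')"
  have r': "cross2 (u - v) (w' - v) > 0" using r by (simp add: cross2_def algebra_simps)
  have cr: "cross2 (u - w) (v - w) > 0" "cross2 (v - w') (u - w') > 0"
    using l r by (simp_all add: cross2_def algebra_simps)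
  have *: "cot_at w u v = cot (vec_angle (u - w) (v - w))" if "cross2 (u - w) (v - w) > 0" for u v w
  proof -
    have nz: "u - w \<noteq> 0" "v - w \<noteq> 0" using that by (auto simp: cross2_def)
    have eqs: "cos (vec_angle (u - w) (v - w)) = ((u - w) \<bullet> (v - w)) / (norm (u - w) * norm (v - w))"
      "sin (vec_angle (u - w) (v - w)) = cross2 (u - w) (v - w) / (norm (u - w) * norm (v - w))"
      using arg_cong[OF cis_vec_angle(1)[OF that], of Re] arg_cong[OF cis_vec_angle(1)[OF that], of Im]
      by (simp_all add: cross2_def inner_complex_def of_real_mult[symmetric] algebra_simps del: of_real_mult)
    show ?thesis unfolding cot_def cot_at_def eqs using nz by simp
  qed
  have s: "sin ?a > 0" "sin ?b > 0"
    using cis_vec_angle(2,3)[OF cr(1)] cis_vec_angle(2,3)[OF cr(2)] by (simp_all add: sin_gt_zero)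
  have "cot_at w u v + cot_at w' v u = cot ?a + cot ?b" using *[OF cr(1)] *[OF cr(2)] by simp
  also have "\<dots> = sin (?a + ?b) / (sin ?a * sin ?b)"
    using s by (simp add: cot_def sin_add field_simps)
  finally have "locally_delaunay u v w w' \<longleftrightarrow> sin (?a + ?b) > 0"
    using s by (auto simp: locally_delaunay_def zero_less_divide_iff mult_less_0_iff)
  also have "\<dots> \<longleftrightarrow> ?a + ?b < pi"
  proof
    assume "?a + ?b < pi"
    then show "sin (?a + ?b) > 0"
      using cis_vec_angle(2)[OF cr(1)] cis_vec_angle(2)[OF cr(2)] by (intro sin_gt_zero) auto
  next
    assume "sin (?a + ?b) > 0"
    then show "?a + ?b < pi"
      using cis_vec_angle(3)[OF cr(1)] cis_vec_angle(3)[OF cr(2)] sin_le_zero[of "?a + ?b"] by linarith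
  qed
  finally show ?thesis
    using triangle_angle_sum[OF l] triangle_angle_sum[OF r']
    unfolding vec_angle_commute[of "w - v"] vec_angle_commute[of "w' - u"]
      vec_angle_commute[of "u - w'"] by (smt (verit))
qed

section \<open>A ten-vertex complex on the moment curve\<close>

text \<open>Attaches the exponents 1 to 5 to the coordinates by an arbitrary bijection; later
  arguments use polynomials on the curve and are insensitive to its choice.\<close>

definition coord_index :: "5 \<Rightarrow> nat" where
  "coord_index = (SOME b. bij_betw b UNIV {1..5})"

lemma bij_coord_index: "bij_betw coord_index UNIV {1..5}"
proof -
  have "\<exists>b. bij_betw b (UNIV :: 5 set) {1..5::nat}"
    by (rule finite_same_card_bij) auto
  then show ?thesis unfolding coord_index_def by (rule someI_ex)
qed

definition vt :: "int \<Rightarrow> real ^ 5" where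
  "vt k = (\<chi> j. real_of_int (k mod 10) ^ coord_index j)"

text \<open>The linear functional that restricts on the moment curve to the polynomial
  \<open>q\<close> without its constant term, for degree at most five.\<close>

definition ev :: "real poly \<Rightarrow> real ^ 5 \<Rightarrow> real" where
  "ev q x = (\<Sum>j\<in>UNIV. coeff q (coord_index j) * x $ j)"

lemma vt_mod [simp]: "vt (k mod 10) = vt k"
  by (simp add: vt_def)

lemma linear_ev: "linear (ev q)"
  by (intro linearI) (simp_all add: ev_def algebra_simps sum.distrib sum_distrib_left)

lemma ev_vt:
  assumes "degree q \<le> 5"
  shows "coeff q 0 + ev q (vt k) = poly q (of_int (k mod 10))"
proof -
  have "ev q (vt k) = (\<Sum>i\<in>{1..5}. coeff q i * of_int (k mod 10) ^ i)"
    unfolding ev_def vt_def using sum.reindex_bij_betw[OF bij_coord_index] by simp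
  moreover have "poly q (of_int (k mod 10)) = (\<Sum>i\<le>5. coeff q i * of_int (k mod 10) ^ i)"
    unfolding poly_altdef
    using assms by (intro sum.mono_neutral_left) (auto simp: coeff_eq_0)
  moreover have "{..5::nat} = insert 0 {1..5}" by auto
  ultimately show ?thesis by simp
qed

text \<open>Points on the moment curve of \<open>\<real>\<^sup>5\<close> are in general position: any six are affinely
  independent, because a polynomial of degree five can vanish at all but one of them.\<close>

lemma moment_general_position:
  assumes A: "A \<subseteq> {0..<10}" "card A \<le> 6"
    and c: "(\<Sum>a\<in>A. c a) = 0" "(\<Sum>a\<in>A. c a *\<^sub>R vt a) = 0" and b: "b \<in> A"
  shows "c b = 0"
proof -
  have fin: "finite A" using A(1) finite_subset by blast
  define q where "q = (\<Prod>m\<in>A - {b}. [:- real_of_int m, 1:])"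
  have "degree q = (\<Sum>m\<in>A - {b}. degree [:- real_of_int m, 1:])"
    unfolding q_def by (rule degree_prod_sum_eq) auto
  also have "\<dots> = card A - 1" using b by simp
  finally have deg: "degree q \<le> 5" using A(2) by simp
  have "0 = (\<Sum>a\<in>A. c a) * coeff q 0 + ev q (\<Sum>a\<in>A. c a *\<^sub>R vt a)"
    using c linear_ev[of q] by (simp add: linear_0)
  also have "\<dots> = (\<Sum>a\<in>A. c a * (coeff q 0 + ev q (vt a)))"
    by (simp add: linear_sum[OF linear_ev] linear_cmul[OF linear_ev] sum_distrib_right
        sum.distrib distrib_left)
  also have "\<dots> = (\<Sum>a\<in>A. c a * poly q (of_int a))"
  proof (rule sum.cong)
    fix a assume "a \<in> A"
    then have "a mod 10 = a" using A(1) by auto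
    then show "c a * (coeff q 0 + ev q (vt a)) = c a * poly q (of_int a)"
      using ev_vt[OF deg, of a] by simp
  qed simp
  also have "\<dots> = c b * poly q (of_int b) + (\<Sum>a\<in>A - {b}. c a * poly q (of_int a))"
    using fin b by (simp add: sum.remove)
  also have "(\<Sum>a\<in>A - {b}. c a * poly q (of_int a)) = 0"
  proof (rule sum.neutral, rule ballI)
    fix a assume "a \<in> A - {b}"
    then have "poly q (of_int a) = 0"
      unfolding q_def poly_prod using fin by (intro prod_zero) auto
    then show "c a * poly q (of_int a) = 0" by simp
  qed
  finally have "c b * poly q (of_int b) = 0" by simp
  moreover have "poly q (of_int b) \<noteq> 0"
    unfolding q_def poly_prod using fin by (simp add: prod_zero_iff)
  ultimately show ?thesis by simp
qed

lemma inj_on_vt: "inj_on vt {0..<10}"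
proof (rule inj_onI)
  fix a b :: int assume ab: "a \<in> {0..<10}" "b \<in> {0..<10}" "vt a = vt b"
  have "degree [:0, 1::real:] \<le> 5" by simp
  from ev_vt[OF this, of a] ev_vt[OF this, of b] ab show "a = b" by simp
qed

lemma vt_eq_iff: "vt a = vt b \<longleftrightarrow> a mod 10 = b mod 10"
  using inj_on_eq_iff[OF inj_on_vt, of "a mod 10" "b mod 10"] by simp

lemma affine_independent_vt:
  assumes A: "A \<subseteq> {0..<10}" "card A \<le> 6"
  shows "\<not> affine_dependent (vt ` A)"
proof -
  have fin: "finite A" using A(1) finite_subset by blast
  have inj: "inj_on vt A" using inj_on_vt A(1) inj_on_subset by blast
  show ?thesis
    unfolding affine_dependent_explicit_finite[OF finite_imageI[OF fin]]
    using moment_general_position[OF A, of "U \<circ> vt" for U]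
    by (auto simp: sum.reindex[OF inj])
qed

lemma convex_hull_vt:
  assumes A: "A \<subseteq> {0..<10}"
  shows "x \<in> convex hull (vt ` A) \<longleftrightarrow>
    (\<exists>w. (\<forall>a\<in>A. 0 \<le> w a) \<and> sum w A = 1 \<and> (\<Sum>a\<in>A. w a *\<^sub>R vt a) = x)" (is "?L \<longleftrightarrow> ?R")
proof -
  have fin: "finite A" using A finite_subset by blast
  have inj: "inj_on vt A" using inj_on_vt A inj_on_subset by blast
  show ?thesis
  proof
    assume ?L
    then obtain u where "\<forall>x\<in>vt ` A. 0 \<le> u x" "sum u (vt ` A) = 1" "(\<Sum>x\<in>vt ` A. u x *\<^sub>R x) = x"
      unfolding convex_hull_finite[OF finite_imageI[OF fin]] by blast
    then show ?R by (intro exI[of _ "u \<circ> vt"]) (simp add: sum.reindex[OF inj])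
  next
    assume ?R
    then obtain w where w: "\<forall>a\<in>A. 0 \<le> w a" "sum w A = 1" "(\<Sum>a\<in>A. w a *\<^sub>R vt a) = x" by blast
    define u where "u = w \<circ> the_inv_into A vt"
    have "u (vt a) = w a" if "a \<in> A" for a
      using that by (simp add: u_def the_inv_into_f_f[OF inj])
    then show ?L
      unfolding convex_hull_finite[OF finite_imageI[OF fin]]
      using w by (auto simp: sum.reindex[OF inj] intro!: exI[of _ u] sum.cong)
  qed
qed

lemma barycentric_unique:
  assumes A: "A \<subseteq> {0..<10}" "card A \<le> 6"
    and "sum v A = sum w A" "(\<Sum>a\<in>A. v a *\<^sub>R vt a) = (\<Sum>a\<in>A. w a *\<^sub>R vt a)" "a \<in> A"
  shows "v a = w a"
  using moment_general_position[OF A, of "\<lambda>a. v a - w a"] assms(3-5)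
  by (simp add: sum_subtractf scaleR_diff_left)

lemma sum_extend_zero:
  assumes "finite B" "A \<subseteq> B"
  shows "(\<Sum>b\<in>B. (if b \<in> A then w b else 0)) = sum w A"
    and "(\<Sum>b\<in>B. (if b \<in> A then w b else 0) *\<^sub>R (f b :: 'v :: real_vector)) = (\<Sum>a\<in>A. w a *\<^sub>R f a)"
  using assms by (auto simp: if_distrib[of "\<lambda>c. c *\<^sub>R _"] sum.If_cases Int_absorb1 cong: if_cong)

text \<open>Both families of weights, extended by zero to \<open>A \<union> B\<close>, represent the
  same point over at most six labels. Uniqueness of barycentric coordinates makes them equal, hence
  zero off \<open>A \<inter> B\<close>.\<close>

lemma convex_hull_vt_Int:
  assumes A: "A \<subseteq> {0..<10}" and B: "B \<subseteq> {0..<10}" and card: "card (A \<union> B) \<le> 6"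
  shows "convex hull (vt ` A) \<inter> convex hull (vt ` B) = convex hull (vt ` (A \<inter> B))"
proof
  show "convex hull (vt ` (A \<inter> B)) \<subseteq> convex hull (vt ` A) \<inter> convex hull (vt ` B)"
    by (intro Int_greatest hull_mono) auto
  show "convex hull (vt ` A) \<inter> convex hull (vt ` B) \<subseteq> convex hull (vt ` (A \<inter> B))"
  proof
    fix x assume "x \<in> convex hull (vt ` A) \<inter> convex hull (vt ` B)"
    then obtain v w where v: "\<forall>a\<in>A. 0 \<le> v a" "sum v A = 1" "(\<Sum>a\<in>A. v a *\<^sub>R vt a) = x"
      and w: "\<forall>a\<in>B. 0 \<le> w a" "sum w B = 1" "(\<Sum>a\<in>B. w a *\<^sub>R vt a) = x"
      unfolding convex_hull_vt[OF A] convex_hull_vt[OF B] Int_iff by blast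
    have fin: "finite (A \<union> B)" "finite A" using A B finite_subset by blast+
    have AB: "A \<union> B \<subseteq> {0..<10}" using A B by blast
    define v' w' where "v' = (\<lambda>a. if a \<in> A then v a else 0)" and "w' = (\<lambda>a. if a \<in> B then w a else 0)"
    have v': "sum v' (A \<union> B) = 1" "(\<Sum>a\<in>A \<union> B. v' a *\<^sub>R vt a) = x"
      using sum_extend_zero(1)[OF fin(1) Un_upper1, of v] sum_extend_zero(2)[OF fin(1) Un_upper1, of v vt] v(2,3)
      unfolding v'_def by (simp_all only:)
    have w': "sum w' (A \<union> B) = 1" "(\<Sum>a\<in>A \<union> B. w' a *\<^sub>R vt a) = x"
      using sum_extend_zero(1)[OF fin(1) Un_upper2, of w] sum_extend_zero(2)[OF fin(1) Un_upper2, of w vt] w(2,3)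
      unfolding w'_def by (simp_all only:)
    have eq: "v' a = w' a" if "a \<in> A \<union> B" for a
      by (rule barycentric_unique[OF AB card _ _ that]) (simp_all only: v' w')
    then have zero: "v a = 0" if "a \<in> A - A \<inter> B" for a using that eq[of a] by (simp add: v'_def w'_def)
    have "sum v (A \<inter> B) = 1"
      using v(2) sum.mono_neutral_right[OF fin(2), of "A \<inter> B" v] zero by auto
    moreover have "(\<Sum>a\<in>A \<inter> B. v a *\<^sub>R vt a) = x"
      using v(3) sum.mono_neutral_right[OF fin(2), of "A \<inter> B" "\<lambda>a. v a *\<^sub>R vt a"] zero by auto
    ultimately show "x \<in> convex hull (vt ` (A \<inter> B))"
      using v(1) A by (subst convex_hull_vt) auto
  qed
qed

section \<open>The simplicial complex and its combinatorics\<close>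

text \<open>With label x + 3y, the steps (1,0), (0,1) and (1,1) add 1, 3 and 4; the two triples are
  the halves of a unit square cut along its diagonal.\<close>

definition tri_labels :: "int set set" where
  "tri_labels = (\<Union>i. {{i mod 10, (i + 1) mod 10, (i + 4) mod 10},
                      {i mod 10, (i + 3) mod 10, (i + 4) mod 10}})"

definition T10 :: "(real ^ 5) set set" where
  "T10 = {convex hull (vt ` c) | c t. t \<in> tri_labels \<and> c \<subseteq> t}"

lemma mod10_distinct:
  "(i + j) mod (10::int) = (i + k) mod 10 \<longleftrightarrow> j mod 10 = k mod 10"
  "i mod (10::int) = (i + k) mod 10 \<longleftrightarrow> k mod 10 = 0"
  "(i + j) mod (10::int) = i mod 10 \<longleftrightarrow> j mod 10 = 0"
  by (simp_all add: mod_eq_dvd_iff mod_eq_0_iff_dvd)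

lemma tri_labelsD:
  assumes "t \<in> tri_labels"
  shows "t \<subseteq> {0..<10}" "card t = 3" "finite t"
  using assms by (auto simp: tri_labels_def card_insert_if mod10_distinct)

lemma simplex_vt:
  assumes "t \<in> tri_labels" "c \<subseteq> t"
  shows "(int (card c) - 1) simplex (convex hull (vt ` c))" "\<not> affine_dependent (vt ` c)"
    "card c \<le> 3" "c \<subseteq> {0..<10}"
proof -
  show c: "c \<subseteq> {0..<10}" "card c \<le> 3"
    using tri_labelsD[OF assms(1)] assms(2) card_mono[of t c] by auto
  show i: "\<not> affine_dependent (vt ` c)" using affine_independent_vt[OF c(1)] c(2) by simp
  have "card (vt ` c) = card c" using card_image inj_on_subset[OF inj_on_vt c(1)] by blast
  then show "(int (card c) - 1) simplex (convex hull (vt ` c))"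
    using i by (intro simplex_convex_hull) simp
qed

lemma simplicial_complex_T10: "simplicial_complex T10"
  unfolding simplicial_complex_def
proof (intro conjI ballI allI impI)
  have "T10 \<subseteq> (\<lambda>c. convex hull (vt ` c)) ` Pow {0..<10}"
    unfolding T10_def using tri_labelsD(1) by blast
  then show "finite T10" using finite_subset by blast
next
  fix S assume "S \<in> T10" then show "\<exists>n. n simplex S"
    unfolding T10_def using simplex_vt(1) by blast
next
  fix F S assume "S \<in> T10 \<and> F face_of S"
  then obtain c t where c: "t \<in> tri_labels" "c \<subseteq> t" "F face_of (convex hull (vt ` c))"
    unfolding T10_def by blast
  then obtain d where "d \<subseteq> vt ` c" "F = convex hull d"
    using face_of_convex_hull_affine_independent[OF simplex_vt(2)[OF c(1,2)], of F] c(3) by blast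
  then obtain e where "e \<subseteq> c" "F = convex hull (vt ` e)" by (auto simp: subset_image_iff)
  then show "F \<in> T10" unfolding T10_def using c by blast
next
  fix S S' assume "S \<in> T10 \<and> S' \<in> T10"
  then obtain c t c' t' where c: "t \<in> tri_labels" "c \<subseteq> t" "S = convex hull (vt ` c)"
     and c': "t' \<in> tri_labels" "c' \<subseteq> t'" "S' = convex hull (vt ` c')"
    unfolding T10_def by blast
  \<comment> \<open>Two triangles have at most six vertices in all, which is the reach of general
    position in dimension five.\<close>
  have "card (c \<union> c') \<le> 6"
    using simplex_vt(3)[OF c(1,2)] simplex_vt(3)[OF c'(1,2)] card_Un_le[of c c'] by linarith
  then have "S \<inter> S' = convex hull (vt ` (c \<inter> c'))"
    unfolding c c' using convex_hull_vt_Int[OF simplex_vt(4)[OF c(1,2)] simplex_vt(4)[OF c'(1,2)]] by simp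
  then show "S \<inter> S' face_of S"
    unfolding c(3) face_of_convex_hull_affine_independent[OF simplex_vt(2)[OF c(1,2)]]
    by (intro exI[of _ "vt ` (c \<inter> c')"]) auto
qed

lemma two_dim_complex_T10: "two_dim_complex T10"
  unfolding two_dim_complex_def
proof (intro conjI ballI simplicial_complex_T10)
  show "aff_dim S \<le> 2" if S: "S \<in> T10" for S
  proof -
    obtain c t where c: "t \<in> tri_labels" "c \<subseteq> t" "S = convex hull (vt ` c)"
      using S unfolding T10_def by blast
    then show ?thesis
      using aff_dim_simplex[OF simplex_vt(1)[OF c(1,2)]] simplex_vt(3)[OF c(1,2)] by simp
  qed
  let ?t = "{0 mod 10, (0 + 1) mod 10, (0 + 4) mod (10::int)}"
  have t: "?t \<in> tri_labels" unfolding tri_labels_def by (rule UN_I[of 0]) simp_all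
  then have "convex hull (vt ` ?t) \<in> T10" unfolding T10_def by (intro CollectI exI[of _ ?t]) simp
  moreover have "aff_dim (convex hull (vt ` ?t)) = 2"
    using aff_dim_simplex[OF simplex_vt(1)[OF t subset_refl]] tri_labelsD(2)[OF t] by simp
  ultimately show "\<exists>S\<in>T10. aff_dim S = 2" by blast
qed

definition steps :: "int set" where "steps = {1, 3, 4, -1, -3, -4}"

lemma steps_mod: "x \<in> steps \<Longrightarrow> x mod 10 \<noteq> 0"
  by (auto simp: steps_def)

text \<open>The link of a vertex is a hexagon; its edges join the consecutive steps
  \<open>1, 4, 3, -1, -4, -3\<close>.\<close>

definition link :: "(int \<times> int) set" where
  "link = {(1, 4), (4, 1), (4, 3), (3, 4), (3, -1), (-1, 3),
           (-1, -4), (-4, -1), (-4, -3), (-3, -4), (-3, 1), (1, -3)}"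

lemma tri_labels_iff:
  "t \<in> tri_labels \<longleftrightarrow> (\<exists>i. \<exists>D\<in>{{0, 1, 4}, {0, 3, 4}}. t = (\<lambda>d. (i + d) mod 10) ` D)"
  by (auto simp: tri_labels_def)

lemma tri_labelsE:
  assumes "t \<in> tri_labels"
  obtains i D where "D = {0, 1, 4} \<or> D = {0, 3, 4}" "t = (\<lambda>d. (i + d) mod 10) ` D"
  using assms unfolding tri_labels_iff by blast

text \<open>Passes from residues to integers: the representatives are chosen so that their
  difference is one of the six small steps, by which edge vectors are indexed.\<close>

lemma tri_labels_pair:
  assumes "t \<in> tri_labels" "p \<in> t" "q \<in> t" "p \<noteq> q"
  obtains a x where "x \<in> steps" "vt p = vt a" "vt q = vt (a + x)"
proof -
  obtain i D where D: "D = {0, 1, 4} \<or> D = {0, 3, 4}" and t: "t = (\<lambda>d. (i + d) mod 10) ` D"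
    using tri_labelsE[OF assms(1)] .
  obtain d where d: "d \<in> D" "p = (i + d) mod 10" using assms(2) unfolding t by (rule imageE)
  obtain e where e: "e \<in> D" "q = (i + e) mod 10" using assms(3) unfolding t by (rule imageE)
  have "d \<noteq> e" using assms(4) d e by auto
  then have "e - d \<in> steps" using D d(1) e(1) by (auto simp: steps_def)
  then show ?thesis using d e by (intro that[of "e - d" "i + d"]) simp_all
qed

lemma tri_labels_triple:
  assumes "t \<in> tri_labels" "p \<in> t" "q \<in> t" "r \<in> t" "p \<noteq> q" "p \<noteq> r" "q \<noteq> r"
  obtains a x y where "(x, y) \<in> link" "vt p = vt a" "vt q = vt (a + x)" "vt r = vt (a + y)"
proof -
  obtain i D where D: "D = {0, 1, 4} \<or> D = {0, 3, 4}" and t: "t = (\<lambda>d. (i + d) mod 10) ` D"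
    using tri_labelsE[OF assms(1)] .
  obtain d where d: "d \<in> D" "p = (i + d) mod 10" using assms(2) unfolding t by (rule imageE)
  obtain e where e: "e \<in> D" "q = (i + e) mod 10" using assms(3) unfolding t by (rule imageE)
  obtain f where f: "f \<in> D" "r = (i + f) mod 10" using assms(4) unfolding t by (rule imageE)
  have "d \<noteq> e" "d \<noteq> f" "e \<noteq> f" using assms(5-7) d e f by auto
  note ne = this
  from D have "(e - d, f - d) \<in> link"
  proof
    assume "D = {0, 1, 4}"
    then have "d = 0 \<or> d = 1 \<or> d = 4" "e = 0 \<or> e = 1 \<or> e = 4" "f = 0 \<or> f = 1 \<or> f = 4"
      using d e f by auto
    then show ?thesis using ne by (elim disjE) (simp_all add: link_def)
  next
    assume "D = {0, 3, 4}"
    then have "d = 0 \<or> d = 3 \<or> d = 4" "e = 0 \<or> e = 3 \<or> e = 4" "f = 0 \<or> f = 3 \<or> f = 4"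
      using d e f by auto
    then show ?thesis using ne by (elim disjE) (simp_all add: link_def)
  qed
  then show ?thesis using d e f by (intro that[of "e - d" "f - d" "i + d"]) simp_all
qed

lemma link_tri_labels:
  assumes "(x, y) \<in> link"
  shows "{a mod 10, (a + x) mod 10, (a + y) mod 10} \<in> tri_labels"
proof -
  \<comment> \<open>The shift that makes the smallest of the three offsets \<open>0\<close>,
    \<open>x\<close>, \<open>y\<close> equal to zero.\<close>
  define d where "d = max 0 (max (- x) (- y))"
  have D: "{d, d + x, d + y} = {0, 1, 4} \<or> {d, d + x, d + y} = {0, 3, 4}"
    using assms unfolding link_def by (elim insertE emptyE) (simp_all add: d_def insert_commute)
  have "{a mod 10, (a + x) mod 10, (a + y) mod 10} = (\<lambda>e. (a - d + e) mod 10) ` {d, d + x, d + y}"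
    by (simp add: algebra_simps)
  then show ?thesis unfolding tri_labels_iff using D by (metis insertCI)
qed

text \<open>Points of an affinely independent \<open>C\<close> are extreme in the hull and so belong
  to any spanning set \<open>B\<close>. This recovers vertices from edges and triangles, which are
  given as mere point sets.\<close>

lemma hull_eq_vertices:
  fixes B C :: "'a :: euclidean_space set"
  assumes c: "\<not> affine_dependent C" and eq: "convex hull B = convex hull C"
    and fin: "finite B" and card: "card B \<le> card C"
  shows "B = C"
proof -
  have "C \<subseteq> B"
    using extreme_point_of_convex_hull_affine_independent[OF c] extreme_point_of_convex_hull[of _ B] eq
    by auto
  then show ?thesis using card_seteq[OF fin _ card] by blast
qed

lemma simplex_of_T10:
  assumes "S \<in> T10" "n simplex S"
  obtains c t where "t \<in> tri_labels" "c \<subseteq> t" "S = convex hull (vt ` c)" "int (card c) = n + 1"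
     "card (vt ` c) = card c" "\<not> affine_dependent (vt ` c)"
proof -
  obtain c t where c: "t \<in> tri_labels" "c \<subseteq> t" "S = convex hull (vt ` c)"
    using assms(1) unfolding T10_def by blast
  have "n = int (card c) - 1"
    using aff_dim_simplex[OF assms(2)] aff_dim_simplex[OF simplex_vt(1)[OF c(1,2)]] c(3) by simp
  moreover have "card (vt ` c) = card c"
    using card_image inj_on_subset[OF inj_on_vt simplex_vt(4)[OF c(1,2)]] by blast
  ultimately show ?thesis using that[OF c] simplex_vt(2)[OF c(1,2)] by simp
qed

lemma edges_T10D:
  assumes "convex hull {u, v} \<in> edges T10"
  obtains a x where "x \<in> steps" "u = vt a" "v = vt (a + x)"
proof -
  have *: "convex hull {u, v} \<in> T10" "1 simplex (convex hull {u, v})"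
    using assms by (auto simp: edges_def)
  obtain c t where c: "t \<in> tri_labels" "c \<subseteq> t" "convex hull {u, v} = convex hull (vt ` c)"
      "int (card c) = 1 + 1" "card (vt ` c) = card c" "\<not> affine_dependent (vt ` c)"
    by (rule simplex_of_T10[OF *])
  have uv: "{u, v} = vt ` c"
    by (rule hull_eq_vertices[OF c(6,3)]) (use c(4,5) card_insert_le_m1[of 2 "{v}" u] in auto)
  have "card {u, v} = 2" using c(4,5) unfolding uv by simp
  then have "u \<noteq> v" by auto
  have "u \<in> vt ` c" "v \<in> vt ` c" unfolding uv[symmetric] by simp_all
  then obtain p q where pq: "p \<in> c" "q \<in> c" "u = vt p" "v = vt q" by (elim imageE)
  with \<open>u \<noteq> v\<close> have "p \<noteq> q" by blast
  obtain a x where "x \<in> steps" "vt p = vt a" "vt q = vt (a + x)"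
    by (rule tri_labels_pair[OF c(1) _ _ \<open>p \<noteq> q\<close>]) (use pq c(2) in auto)
  then show ?thesis using that pq by simp
qed

lemma triangles_T10D:
  assumes "convex hull {u, v, w} \<in> triangles T10"
  obtains a x y where "(x, y) \<in> link" "u = vt a" "v = vt (a + x)" "w = vt (a + y)"
proof -
  have *: "convex hull {u, v, w} \<in> T10" "2 simplex (convex hull {u, v, w})"
    using assms by (auto simp: triangles_def)
  obtain c t where c: "t \<in> tri_labels" "c \<subseteq> t" "convex hull {u, v, w} = convex hull (vt ` c)"
      "int (card c) = 2 + 1" "card (vt ` c) = card c" "\<not> affine_dependent (vt ` c)"
    by (rule simplex_of_T10[OF *])
  have uv: "{u, v, w} = vt ` c"
    by (rule hull_eq_vertices[OF c(6,3)]) (use c(4,5) in \<open>auto simp: card_insert_if\<close>)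
  have "card {u, v, w} = 3" using c(4,5) unfolding uv by simp
  then have ne: "u \<noteq> v" "u \<noteq> w" "v \<noteq> w" by (auto simp: card_insert_if split: if_splits)
  have "u \<in> vt ` c" "v \<in> vt ` c" "w \<in> vt ` c" unfolding uv[symmetric] by simp_all
  then obtain p q r where pq: "p \<in> c" "q \<in> c" "r \<in> c" "u = vt p" "v = vt q" "w = vt r"
    by (elim imageE)
  with ne have ne': "p \<noteq> q" "p \<noteq> r" "q \<noteq> r" by blast+
  obtain a x y where "(x, y) \<in> link" "vt p = vt a" "vt q = vt (a + x)" "vt r = vt (a + y)"
    by (rule tri_labels_triple[OF c(1) _ _ _ ne']) (use pq c(2) in auto)
  then show ?thesis using that pq by simp
qed

lemma triangle_in_T10:
  assumes "(x, y) \<in> link"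
  shows "convex hull {vt a, vt (a + x), vt (a + y)} \<in> triangles T10"
proof -
  let ?t = "{a mod 10, (a + x) mod 10, (a + y) mod 10}"
  have t: "?t \<in> tri_labels" by (rule link_tri_labels[OF assms])
  have "vt ` ?t = {vt a, vt (a + x), vt (a + y)}" by simp
  moreover have "2 simplex (convex hull (vt ` ?t))"
    using simplex_vt(1)[OF t subset_refl] tri_labelsD(2)[OF t] by simp
  moreover have "convex hull (vt ` ?t) \<in> T10" unfolding T10_def using t by blast
  ultimately show ?thesis by (simp add: triangles_def)
qed

lemma steps_link: "x \<in> steps \<Longrightarrow> \<exists>y. (x, y) \<in> link"
  by (auto simp: steps_def link_def)

lemma edge_in_T10:
  assumes "x \<in> steps"
  shows "convex hull {vt a, vt (a + x)} \<in> edges T10"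
proof -
  obtain y where "(x, y) \<in> link" using steps_link[OF assms] by blast
  then have t: "{a mod 10, (a + x) mod 10, (a + y) mod 10} \<in> tri_labels" by (rule link_tri_labels)
  let ?c = "{a mod 10, (a + x) mod 10}"
  have "?c \<subseteq> {a mod 10, (a + x) mod 10, (a + y) mod 10}" by auto
  note c = t this
  have "card ?c = 2" using steps_mod[OF assms] by (simp add: mod10_distinct)
  then have "1 simplex (convex hull (vt ` ?c))" using simplex_vt(1)[OF c] by simp
  moreover have "convex hull (vt ` ?c) \<in> T10" unfolding T10_def using c by blast
  ultimately show ?thesis by (simp add: edges_def)
qed

lemma affine_independent_link:
  assumes "(x, y) \<in> link"
  shows "\<not> affine_dependent {vt a, vt (a + x), vt (a + y)}"
  using simplex_vt(2)[OF link_tri_labels[OF assms] subset_refl, of a] by simp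

lemma steps_vt_neq: "x \<in> steps \<Longrightarrow> vt a \<noteq> vt (a + x)"
  using steps_mod[of x] by (simp add: vt_eq_iff mod10_distinct)

lemma vt_not_in_opposite_edge:
  assumes "(x, y) \<in> link"
  shows "vt a \<notin> closed_segment (vt (a + x)) (vt (a + y))"
proof -
  have ne: "vt a \<noteq> vt (a + x)" "vt a \<noteq> vt (a + y)"
    using assms steps_vt_neq[of x a] steps_vt_neq[of y a] by (auto simp: link_def steps_def)
  show ?thesis
  proof
    assume "vt a \<in> closed_segment (vt (a + x)) (vt (a + y))"
    then have "vt a \<in> convex hull {vt (a + x), vt (a + y)}" by (simp add: segment_convex_hull)
    then have "vt a \<in> affine hull ({vt a, vt (a + x), vt (a + y)} - {vt a})"
      using ne convex_hull_subset_affine_hull[of "{vt (a + x), vt (a + y)}"]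
      by (auto simp: insert_Diff_if)
    then show False using affine_independent_link[OF assms, of a] unfolding affine_dependent_def by blast
  qed
qed

section \<open>The marking homeomorphism\<close>

text \<open>The generators are \<open>plane 3 (-1)\<close> and \<open>plane 5 (-5)\<close>, a basis
  of the index-ten sublattice x + 3y = 0 mod 10; the second is vertical and spans the thin
  direction.\<close>

definition Lam :: "complex set" where
  "Lam = {of_int m * (100 + 4 * \<i>) + of_int n * (10 * \<i>) | m n. True}"

lemma is_lattice_Lam: "is_lattice Lam"
proof -
  have "(100 + 4 * \<i>) \<noteq> 10 * \<i>" by (simp add: complex_eq_iff)
  moreover have "independent {100 + 4 * \<i>, 10 * \<i>}"
    by (subst independent_insert) (auto simp: span_singleton complex_eq_iff)
  ultimately show ?thesis unfolding is_lattice_def Lam_def by blast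
qed

abbreviation torus :: "complex set topology" where
  "torus \<equiv> mtopology_of (flat_torus Lam)"

abbreviation proj :: "complex \<Rightarrow> complex set" where
  "proj \<equiv> torus_proj Lam"

lemma proj_eq_iff: "proj z = proj w \<longleftrightarrow> w - z \<in> Lam"
  by (rule torus_proj_eq_iff[OF is_lattice_Lam])

lemma topspace_torus: "topspace torus = range proj"
  by (simp add: mspace_flat_torus[OF is_lattice_Lam])

lemma Hausdorff_torus: "Hausdorff_space torus"
  using Metric_space.Hausdorff_space_mtopology[OF Metric_space_flat_torus[OF is_lattice_Lam]]
  by (simp add: mtopology_of_def mspace_flat_torus mdist_flat_torus is_lattice_Lam)

lemma continuous_map_proj: "continuous_map euclidean torus proj"
  using quotient_map_torus_proj[OF is_lattice_Lam] quotient_imp_continuous_map by blast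

text \<open>In the coordinates \<open>z = x * (50 + \<i>) + y * (50 - \<i>)\<close> the lattice is
  \<open>x + 3 * y \<equiv> 0 mod 10\<close>.\<close>

definition plane :: "real \<Rightarrow> real \<Rightarrow> complex" where
  "plane x y = x *\<^sub>R (50 + \<i>) + y *\<^sub>R (50 - \<i>)"

lemma plane_sel [simp]: "Re (plane x y) = 50 * (x + y)" "Im (plane x y) = x - y"
  by (simp_all add: plane_def)

lemma plane_surj: "plane ((Re z / 50 + Im z) / 2) ((Re z / 50 - Im z) / 2) = z"
  by (simp add: complex_eq_iff field_simps)

lemma plane_diff: "plane x y - plane x' y' = plane (x - x') (y - y')"
  by (simp add: complex_eq_iff)

lemma plane_in_Lam:
  "plane x y \<in> Lam \<longleftrightarrow> (\<exists>m n. x = of_int m \<and> y = of_int n \<and> (m + 3 * n) mod 10 = 0)"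
proof
  assume "plane x y \<in> Lam"
  then obtain m n where "plane x y = of_int m * (100 + 4 * \<i>) + of_int n * (10 * \<i>)"
    by (auto simp: Lam_def)
  then have "50 * (x + y) = 100 * of_int m" "x - y = 4 * of_int m + 10 * of_int n"
    by (simp_all add: complex_eq_iff)
  then have "x = of_int (3 * m + 5 * n)" "y = of_int (- m - 5 * n)" by simp_all
  moreover have "(3 * m + 5 * n + 3 * (- m - 5 * n)) mod 10 = 0" by (simp add: algebra_simps)
  ultimately show "\<exists>m n. x = of_int m \<and> y = of_int n \<and> (m + 3 * n) mod 10 = 0"
    by (intro exI conjI)
next
  assume "\<exists>m n. x = of_int m \<and> y = of_int n \<and> (m + 3 * n) mod 10 = 0"
  then obtain m n where mn: "x = of_int m" "y = of_int n" "10 dvd m + 3 * n" by auto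
  then obtain k where k: "m + 3 * n = 10 * k" by (auto elim: dvdE)
  then have m: "m = 10 * k - 3 * n" by simp
  have "plane x y = of_int (5 * k - n) * (100 + 4 * \<i>) + of_int (- k) * (10 * \<i>)"
    by (simp add: complex_eq_iff mn m algebra_simps)
  then show "plane x y \<in> Lam" unfolding Lam_def by blast
qed

section \<open>Unit squares and their barycentric coordinates\<close>

text \<open>The unit square with lower left corner \<open>i\<close>, mapped affinely on each half;
  the maxima and the minimum merge the formulas of the two triangles into one.\<close>

definition cell :: "int \<Rightarrow> real \<Rightarrow> real \<Rightarrow> real ^ 5" where
  "cell i s t = (1 - max s t) *\<^sub>R vt i + max (s - t) 0 *\<^sub>R vt (i + 1)
     + max (t - s) 0 *\<^sub>R vt (i + 3) + min s t *\<^sub>R vt (i + 4)"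

lemma vt_cong: "i mod 10 = j mod 10 \<Longrightarrow> vt (i + x) = vt (j + x)"
  unfolding vt_eq_iff by (rule mod_add_cong) auto

lemma cell_cong: "i mod 10 = j mod 10 \<Longrightarrow> cell i s t = cell j s t"
  using vt_cong[of i j 0] vt_cong[of i j] by (simp add: cell_def)

lemma cell_right: "0 \<le> t \<Longrightarrow> t \<le> 1 \<Longrightarrow> cell i 1 t = cell (i + 1) 0 t"
  by (simp add: cell_def max_def min_def algebra_simps)

lemma cell_top: "0 \<le> s \<Longrightarrow> s \<le> 1 \<Longrightarrow> cell i s 1 = cell (i + 3) s 0"
  by (simp add: cell_def max_def min_def algebra_simps)

definition weight :: "int \<Rightarrow> real \<Rightarrow> real \<Rightarrow> int \<Rightarrow> real" where
  "weight i s t a =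
     (if a mod 10 = i mod 10 then 1 - max s t
      else if a mod 10 = (i + 1) mod 10 then max (s - t) 0
      else if a mod 10 = (i + 3) mod 10 then max (t - s) 0
      else if a mod 10 = (i + 4) mod 10 then min s t else 0)"

lemma weight_vals:
  "weight i s t i = 1 - max s t" "weight i s t (i + 1) = max (s - t) 0"
  "weight i s t (i + 3) = max (t - s) 0" "weight i s t (i + 4) = min s t"
  by (simp_all add: weight_def mod10_distinct)

lemma weight_mod [simp]: "weight i s t (a mod 10) = weight i s t a"
  by (simp add: weight_def)

lemma weight_cong: "i mod 10 = j mod 10 \<Longrightarrow> weight i s t a = weight j s t a"
proof -
  assume ij: "i mod 10 = j mod 10"
  have "(i + k) mod 10 = (j + k) mod 10" for k by (rule mod_add_cong[OF ij refl])
  then show ?thesis unfolding weight_def ij by (simp only:)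
qed

lemma weight_nonzero:
  assumes "weight i s t a \<noteq> 0"
  shows "a mod 10 = i mod 10 \<or> a mod 10 = (i + 1) mod 10 \<and> t < s
    \<or> a mod 10 = (i + 3) mod 10 \<and> s < t \<or> a mod 10 = (i + 4) mod 10"
proof -
  have *: "P \<or> Q \<and> t < s \<or> R \<and> s < t \<or> S"
    if "(if P then x else if Q then max (s - t) 0 else if R then max (t - s) 0 else if S then y else 0) \<noteq> 0"
    for P Q R S and x y :: real
    using that by (auto split: if_splits)
  show ?thesis using assms unfolding weight_def by (rule *)
qed

lemma weight_sum:
  "(\<Sum>a\<in>{0..<10}. weight i s t a *\<^sub>R f a) =
    (1 - max s t) *\<^sub>R f (i mod 10) + max (s - t) 0 *\<^sub>R f ((i + 1) mod 10)
     + max (t - s) 0 *\<^sub>R f ((i + 3) mod 10) + min s t *\<^sub>R (f ((i + 4) mod 10) :: 'v :: real_vector)"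
proof -
  let ?B = "{i mod 10, (i + 1) mod 10, (i + 3) mod 10, (i + 4) mod 10}"
  have "(\<Sum>a\<in>{0..<10}. weight i s t a *\<^sub>R f a) = (\<Sum>a\<in>?B. weight i s t a *\<^sub>R f a)"
    by (rule sum.mono_neutral_right) (auto simp: weight_def)
  then show ?thesis by (simp add: mod10_distinct weight_vals add.assoc)
qed

lemma weight_sum_one: "(\<Sum>a\<in>{0..<10}. weight i s t a) = 1"
  using weight_sum[of i s t "\<lambda>_. 1::real"] by (simp add: max_def min_def)

lemma weight_sum_vt: "(\<Sum>a\<in>{0..<10}. weight i s t a *\<^sub>R vt a) = cell i s t"
  by (simp add: weight_sum cell_def)

text \<open>One of the two off-diagonal weights vanishes, so the support lies in a single triangle
  and two supports together stay within six labels.\<close>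

lemma card_weight_support: "card {a \<in> {0..<10}. weight i s t a \<noteq> 0} \<le> 3"
proof -
  define D :: int where "D = (if t \<le> s then 1 else 3)"
  have "{a \<in> {0..<10}. weight i s t a \<noteq> 0} \<subseteq> {i mod 10, (i + D) mod 10, (i + 4) mod 10}"
  proof
    fix a assume "a \<in> {a \<in> {0..<10}. weight i s t a \<noteq> 0}"
    then have "a mod 10 = a" "weight i s t a \<noteq> 0" by auto
    then show "a \<in> {i mod 10, (i + D) mod 10, (i + 4) mod 10}"
      using weight_nonzero[of i s t a] unfolding D_def by (cases "t \<le> s") auto
  qed
  then have "card {a \<in> {0..<10}. weight i s t a \<noteq> 0} \<le> card {i mod 10, (i + D) mod 10, (i + 4) mod 10}"
    by (intro card_mono) auto
  also have "\<dots> \<le> 3" by (simp add: card_insert_if)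
  finally show ?thesis .
qed

lemma cell_weight_unique:
  assumes "cell i s t = cell j s' t'"
  shows "weight i s t a = weight j s' t' a"
proof -
  let ?w = "weight i s t" and ?v = "weight j s' t'"
  let ?A = "{a \<in> {0..<10}. ?w a \<noteq> 0} \<union> {a \<in> {0..<10}. ?v a \<noteq> 0}"
  have A: "?A \<subseteq> {0..<10}" "card ?A \<le> 6"
    using card_weight_support[of i s t] card_weight_support[of j s' t']
      card_Un_le[of "{a \<in> {0..<10}. ?w a \<noteq> 0}" "{a \<in> {0..<10}. ?v a \<noteq> 0}"] by auto
  have s: "sum ?w ?A = 1" "sum ?v ?A = 1"
    "(\<Sum>a\<in>?A. ?w a *\<^sub>R vt a) = cell i s t" "(\<Sum>a\<in>?A. ?v a *\<^sub>R vt a) = cell j s' t'"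
  proof -
    have "sum ?w ?A = sum ?w {0..<10}" "sum ?v ?A = sum ?v {0..<10}"
      "(\<Sum>a\<in>?A. ?w a *\<^sub>R vt a) = (\<Sum>a\<in>{0..<10}. ?w a *\<^sub>R vt a)"
      "(\<Sum>a\<in>?A. ?v a *\<^sub>R vt a) = (\<Sum>a\<in>{0..<10}. ?v a *\<^sub>R vt a)"
      by (rule sum.mono_neutral_left, auto)+
    then show "sum ?w ?A = 1" "sum ?v ?A = 1"
      "(\<Sum>a\<in>?A. ?w a *\<^sub>R vt a) = cell i s t" "(\<Sum>a\<in>?A. ?v a *\<^sub>R vt a) = cell j s' t'"
      unfolding weight_sum_one weight_sum_vt .
  qed
  have "?w (a mod 10) = ?v (a mod 10)"
  proof (cases "a mod 10 \<in> ?A")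
    case True
    show ?thesis by (rule barycentric_unique[OF A _ _ True]) (simp_all only: s assms)
  next
    case False
    then show ?thesis by simp
  qed
  then show ?thesis by simp
qed

text \<open>On the half-open square the corner has positive weight. If the corners differed, both
  \<open>i - j\<close> and \<open>j - i\<close> would be 1, 3 or 4 mod 10, but no two of these
  numbers add up to 0 mod 10.\<close>

lemma cell_inject:
  assumes eq: "cell i s t = cell j s' t'" and s: "0 \<le> s" "s < 1" "0 \<le> t" "t < 1"
    and s': "0 \<le> s'" "s' < 1" "0 \<le> t'" "t' < 1"
  shows "i mod 10 = j mod 10" "s = s'" "t = t'"
proof -
  note w = cell_weight_unique[OF eq]
  show ij: "i mod 10 = j mod 10"
  proof (rule ccontr)
    assume ne: "i mod 10 \<noteq> j mod 10"
    have 1: "weight j s' t' i \<noteq> 0" using w[of i] s by (simp add: weight_vals)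
    have 2: "weight i s t j \<noteq> 0" using w[of j] s' by (simp add: weight_vals)
    have d: "10 dvd (i - j) - 1 \<or> 10 dvd (i - j) - 3 \<or> 10 dvd (i - j) - 4"
      using weight_nonzero[OF 1] ne unfolding mod_eq_dvd_iff diff_diff_eq by blast
    have d': "10 dvd (j - i) - 1 \<or> 10 dvd (j - i) - 3 \<or> 10 dvd (j - i) - 4"
      using weight_nonzero[OF 2] ne[symmetric] unfolding mod_eq_dvd_iff diff_diff_eq by blast
    from d d' show False by presburger
  qed
  have "weight i s t a = weight i s' t' a" for a using w weight_cong[OF ij] by simp
  from this[of "i + 1"] this[of "i + 3"] this[of "i + 4"]
  have "max (s - t) 0 = max (s' - t') 0" "max (t - s) 0 = max (t' - s') 0" "min s t = min s' t'"
    by (simp_all add: weight_vals)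
  then show "s = s'" "t = t'" by linarith+
qed

text \<open>The universal covering of the realized complex.\<close>

definition wrap :: "complex \<Rightarrow> real ^ 5" where
  "wrap z = (let x = (Re z / 50 + Im z) / 2; y = (Re z / 50 - Im z) / 2
     in cell (\<lfloor>x\<rfloor> + 3 * \<lfloor>y\<rfloor>) (frac x) (frac y))"

lemma wrap_plane: "wrap (plane x y) = cell (\<lfloor>x\<rfloor> + 3 * \<lfloor>y\<rfloor>) (frac x) (frac y)"
proof -
  have "(Re (plane x y) / 50 + Im (plane x y)) / 2 = x" "(Re (plane x y) / 50 - Im (plane x y)) / 2 = y"
    by (simp_all add: field_simps)
  then show ?thesis unfolding wrap_def by (simp only: Let_def)
qed

text \<open>On the right and top sides of the closed square the floors jump to the neighbouring
  cell; the gluing identities \<open>cell_right\<close> and \<open>cell_top\<close>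
  compensate.\<close>

lemma wrap_cell:
  assumes "0 \<le> s" "s \<le> 1" "0 \<le> t" "t \<le> 1"
  shows "wrap (plane (of_int i + s) t) = cell i s t"
proof -
  have f: "\<lfloor>x\<rfloor> = 0 \<and> frac x = x" if "0 \<le> x" "x < 1" for x :: real
    using that by (simp add: frac_eq floor_eq_iff)
  show ?thesis
  proof (cases "s = 1"; cases "t = 1")
    assume "s = 1" "t = 1"
    then show ?thesis
      using cell_right[of 1 i] cell_top[of 0 "i + 1"] by (simp add: wrap_plane algebra_simps)
  next
    assume "s = 1" "t \<noteq> 1"
    then show ?thesis using cell_right[of t i] assms f[of t] by (simp add: wrap_plane)
  next
    assume "s \<noteq> 1" "t = 1"
    then show ?thesis using cell_top[of s i] assms f[of s] by (simp add: wrap_plane)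
  next
    assume "s \<noteq> 1" "t \<noteq> 1"
    then show ?thesis using assms f[of s] f[of t] by (simp add: wrap_plane)
  qed
qed

lemma wrap_eq_iff: "wrap z = wrap w \<longleftrightarrow> w - z \<in> Lam"
proof -
  obtain x y where z: "z = plane x y" using plane_surj by metis
  obtain x' y' where w: "w = plane x' y'" using plane_surj by metis
  show ?thesis
  proof
    assume "wrap z = wrap w"
    from cell_inject[OF this[unfolded z w wrap_plane]]
    have *: "(\<lfloor>x\<rfloor> + 3 * \<lfloor>y\<rfloor>) mod 10 = (\<lfloor>x'\<rfloor> + 3 * \<lfloor>y'\<rfloor>) mod 10" "frac x = frac x'" "frac y = frac y'"
      by (simp_all add: frac_lt_1)
    then have "x' - x = of_int (\<lfloor>x'\<rfloor> - \<lfloor>x\<rfloor>)" "y' - y = of_int (\<lfloor>y'\<rfloor> - \<lfloor>y\<rfloor>)"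
      by (simp_all add: frac_def)
    moreover have "(\<lfloor>x'\<rfloor> - \<lfloor>x\<rfloor> + 3 * (\<lfloor>y'\<rfloor> - \<lfloor>y\<rfloor>)) mod 10 = 0"
      using *(1)[symmetric] unfolding mod_eq_dvd_iff by (simp add: algebra_simps dvd_imp_mod_0)
    ultimately show "w - z \<in> Lam" unfolding z w plane_diff plane_in_Lam by (intro exI conjI)
  next
    assume "w - z \<in> Lam"
    then obtain m n where mn: "x' - x = of_int m" "y' - y = of_int n" "(m + 3 * n) mod 10 = 0"
      unfolding z w plane_diff plane_in_Lam by (elim exE conjE) (rule that)
    then have *: "x' = x + of_int m" "y' = y + of_int n" by simp_all
    have **: "frac x' = frac x" "frac y' = frac y" unfolding * frac_def by simp_all
    have "(\<lfloor>x'\<rfloor> + 3 * \<lfloor>y'\<rfloor>) mod 10 = (\<lfloor>x\<rfloor> + 3 * \<lfloor>y\<rfloor>) mod 10"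
      unfolding * mod_eq_dvd_iff using mn(3) by (simp add: algebra_simps mod_0_imp_dvd)
    then show "wrap z = wrap w"
      unfolding z w wrap_plane ** using cell_cong by metis
  qed
qed

definition marking :: "real ^ 5 \<Rightarrow> complex set" where
  "marking x = proj (SOME z. wrap z = x)"

text \<open>\<open>wrap\<close> and \<open>proj\<close> have the same fibres, so the chosen preimage
  does not matter.\<close>

lemma marking_wrap: "marking (wrap z) = proj z"
proof -
  have "wrap (SOME w. wrap w = wrap z) = wrap z" by (rule someI[of _ z]) simp
  then show ?thesis unfolding marking_def proj_eq_iff wrap_eq_iff .
qed

lemma marking_cell:
  assumes "0 \<le> s" "s \<le> 1" "0 \<le> t" "t \<le> 1"
  shows "marking (cell i s t) = proj (plane (of_int i + s) t)"
  using marking_wrap wrap_cell[OF assms] by metis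

section \<open>Continuity and bijectivity of the marking\<close>

definition triA :: "int \<Rightarrow> (real ^ 5) set" where "triA i = convex hull {vt i, vt (i + 1), vt (i + 4)}"
definition triB :: "int \<Rightarrow> (real ^ 5) set" where "triB i = convex hull {vt i, vt (i + 3), vt (i + 4)}"

lemma triA_iff: "x \<in> triA i \<longleftrightarrow> (\<exists>s t. 0 \<le> t \<and> t \<le> s \<and> s \<le> 1 \<and> x = cell i s t)"
proof
  assume "x \<in> triA i"
  then obtain u v w where "0 \<le> u" "0 \<le> v" "0 \<le> w" "u + v + w = 1"
     "x = u *\<^sub>R vt i + v *\<^sub>R vt (i + 1) + w *\<^sub>R vt (i + 4)"
    unfolding triA_def convex_hull_3 by blast
  moreover then have "u = 1 - (v + w)" by simp
  ultimately show "\<exists>s t. 0 \<le> t \<and> t \<le> s \<and> s \<le> 1 \<and> x = cell i s t"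
    by (intro exI[of _ "v + w"] exI[of _ w]) (auto simp: cell_def)
next
  assume "\<exists>s t. 0 \<le> t \<and> t \<le> s \<and> s \<le> 1 \<and> x = cell i s t"
  then obtain s t where st: "0 \<le> t" "t \<le> s" "s \<le> 1" "x = cell i s t" by blast
  then have "x = (1 - s) *\<^sub>R vt i + (s - t) *\<^sub>R vt (i + 1) + t *\<^sub>R vt (i + 4)"
    by (simp add: cell_def)
  then show "x \<in> triA i"
    unfolding triA_def convex_hull_3 using st
    by (intro CollectI exI[of _ "1 - s"] exI[of _ "s - t"] exI[of _ t]) simp
qed

lemma triB_iff: "x \<in> triB i \<longleftrightarrow> (\<exists>s t. 0 \<le> s \<and> s \<le> t \<and> t \<le> 1 \<and> x = cell i s t)"
proof
  assume "x \<in> triB i"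
  then obtain u v w where "0 \<le> u" "0 \<le> v" "0 \<le> w" "u + v + w = 1"
     "x = u *\<^sub>R vt i + v *\<^sub>R vt (i + 3) + w *\<^sub>R vt (i + 4)"
    unfolding triB_def convex_hull_3 by blast
  moreover then have "u = 1 - (v + w)" by simp
  ultimately show "\<exists>s t. 0 \<le> s \<and> s \<le> t \<and> t \<le> 1 \<and> x = cell i s t"
    by (intro exI[of _ w] exI[of _ "v + w"]) (auto simp: cell_def)
next
  assume "\<exists>s t. 0 \<le> s \<and> s \<le> t \<and> t \<le> 1 \<and> x = cell i s t"
  then obtain s t where st: "0 \<le> s" "s \<le> t" "t \<le> 1" "x = cell i s t" by blast
  then have "x = (1 - t) *\<^sub>R vt i + (t - s) *\<^sub>R vt (i + 3) + s *\<^sub>R vt (i + 4)"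
    by (simp add: cell_def)
  then show "x \<in> triB i"
    unfolding triB_def convex_hull_3 using st
    by (intro CollectI exI[of _ "1 - t"] exI[of _ "t - s"] exI[of _ s]) simp
qed

lemma tri_cong: "i mod 10 = j mod 10 \<Longrightarrow> triA i = triA j" "i mod 10 = j mod 10 \<Longrightarrow> triB i = triB j"
  using vt_cong[of i j 0] vt_cong[of i j] by (simp_all add: triA_def triB_def)

lemma Union_T10: "\<Union>T10 = (\<Union>i\<in>{0..<10}. triA i \<union> triB i)"
proof
  show "(\<Union>i\<in>{0..<10}. triA i \<union> triB i) \<subseteq> \<Union>T10"
  proof -
    have "triA i \<in> T10" "triB i \<in> T10" for i
      using triangle_in_T10[of 1 4 i] triangle_in_T10[of 3 4 i]
      by (simp_all add: link_def triangles_def triA_def triB_def)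
    then show ?thesis by blast
  qed
  show "\<Union>T10 \<subseteq> (\<Union>i\<in>{0..<10}. triA i \<union> triB i)"
  proof
    fix x assume "x \<in> \<Union>T10"
    then obtain c t where t: "t \<in> tri_labels" "c \<subseteq> t" "x \<in> convex hull (vt ` c)"
      unfolding T10_def by blast
    then have x: "x \<in> convex hull (vt ` t)" using subsetD[OF hull_mono[OF image_mono[OF t(2)]] t(3)] by simp
    obtain i D where D: "D = {0, 1, 4} \<or> D = {0, 3, 4}" "t = (\<lambda>d. (i + d) mod 10) ` D"
      using tri_labelsE[OF t(1)] .
    then have "x \<in> triA i \<union> triB i" using x by (auto simp: triA_def triB_def)
    then have "x \<in> triA (i mod 10) \<union> triB (i mod 10)"
      using tri_cong[of "i mod 10" i] by simp
    then show "x \<in> (\<Union>i\<in>{0..<10}. triA i \<union> triB i)"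
      by (intro UN_I[of "i mod 10"]) auto
  qed
qed

lemma cell_in_T10:
  assumes "0 \<le> s" "s \<le> 1" "0 \<le> t" "t \<le> 1"
  shows "cell i s t \<in> \<Union>T10"
proof -
  have "cell (i mod 10) s t \<in> triA (i mod 10) \<union> triB (i mod 10)"
    using assms triA_iff triB_iff by (metis UnCI linear)
  then show ?thesis unfolding Union_T10 cell_cong[of "i mod 10" i, simplified, symmetric]
    by (intro UN_I[of "i mod 10"]) auto
qed

lemma T10_eq_range_wrap: "\<Union>T10 = range wrap"
proof
  show "\<Union>T10 \<subseteq> range wrap"
  proof
    fix x assume "x \<in> \<Union>T10"
    then obtain i where "x \<in> triA i \<union> triB i" unfolding Union_T10 by blast
    then obtain s t where x: "x = cell i s t" and "0 \<le> t \<and> t \<le> s \<and> s \<le> 1 \<or> 0 \<le> s \<and> s \<le> t \<and> t \<le> 1"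
      unfolding Un_iff triA_iff triB_iff by auto
    then have "0 \<le> s" "s \<le> 1" "0 \<le> t" "t \<le> 1" by linarith+
    from wrap_cell[OF this, of i] show "x \<in> range wrap" unfolding x by (metis rangeI)
  qed
  show "range wrap \<subseteq> \<Union>T10"
  proof
    fix x assume "x \<in> range wrap"
    then obtain z where "x = wrap z" by blast
    then show "x \<in> \<Union>T10"
      unfolding wrap_def Let_def using cell_in_T10 by (simp add: frac_lt_1 less_imp_le)
  qed
qed

text \<open>The Lagrange polynomial that is 1 at \<open>b\<close> and 0 at \<open>a\<close> and
  \<open>c\<close>, read as an affine function on the ambient space through \<open>ev\<close>. It
  gives the weight of \<open>b\<close> in the triangle, which makes the inverse of
  \<open>cell\<close> visibly continuous.\<close>

definition bary :: "int \<Rightarrow> int \<Rightarrow> int \<Rightarrow> real ^ 5 \<Rightarrow> real" where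
  "bary a b c x = (let A = real_of_int (a mod 10); B = real_of_int (b mod 10); C = real_of_int (c mod 10);
      q = smult (1 / ((B - A) * (B - C))) ([:- A, 1:] * [:- C, 1:])
    in coeff q 0 + ev q x)"

lemma continuous_on_bary: "continuous_on S (bary a b c)"
  unfolding bary_def Let_def
  by (intro continuous_intros linear_continuous_on linear_conv_bounded_linear[THEN iffD1] linear_ev)

lemma bary_eq:
  assumes ne: "a mod 10 \<noteq> b mod 10" "c mod 10 \<noteq> b mod 10" and uvw: "u + v + w = 1"
  shows "bary a b c (u *\<^sub>R vt a + v *\<^sub>R vt b + w *\<^sub>R vt c) = v"
proof -
  define A B C where ABC: "A = real_of_int (a mod 10)" "B = real_of_int (b mod 10)" "C = real_of_int (c mod 10)"
  define q where "q = smult (1 / ((B - A) * (B - C))) ([:- A, 1:] * [:- C, 1:])"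
  have deg: "degree q \<le> 5" by (simp add: q_def)
  have ne': "B \<noteq> A" "B \<noteq> C" using ne by (auto simp: ABC)
  have q: "poly q A = 0" "poly q C = 0" "poly q B = 1"
    using ne' by (simp_all add: q_def del: mult_pCons_left mult_pCons_right)
  have "bary a b c (u *\<^sub>R vt a + v *\<^sub>R vt b + w *\<^sub>R vt c) =
     (u + v + w) * coeff q 0 + ev q (u *\<^sub>R vt a + v *\<^sub>R vt b + w *\<^sub>R vt c)"
    unfolding bary_def Let_def uvw by (simp only: mult_1 flip: ABC q_def)
  also have "\<dots> = u * (coeff q 0 + ev q (vt a)) + v * (coeff q 0 + ev q (vt b)) + w * (coeff q 0 + ev q (vt c))"
    by (simp add: linear_add[OF linear_ev] linear_cmul[OF linear_ev] algebra_simps)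
  also have "\<dots> = v" by (simp add: ev_vt[OF deg] q flip: ABC)
  finally show ?thesis .
qed

lemma continuous_map_proj_comp:
  assumes "continuous_on S f"
  shows "continuous_map (top_of_set S) torus (\<lambda>x. proj (f x))"
  using continuous_map_compose[OF _ continuous_map_proj, of "top_of_set S" f] assms
  by (simp add: o_def)

lemma continuous_plane [continuous_intros]:
  "continuous_on S f \<Longrightarrow> continuous_on S g \<Longrightarrow> continuous_on S (\<lambda>x. plane (f x) (g x))"
  unfolding plane_def by (intro continuous_intros)

lemma continuous_marking_triA: "continuous_map (top_of_set (triA i)) torus marking"
proof (rule continuous_map_eq)
  let ?v = "bary i (i + 1) (i + 4)" and ?w = "bary (i + 1) (i + 4) i"
  show "continuous_map (top_of_set (triA i)) torus (\<lambda>x. proj (plane (of_int i + (?v x + ?w x)) (?w x)))"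
    by (intro continuous_map_proj_comp continuous_intros continuous_on_bary)
  fix x assume "x \<in> topspace (top_of_set (triA i))"
  then obtain s t where st: "0 \<le> t" "t \<le> s" "s \<le> 1" "x = cell i s t"
    by (auto simp: triA_iff)
  then have x: "x = (1 - s) *\<^sub>R vt i + (s - t) *\<^sub>R vt (i + 1) + t *\<^sub>R vt (i + 4)"
    by (simp add: cell_def)
  have "?v x = s - t" unfolding x by (rule bary_eq) (simp_all add: mod10_distinct)
  moreover have "?w ((s - t) *\<^sub>R vt (i + 1) + t *\<^sub>R vt (i + 4) + (1 - s) *\<^sub>R vt i) = t"
    by (rule bary_eq) (simp_all add: mod10_distinct)
  then have "?w x = t" unfolding x by (simp add: ac_simps)
  ultimately show "proj (plane (of_int i + (?v x + ?w x)) (?w x)) = marking x"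
    using st by (simp add: marking_cell)
qed

lemma continuous_marking_triB: "continuous_map (top_of_set (triB i)) torus marking"
proof (rule continuous_map_eq)
  let ?v = "bary i (i + 3) (i + 4)" and ?w = "bary (i + 3) (i + 4) i"
  show "continuous_map (top_of_set (triB i)) torus (\<lambda>x. proj (plane (of_int i + ?w x) (?v x + ?w x)))"
    by (intro continuous_map_proj_comp continuous_intros continuous_on_bary)
  fix x assume "x \<in> topspace (top_of_set (triB i))"
  then obtain s t where st: "0 \<le> s" "s \<le> t" "t \<le> 1" "x = cell i s t"
    by (auto simp: triB_iff)
  then have x: "x = (1 - t) *\<^sub>R vt i + (t - s) *\<^sub>R vt (i + 3) + s *\<^sub>R vt (i + 4)"
    by (simp add: cell_def)
  have "?v x = t - s" unfolding x by (rule bary_eq) (simp_all add: mod10_distinct)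
  moreover have "?w ((t - s) *\<^sub>R vt (i + 3) + s *\<^sub>R vt (i + 4) + (1 - t) *\<^sub>R vt i) = s"
    by (rule bary_eq) (simp_all add: mod10_distinct)
  then have "?w x = s" unfolding x by (simp add: ac_simps)
  ultimately show "proj (plane (of_int i + ?w x) (?v x + ?w x)) = marking x"
    using st by (simp add: marking_cell)
qed

lemma compact_tri: "compact (triA i)" "compact (triB i)"
  unfolding triA_def triB_def by (simp_all add: finite_imp_compact_convex_hull)

lemma compact_T10: "compact (\<Union>T10)"
  unfolding Union_T10 by (intro compact_UN compact_Un compact_tri) simp

lemma continuous_marking: "continuous_map (top_of_set (\<Union>T10)) torus marking"
proof -
  define tri where "tri = (\<lambda>(i, b). if b then triA i else triB i)"
  have sub: "tri j \<subseteq> \<Union>T10" if "j \<in> {0..<10} \<times> UNIV" for j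
    using that unfolding Union_T10 tri_def by (auto split: if_splits)
  show ?thesis
  proof (rule pasting_lemma_closed[where I = "{0..<10} \<times> UNIV" and T = tri and f = "\<lambda>_. marking"])
    fix j :: "int \<times> bool" assume j: "j \<in> {0..<10} \<times> UNIV"
    have "closed (tri j)"
      using compact_tri compact_imp_closed by (auto simp: tri_def split: prod.splits)
    then show "closedin (top_of_set (\<Union>T10)) (tri j)"
      using sub[OF j] by (simp add: closed_subset)
    show "continuous_map (subtopology (top_of_set (\<Union>T10)) (tri j)) torus marking"
      using continuous_marking_triA continuous_marking_triB Int_absorb1[OF sub[OF j]]
      by (auto simp: subtopology_subtopology tri_def split: prod.splits)
  next
    fix x assume "x \<in> topspace (top_of_set (\<Union>T10))"
    then obtain i where i: "i \<in> {0..<10}" "x \<in> triA i \<or> x \<in> triB i" unfolding Union_T10 by auto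
    then show "\<exists>j. j \<in> {0..<10} \<times> UNIV \<and> x \<in> tri j \<and> marking x = marking x"
      by (intro exI[of _ "(i, x \<in> triA i)"]) (auto simp: tri_def)
  qed auto
qed

lemma inj_on_marking: "inj_on marking (\<Union>T10)"
  unfolding T10_eq_range_wrap
  by (rule inj_onI) (auto simp: marking_wrap proj_eq_iff wrap_eq_iff)

lemma homeomorphic_map_marking: "homeomorphic_map (top_of_set (\<Union>T10)) torus marking"
proof (rule continuous_imp_homeomorphic_map[OF continuous_marking])
  show "compact_space (top_of_set (\<Union>T10))" using compact_T10 by (simp add: compact_space_subtopology)
  show "marking ` topspace (top_of_set (\<Union>T10)) = topspace torus"
    unfolding topspace_torus T10_eq_range_wrap by (auto simp: image_image marking_wrap)
qed (simp_all add: Hausdorff_torus inj_on_marking)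

section \<open>A family of geodesic maps\<close>

text \<open>The triangle wave with value 0 at the even and 1 at the odd integers.\<close>

definition wave :: "real \<Rightarrow> real" where "wave y = arccos (cos (pi * y)) / pi"

lemma continuous_wave: "continuous_on S wave"
  unfolding wave_def by (intro continuous_intros) auto

lemma wave_even:
  assumes "even n" "0 \<le> y" "y \<le> 1"
  shows "wave (of_int n + y) = y" "wave (of_int n - y) = y"
proof -
  obtain k where n: "n = 2 * k" using assms(1) by (auto elim: evenE)
  have e: "pi * (of_int n + y) = 2 * pi * of_int k + pi * y" "pi * (of_int n - y) = 2 * pi * of_int k - pi * y"
    by (simp_all add: n algebra_simps)
  have c: "cos (pi * (of_int n + y)) = cos (pi * y)" "cos (pi * (of_int n - y)) = cos (pi * y)"
    unfolding e cos_add cos_diff cos_int_2pin sin_int_2pin by simp_all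
  have "pi * y \<le> pi * 1" by (rule mult_left_mono) (use assms in auto)
  then have "arccos (cos (pi * y)) = pi * y" using assms by (intro arccos_cos) auto
  then show "wave (of_int n + y) = y" "wave (of_int n - y) = y" by (simp_all add: wave_def c)
qed

lemma wave_odd:
  assumes "odd n" "0 \<le> y" "y \<le> 1"
  shows "wave (of_int n + y) = 1 - y" "wave (of_int n - y) = 1 - y"
  using wave_even(2)[of "n + 1" "1 - y"] wave_even(1)[of "n - 1" "1 - y"] assms by simp_all

lemma wave_periodic: "even n \<Longrightarrow> wave (y + of_int n) = wave y"
proof -
  assume "even n"
  then obtain k where n: "n = 2 * k" by (auto elim: evenE)
  have e: "pi * (y + of_int n) = pi * y + 2 * pi * of_int k" by (simp add: n algebra_simps)
  show ?thesis unfolding wave_def e cos_add cos_int_2pin sin_int_2pin by simp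
qed

lemma Im_Lam:
  assumes "l \<in> Lam"
  obtains n where "even n" "Im l = of_int n"
proof -
  obtain x y where l: "l = plane x y" using plane_surj by metis
  obtain m n where mn: "x = of_int m" "y = of_int n" "(m + 3 * n) mod 10 = 0"
    using assms unfolding l plane_in_Lam by (elim exE conjE) (rule that)
  have "2 dvd m + 3 * n" using mn(3) by (metis dvd_trans mod_0_imp_dvd dvd_numeral_simp even_numeral)
  then have "even (m - n)" by simp
  then show ?thesis using that[of "m - n"] by (simp add: l mn)
qed

text \<open>Every representative gives the same value: \<open>Lam\<close> has even imaginary parts
  and \<open>wave\<close> has period 2.\<close>

definition wave_torus :: "complex set \<Rightarrow> real" where
  "wave_torus X = wave (Im (SOME z. z \<in> X))"

lemma proj_mem_iff: "w \<in> proj z \<longleftrightarrow> w - z \<in> Lam"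
  by (auto simp: torus_proj_def image_iff) (metis add.commute diff_add_cancel)

lemma wave_torus_proj: "wave_torus (proj z) = wave (Im z)"
proof -
  have "z \<in> proj z" using is_lattice_add_closed(1)[OF is_lattice_Lam] by (simp add: proj_mem_iff)
  then have "(SOME w. w \<in> proj z) \<in> proj z" by (rule someI)
  then obtain n where "even n" "Im ((SOME w. w \<in> proj z) - z) = of_int n"
    unfolding proj_mem_iff by (rule Im_Lam)
  then show ?thesis
    using wave_periodic[of n "Im z"] by (simp add: wave_torus_def algebra_simps)
qed

lemma continuous_wave_torus: "continuous_map torus euclidean wave_torus"
proof -
  have "continuous_on UNIV (\<lambda>z. wave (Im z))"
    by (rule continuous_on_compose2[OF continuous_wave[of UNIV]]) (auto intro: continuous_intros)
  then have "continuous_map euclidean euclidean (wave_torus \<circ> proj)"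
    by (simp add: o_def wave_torus_proj)
  then show ?thesis
    using continuous_compose_quotient_map_eq[OF quotient_map_torus_proj[OF is_lattice_Lam]] by blast
qed

lemma translate_proj: "(\<lambda>z. z + c) ` proj w = proj (w + c)"
  by (auto simp: torus_proj_def image_image algebra_simps)

lemma setdist_proj_le: "setdist (proj z) (proj w) \<le> dist z w"
  by (rule setdist_le_dist) (simp_all add: proj_mem_iff is_lattice_add_closed(1)[OF is_lattice_Lam])

lemma setdist_proj_lessD:
  assumes "setdist (proj z) (proj w) < e"
  obtains w' where "proj w' = proj w" "dist z w' < e"
proof -
  have "setdist {z} (proj w) < e" using assms by (simp add: setdist_torus_proj[OF is_lattice_Lam])
  moreover have "proj w \<noteq> {}" using is_lattice_add_closed(1)[OF is_lattice_Lam] by (auto simp: torus_proj_def)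
  ultimately obtain w' where w': "w' \<in> proj w" "dist z w' < e" by (auto elim!: setdist_ltE)
  then have "proj w' = proj w" unfolding proj_mem_iff by (metis proj_eq_iff)
  then show ?thesis using that w'(2) by blast
qed

lemma torus_eq_mtopology: "torus = Metric_space.mtopology (range proj) setdist"
  by (simp add: mtopology_of_def mspace_flat_torus mdist_flat_torus is_lattice_Lam)

lemma continuous_translate:
  "continuous_map (prod_topology euclidean torus) torus (\<lambda>(c, X). (\<lambda>z. z + c) ` X)"
proof -
  interpret Metric_space "range proj" setdist by (rule Metric_space_flat_torus[OF is_lattice_Lam])
  show ?thesis unfolding torus_eq_mtopology continuous_map_to_metric
  proof (intro ballI allI impI)
    fix cX :: "complex \<times> complex set" and e :: real
    assume "cX \<in> topspace (prod_topology euclidean mtopology)" and e: "e > 0"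
    then obtain c z where cX: "cX = (c, proj z)" by auto
    let ?U = "ball c (e / 2) \<times> mball (proj z) (e / 2)"
    have "(\<lambda>z. z + c') ` X \<in> mball (proj (z + c)) e" if "c' \<in> ball c (e / 2)" "X \<in> mball (proj z) (e / 2)" for c' X
    proof -
      have "X \<in> range proj" "setdist (proj z) X < e / 2" using that by auto
      then obtain w where w: "X = proj w" "setdist (proj z) (proj w) < e / 2" by blast
      obtain w' where w': "proj w' = proj w" "dist z w' < e / 2" using setdist_proj_lessD[OF w(2)] .
      have "dist (z + c) (w' + c') \<le> dist z w' + dist c c'" by (rule dist_triangle_add)
      also have "\<dots> < e" using that(1) w'(2) by simp
      finally have "setdist (proj (z + c)) (proj (w' + c')) < e"
        using setdist_proj_le[of "z + c" "w' + c'"] by simp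
      then show ?thesis unfolding w(1) w'(1)[symmetric] translate_proj by simp
    qed
    then show "\<exists>U. openin (prod_topology euclidean mtopology) U \<and> cX \<in> U \<and>
       (\<forall>y\<in>U. (case y of (c, X) \<Rightarrow> (\<lambda>z. z + c) ` X) \<in> mball (case cX of (c, X) \<Rightarrow> (\<lambda>z. z + c) ` X) e)"
      unfolding cX using e
      by (intro exI[of _ ?U]) (auto simp: openin_prod_Times_iff translate_proj)
  qed
qed

section \<open>Bending the marking\<close>

text \<open>A horizontal shear of the whole torus, with amplitude depending on the height. It
  preserves heights and is therefore injective, so embeddedness and homotopy to the marking come for
  free along the family.\<close>

definition bend :: "real \<Rightarrow> complex set \<Rightarrow> complex set" where
  "bend a X = (\<lambda>z. z + of_real (a * wave_torus X)) ` X"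

lemma bend_proj: "bend a (proj z) = proj (z + of_real (a * wave (Im z)))"
  by (simp add: bend_def wave_torus_proj translate_proj)

lemma bend_0: "bend 0 X = X"
  by (simp add: bend_def)

lemma continuous_bend:
  assumes "continuous_map X euclideanreal f" "continuous_map X torus g"
  shows "continuous_map X torus (\<lambda>x. bend (f x) (g x))"
proof -
  have "continuous_map X euclidean (\<lambda>x. complex_of_real (f x * wave_torus (g x)))"
  proof -
    have "continuous_map X euclidean (\<lambda>x. f x * wave_torus (g x))"
      using assms(1) continuous_map_compose[OF assms(2) continuous_wave_torus]
      by (intro continuous_map_real_mult) (simp_all add: o_def)
    moreover have "continuous_map euclidean euclidean complex_of_real"
      by (simp add: continuous_on_of_real)
    ultimately show ?thesis using continuous_map_compose[of X euclidean "\<lambda>x. f x * wave_torus (g x)" euclidean complex_of_real]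
      by (simp add: o_def)
  qed
  then have "continuous_map X (prod_topology euclidean torus) (\<lambda>x. (complex_of_real (f x * wave_torus (g x)), g x))"
    using assms(2) by (simp add: continuous_map_paired)
  from continuous_map_compose[OF this continuous_translate]
  show ?thesis by (simp add: o_def bend_def)
qed

lemma inj_on_bend: "inj_on (bend a) (range proj)"
proof (rule inj_onI, clarify)
  fix z w assume "bend a (proj z) = bend a (proj w)"
  then have *: "(w + of_real (a * wave (Im w))) - (z + of_real (a * wave (Im z))) \<in> Lam"
    by (simp only: bend_proj proj_eq_iff)
  obtain n where n: "even n" "Im ((w + of_real (a * wave (Im w))) - (z + of_real (a * wave (Im z)))) = of_int n"
    using Im_Lam[OF *] .
  then have "wave (Im w) = wave (Im z)"
    using wave_periodic[OF n(1), of "Im z"] by (simp add: algebra_simps)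
  then show "proj z = proj w" using * by (simp add: proj_eq_iff)
qed

abbreviation skel :: "(real ^ 5) set" where "skel \<equiv> one_skeleton T10"

definition phi :: "real \<Rightarrow> real ^ 5 \<Rightarrow> complex set" where
  "phi a = restrict (\<lambda>x. bend a (marking x)) skel"

lemma skel_subset: "skel \<subseteq> \<Union>T10"
  by (auto simp: one_skeleton_def)

lemma compact_skel: "compact skel"
proof -
  have "finite {S \<in> T10. aff_dim S \<le> 1}" "\<And>S. S \<in> T10 \<Longrightarrow> compact S"
    using simplicial_complex_T10 by (auto simp: simplicial_complex_def) (metis compact_simplex)
  then show ?thesis unfolding one_skeleton_def by (intro compact_Union) auto
qed

lemma continuous_marking_skel: "continuous_map (top_of_set skel) torus marking"
  using continuous_map_from_subtopology_mono[OF continuous_marking skel_subset] .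

lemma marking_range: "marking x \<in> range proj"
  by (simp add: marking_def)

lemma continuous_phi: "continuous_map (top_of_set skel) torus (phi a)"
  by (rule continuous_map_eq[OF continuous_bend[OF _ continuous_marking_skel, of "\<lambda>_. a"]])
    (auto simp: phi_def)

lemma embedding_phi: "embedding_map (top_of_set skel) torus (phi a)"
proof (rule continuous_imp_embedding_map[OF continuous_phi _ Hausdorff_torus])
  show "compact_space (top_of_set skel)" using compact_skel by (simp add: compact_space_subtopology)
  show "inj_on (phi a) (topspace (top_of_set skel))"
  proof (rule inj_onI)
    fix x y assume xy: "x \<in> topspace (top_of_set skel)" "y \<in> topspace (top_of_set skel)" "phi a x = phi a y"
    then have "bend a (marking x) = bend a (marking y)" by (simp add: phi_def)
    then have "marking x = marking y" by (rule inj_onD[OF inj_on_bend _ marking_range marking_range])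
    then show "x = y"
      by (rule inj_onD[OF inj_on_marking]) (use xy skel_subset in \<open>simp_all add: subset_iff\<close>)
  qed
qed

lemma homotopic_phi: "homotopic_with (\<lambda>_. True) (top_of_set skel) torus (phi a) (phi 0)"
proof -
  let ?X = "prod_topology (top_of_set {0..1}) (top_of_set skel)"
  have "continuous_map ?X euclideanreal (\<lambda>p. (1 - fst p) * a)"
  proof -
    have "continuous_map ?X euclideanreal fst"
      using continuous_map_into_fulltopology[OF continuous_map_fst] .
    then show ?thesis by (intro continuous_intros) auto
  qed
  moreover have "continuous_map ?X torus (\<lambda>p. marking (snd p))"
    using continuous_map_compose[OF continuous_map_snd continuous_marking_skel, unfolded o_def] .
  ultimately have "continuous_map ?X torus (\<lambda>p. bend ((1 - fst p) * a) (marking (snd p)))"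
    by (rule continuous_bend)
  then show ?thesis
    by (subst homotopic_with)
      (auto simp: phi_def bend_0 intro!: exI[of _ "\<lambda>p. bend ((1 - fst p) * a) (marking (snd p))"])
qed

section \<open>Edge vectors of the bent maps\<close>

definition stepv :: "int \<Rightarrow> complex" where
  "stepv x = (if x = 1 then plane 1 0 else if x = 3 then plane 0 1 else if x = 4 then plane 1 1
     else if x = -1 then plane (-1) 0 else if x = -3 then plane 0 (-1) else plane (-1) (-1))"

lemma stepv_neg: "x \<in> steps \<Longrightarrow> stepv (- x) = - stepv x"
  unfolding steps_def by (elim insertE emptyE) (simp_all add: stepv_def complex_eq_iff)

lemma stepv_link: "(x, y) \<in> link \<Longrightarrow> stepv (y - x) = stepv y - stepv x"
  unfolding link_def by (elim insertE emptyE) (simp_all add: stepv_def complex_eq_iff)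

lemma marking_edge_pos:
  assumes "0 \<le> t" "t \<le> 1"
  shows "marking (linepath (vt k) (vt (k + 1)) t) = proj (plane (of_int k + t) 0)"
    "marking (linepath (vt k) (vt (k + 3)) t) = proj (plane (of_int k) t)"
    "marking (linepath (vt k) (vt (k + 4)) t) = proj (plane (of_int k + t) t)"
  using marking_cell[of t 0 k] marking_cell[of 0 t k] marking_cell[of t t k] assms
  by (simp_all add: cell_def linepath_def)

lemma marking_edge:
  assumes "x \<in> steps" "0 \<le> t" "t \<le> 1"
  shows "marking (linepath (vt k) (vt (k + x)) t) = proj (plane (of_int k) 0 + t *\<^sub>R stepv x)"
proof -
  have rev: "linepath p q t = linepath q p (1 - t)" for p q :: "real ^ 5"
    by (simp add: linepath_def algebra_simps)
  have t': "0 \<le> 1 - t" "1 - t \<le> 1" using assms by auto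
  \<comment> \<open>The label \<open>k - 3\<close> is lifted below to (k - 3, 0), while the step -3
    leads to (k, -1); this lattice vector is the difference.\<close>
  have L: "plane 3 (-1) \<in> Lam" unfolding plane_in_Lam by (intro exI[of _ 3] exI[of _ "-1"]) simp
  consider "x = 1" | "x = 3" | "x = 4" | "x = -1" | "x = -3" | "x = -4"
    using assms(1) by (auto simp: steps_def)
  then show ?thesis
  proof cases
    case 1
    have "plane (of_int k + t) 0 = plane (of_int k) 0 + t *\<^sub>R stepv x"
      using 1 by (simp add: stepv_def complex_eq_iff algebra_simps)
    then show ?thesis using marking_edge_pos(1)[OF assms(2,3), of k] 1 by simp
  next
    case 2
    have "plane (of_int k) t = plane (of_int k) 0 + t *\<^sub>R stepv x"
      using 2 by (simp add: stepv_def complex_eq_iff algebra_simps)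
    then show ?thesis using marking_edge_pos(2)[OF assms(2,3), of k] 2 by simp
  next
    case 3
    have "plane (of_int k + t) t = plane (of_int k) 0 + t *\<^sub>R stepv x"
      using 3 by (simp add: stepv_def complex_eq_iff algebra_simps)
    then show ?thesis using marking_edge_pos(3)[OF assms(2,3), of k] 3 by simp
  next
    case 4
    have "marking (linepath (vt k) (vt (k + x)) t) = proj (plane (of_int k - t) 0)"
      using marking_edge_pos(1)[OF t', of "k - 1"] 4 by (simp add: rev[of "vt k"])
    also have "plane (of_int k - t) 0 = plane (of_int k) 0 + t *\<^sub>R stepv x"
      using 4 by (simp add: stepv_def complex_eq_iff algebra_simps)
    finally show ?thesis .
  next
    case 5
    have "marking (linepath (vt k) (vt (k + x)) t) = proj (plane (of_int k - 3) (1 - t))"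
      using marking_edge_pos(2)[OF t', of "k - 3"] 5 by (simp add: rev[of "vt k"])
    also have "\<dots> = proj (plane (of_int k) 0 + t *\<^sub>R stepv x)"
    proof -
      have "plane (of_int k) 0 + t *\<^sub>R stepv x - plane (of_int k - 3) (1 - t) = plane 3 (-1)"
        using 5 by (simp add: stepv_def complex_eq_iff algebra_simps)
      then show ?thesis unfolding proj_eq_iff using L by simp
    qed
    finally show ?thesis .
  next
    case 6
    have "marking (linepath (vt k) (vt (k + x)) t) = proj (plane (of_int k - 3 - t) (1 - t))"
      using marking_edge_pos(3)[OF t', of "k - 4"] 6 by (simp add: rev[of "vt k"] algebra_simps)
    also have "\<dots> = proj (plane (of_int k) 0 + t *\<^sub>R stepv x)"
    proof -
      have "plane (of_int k) 0 + t *\<^sub>R stepv x - plane (of_int k - 3 - t) (1 - t) = plane 3 (-1)"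
        using 6 by (simp add: stepv_def complex_eq_iff algebra_simps)
      then show ?thesis unfolding proj_eq_iff using L by simp
    qed
    finally show ?thesis .
  qed
qed

text \<open>The edge vectors of the geodesic map that moves vertex \<open>k\<close> of the model by \<open>e k\<close>.\<close>

definition disp :: "(int \<Rightarrow> complex) \<Rightarrow> int \<Rightarrow> int \<Rightarrow> complex" where
  "disp e k x = stepv x + e (k + x) - e k"

definition zigzag :: "real \<Rightarrow> int \<Rightarrow> complex" where
  "zigzag a k = (if even k then 0 else of_real a)"

lemma linepath_in_skel:
  assumes "x \<in> steps" "t \<in> {0..1}"
  shows "linepath (vt k) (vt (k + x)) t \<in> skel"
proof -
  have "convex hull {vt k, vt (k + x)} \<in> {S \<in> T10. aff_dim S \<le> 1}"
    using edge_in_T10[OF assms(1), of k] aff_dim_simplex[of 1 "convex hull {vt k, vt (k + x)}"]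
    by (simp add: edges_def)
  moreover have "linepath (vt k) (vt (k + x)) t \<in> convex hull {vt k, vt (k + x)}"
    using assms(2) by (auto simp: segment_convex_hull[symmetric] in_segment linepath_def)
  ultimately show ?thesis unfolding one_skeleton_def by blast
qed

lemma phi_edge:
  assumes x: "x \<in> steps"
  shows "geodesic_from Lam (phi a \<circ> linepath (vt k) (vt (k + x)))
    (plane (of_int k) 0 + zigzag a k) (disp (zigzag a) k x)"
  unfolding geodesic_from_def
proof
  fix t :: real assume t: "t \<in> {0..1}"
  let ?z = "plane (of_int k) 0 + t *\<^sub>R stepv x"
  have "(phi a \<circ> linepath (vt k) (vt (k + x))) t = bend a (proj ?z)"
    using linepath_in_skel[OF x t, of k] marking_edge[OF x, of t k] t by (simp add: phi_def)
  also have "\<dots> = proj (?z + of_real (a * wave (Im ?z)))" by (rule bend_proj)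
  also have "?z + of_real (a * wave (Im ?z)) = plane (of_int k) 0 + zigzag a k + t *\<^sub>R disp (zigzag a) k x"
  proof -
    \<comment> \<open>Along an edge the height is constant or moves by one from an integer, and on
      such an interval the wave is affine; this is why the bent edge remains straight.\<close>
    have "of_real (a * wave (Im ?z)) = zigzag a k + t *\<^sub>R (zigzag a (k + x) - zigzag a k)"
    proof -
      have w: "wave (of_int k) = (if even k then 0 else 1)"
        "wave (of_int k + t) = (if even k then t else 1 - t)"
        "wave (of_int k - t) = (if even k then t else 1 - t)"
        using wave_even[of k 0] wave_odd[of k 0] wave_even[of k t] wave_odd[of k t] t by auto
      have "x \<in> {4, -4} \<or> odd x" using x by (auto simp: steps_def)
      moreover have "Im ?z = of_int k" if "x \<in> {4, -4}" using that by (auto simp: stepv_def)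
      moreover have "Im ?z = of_int k + t \<or> Im ?z = of_int k - t" if "odd x"
        using x that by (auto simp: steps_def stepv_def)
      ultimately show ?thesis
        using w by (auto simp: zigzag_def scaleR_conv_of_real right_diff_distrib)
    qed
    then show ?thesis by (simp add: disp_def algebra_simps)
  qed
  finally show "(phi a \<circ> linepath (vt k) (vt (k + x))) t =
    proj (plane (of_int k) 0 + zigzag a k + t *\<^sub>R disp (zigzag a) k x)" .
qed

lemma edges_geodesic_phi: "edges_geodesic Lam T10 (phi a)"
  unfolding edges_geodesic_def
proof (intro allI impI)
  fix u v assume "convex hull {u, v} \<in> edges T10"
  then obtain k x where "x \<in> steps" "u = vt k" "v = vt (k + x)" by (rule edges_T10D)
  then show "is_geodesic Lam (phi a \<circ> linepath u v)"
    unfolding is_geodesic_def using phi_edge by blast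
qed

lemma phi_in_cfunspace: "phi a \<in> mspace (cfunspace (top_of_set skel) (flat_torus Lam))"
proof -
  have comp: "compactin (top_of_set skel) (topspace (top_of_set skel))"
    using compact_skel by (simp add: compactin_subtopology)
  have "phi a x \<in> mspace (flat_torus Lam)" if "x \<in> skel" for x
    using continuous_map_image_subset_topspace[OF continuous_phi[of a]] that by auto
  then show ?thesis
    using continuous_phi[of a] unfolding compactin_mspace_cfunspace[OF comp] by (simp add: phi_def)
qed

section \<open>Edge displacements\<close>

lemma disp_neg: "x \<in> steps \<Longrightarrow> disp e (k + x) (- x) = - disp e k x"
  by (simp add: disp_def stepv_neg)

lemma disp_link: "(x, y) \<in> link \<Longrightarrow> disp e (k + x) (y - x) = disp e k y - disp e k x"
  by (simp add: disp_def stepv_link)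

text \<open>A step together with the steps to the apexes of the triangles on its left and right.\<close>

definition flank :: "(int \<times> int \<times> int) set" where
  "flank = {(1, -3, 4), (4, 1, 3), (3, 4, -1), (-1, 3, -4), (-4, -1, -3), (-3, -4, 1)}"

lemma link_flank:
  assumes "(x, y) \<in> link" "(x, y') \<in> link" "y \<noteq> y'"
  shows "(x, y, y') \<in> flank \<or> (x, y', y) \<in> flank"
  using assms(1) unfolding link_def
  by (elim insertE emptyE) (use assms(2,3) in \<open>auto simp: link_def flank_def\<close>)

text \<open>\<open>plane\<close> reverses orientation (\<open>50 - \<i>\<close> lies clockwise of
  \<open>50 + \<i>\<close>), which explains the order of the arguments. The two inequalities cover
  the two triangles of the unit square at \<open>k\<close>.\<close>

definition positively_oriented :: "(int \<Rightarrow> complex) \<Rightarrow> bool" where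
  "positively_oriented e \<longleftrightarrow>
     (\<forall>k. cross2 (disp e k 4) (disp e k 1) > 0 \<and> cross2 (disp e k 3) (disp e k 4) > 0)"

text \<open>Two of the six sectors at \<open>k\<close> are given; the other four belong to triangles
  based at \<open>k - 1\<close>, \<open>k - 3\<close> and \<open>k - 4\<close>, seen from another
  corner.\<close>

lemma flank_oriented_left:
  assumes "positively_oriented e" "(x, l, r) \<in> flank"
  shows "cross2 (disp e k x) (disp e k l) > 0"
proof -
  have A: "cross2 (disp e j 4) (disp e j 1) > 0" and B: "cross2 (disp e j 3) (disp e j 4) > 0" for j
    using assms(1) by (auto simp: positively_oriented_def)
  have e: "disp e (k + -1) 4 = disp e k 3 - disp e k (-1)" "disp e (k + -1) 1 = - disp e k (-1)"
    "disp e (k + -4) 4 = - disp e k (-4)" "disp e (k + -4) 3 = disp e k (-1) - disp e k (-4)"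
    "disp e (k + -4) 1 = disp e k (-3) - disp e k (-4)"
    "disp e (k + -3) 3 = - disp e k (-3)" "disp e (k + -3) 4 = disp e k 1 - disp e k (-3)"
    using disp_link[of "-1" 3 e k] disp_neg[of "-1" e k] disp_neg[of "-4" e k] disp_link[of "-4" "-1" e k]
      disp_link[of "-4" "-3" e k] disp_neg[of "-3" e k] disp_link[of "-3" 1 e k]
    by (simp_all add: link_def steps_def)
  have "cross2 (disp e k (-1)) (disp e k 3) > 0" "cross2 (disp e k (-3)) (disp e k (-4)) > 0"
    using A[of "k + -1"] A[of "k + -4"] unfolding e by (simp_all add: cross2_def algebra_simps)
  moreover have "cross2 (disp e k (-4)) (disp e k (-1)) > 0" "cross2 (disp e k 1) (disp e k (-3)) > 0"
    using B[of "k + -4"] B[of "k + -3"] unfolding e by (simp_all add: cross2_def algebra_simps)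
  ultimately show ?thesis
    using assms(2) A[of k] B[of k] unfolding flank_def by (elim insertE emptyE) simp_all
qed

lemma flank_oriented_right:
  assumes "positively_oriented e" "(x, l, r) \<in> flank"
  shows "cross2 (disp e k x) (disp e k r) < 0"
proof -
  have "\<exists>r'. (r, x, r') \<in> flank"
    using assms(2) unfolding flank_def by (elim insertE emptyE) auto
  then obtain r' where "(r, x, r') \<in> flank" by blast
  from flank_oriented_left[OF assms(1) this, of k] show ?thesis by (simp add: cross2_def algebra_simps)
qed

section \<open>The Delaunay condition in terms of displacements\<close>

definition locally_delaunay_disp :: "(int \<Rightarrow> complex) \<Rightarrow> bool" where
  "locally_delaunay_disp e \<longleftrightarrow>
     (\<forall>k. \<forall>(x, l, r)\<in>flank. locally_delaunay 0 (disp e k x) (disp e k l) (disp e k r))"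

lemma locally_delaunay_translate:
  "locally_delaunay (u + a) (v + a) (w + a) (w' + a) = locally_delaunay u v w w'"
  by (simp add: locally_delaunay_def cot_at_def)

lemma locally_delaunay_swap: "locally_delaunay u v w w' = locally_delaunay v u w' w"
  by (simp add: locally_delaunay_def add.commute)

text \<open>Reversing an edge exchanges its ends and its sides at once, which leaves the condition
  unchanged; so three of the six directions determine the rest.\<close>

lemma locally_delaunay_dispI:
  assumes "\<And>k. locally_delaunay 0 (disp e k 1) (disp e k (-3)) (disp e k 4)"
    and "\<And>k. locally_delaunay 0 (disp e k 4) (disp e k 1) (disp e k 3)"
    and "\<And>k. locally_delaunay 0 (disp e k 3) (disp e k 4) (disp e k (-1))"
  shows "locally_delaunay_disp e"
proof -
  have neg: "locally_delaunay 0 (disp e k (- x)) (disp e k (r - x)) (disp e k (l - x))"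
    if "\<And>k. locally_delaunay 0 (disp e k x) (disp e k l) (disp e k r)" "(x, l) \<in> link" "(x, r) \<in> link" for x l r k
  proof -
    have x: "x \<in> steps" using that(2) by (auto simp: link_def steps_def)
    have "disp e k (- x) = - disp e (k - x) x" using disp_neg[OF x, of e "k - x"] by simp
    moreover have "disp e k (l - x) = disp e (k - x) l - disp e (k - x) x"
      "disp e k (r - x) = disp e (k - x) r - disp e (k - x) x"
      using disp_link[OF that(2), of e "k - x"] disp_link[OF that(3), of e "k - x"] by simp_all
    ultimately show ?thesis
      using that(1)[of "k - x"] locally_delaunay_swap
        locally_delaunay_translate[of 0 "- disp e (k - x) x" "disp e (k - x) x" "disp e (k - x) l" "disp e (k - x) r"]
      by simp
  qed
  show ?thesis
    unfolding locally_delaunay_disp_def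
  proof (intro allI ballI, clarify)
    fix k x l r assume "(x, l, r) \<in> flank"
    then show "locally_delaunay 0 (disp e k x) (disp e k l) (disp e k r)"
      unfolding flank_def using assms(1)[of k] assms(2)[of k] assms(3)[of k]
        neg[OF assms(1), of k] neg[OF assms(2), of k] neg[OF assms(3), of k]
      by (elim insertE emptyE) (simp_all add: link_def)
  qed
qed

text \<open>This is how the homotopy class enters: the edge vectors differ from those of the model
  by differences of vertex displacements, so they close up around triangles.\<close>

definition has_disp :: "(real ^ 5 \<Rightarrow> complex set) \<Rightarrow> (int \<Rightarrow> complex) \<Rightarrow> bool" where
  "has_disp \<phi> e \<longleftrightarrow>
     (\<forall>k. \<forall>x\<in>steps. velocity Lam (\<phi> \<circ> linepath (vt k) (vt (k + x))) = disp e k x)"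

lemma inner_angle_disp:
  assumes v: "has_disp \<phi> e" and "(x, y) \<in> link"
  shows "inner_angle Lam \<phi> (vt (k + x)) (vt k) (vt (k + y)) = vec_angle (disp e k x) (disp e k y)"
    and "inner_angle Lam \<phi> (vt k) (vt (k + x)) (vt (k + y))
       = vec_angle (- disp e k x) (disp e k y - disp e k x)"
    and "inner_angle Lam \<phi> (vt k) (vt (k + y)) (vt (k + x))
       = vec_angle (- disp e k y) (disp e k x - disp e k y)"
proof -
  have l: "(y, x) \<in> link" using assms(2) by (auto simp: link_def)
  have "x \<in> steps \<and> y \<in> steps \<and> - x \<in> steps \<and> - y \<in> steps \<and> y - x \<in> steps \<and> x - y \<in> steps"
    using assms(2) unfolding link_def by (elim insertE emptyE) (simp_all add: steps_def)
  then have xy: "x \<in> steps" "y \<in> steps" "- x \<in> steps" "- y \<in> steps" "y - x \<in> steps" "x - y \<in> steps"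
    by auto
  have vel: "velocity Lam (\<phi> \<circ> linepath (vt k) (vt (k + z))) = disp e k z" if "z \<in> steps" for k z
    using v that by (auto simp: has_disp_def)
  show "inner_angle Lam \<phi> (vt (k + x)) (vt k) (vt (k + y)) = vec_angle (disp e k x) (disp e k y)"
    by (simp add: inner_angle_def vel xy)
  show "inner_angle Lam \<phi> (vt k) (vt (k + x)) (vt (k + y))
       = vec_angle (- disp e k x) (disp e k y - disp e k x)"
    using vel[OF xy(3), of "k + x"] vel[OF xy(5), of "k + x"]
    by (simp add: inner_angle_def disp_neg xy disp_link[OF assms(2)])
  show "inner_angle Lam \<phi> (vt k) (vt (k + y)) (vt (k + x))
       = vec_angle (- disp e k y) (disp e k x - disp e k y)"
    using vel[OF xy(4), of "k + y"] vel[OF xy(6), of "k + y"]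
    by (simp add: inner_angle_def disp_neg xy disp_link[OF l])
qed

lemma flank_link:
  assumes "(x, l, r) \<in> flank"
  shows "(x, l) \<in> link \<and> (x, r) \<in> link \<and> l mod 10 \<noteq> r mod 10 \<and> x \<in> steps"
  using assms unfolding flank_def by (elim insertE emptyE) (simp_all add: link_def steps_def)

lemma delaunay_expr_iff:
  assumes v: "has_disp \<phi> e" and o: "positively_oriented e" and f: "(x, l, r) \<in> flank"
  shows "inner_angle Lam \<phi> (vt (k + x)) (vt k) (vt (k + l)) + inner_angle Lam \<phi> (vt k) (vt (k + x)) (vt (k + l))
    + inner_angle Lam \<phi> (vt (k + x)) (vt k) (vt (k + r)) + inner_angle Lam \<phi> (vt k) (vt (k + x)) (vt (k + r))
    - inner_angle Lam \<phi> (vt k) (vt (k + l)) (vt (k + x)) - inner_angle Lam \<phi> (vt k) (vt (k + r)) (vt (k + x)) > 0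
    \<longleftrightarrow> locally_delaunay 0 (disp e k x) (disp e k l) (disp e k r)"
proof -
  have l: "(x, l) \<in> link" "(x, r) \<in> link"
    using flank_link[OF f] by auto
  show ?thesis
    unfolding inner_angle_disp[OF v l(1)] inner_angle_disp[OF v l(2)]
    using delaunay_angles_iff[of "disp e k x" 0 "disp e k l" "disp e k r"]
      flank_oriented_left[OF o f, of k] flank_oriented_right[OF o f, of k]
    by simp
qed

lemma flank_pair:
  assumes "(x, l, r) \<in> flank"
  shows "(x, l) \<in> link" "(x, r) \<in> link" "vt (k + l) \<noteq> vt (k + r)" "x \<in> steps"
  using flank_link[OF assms] by (auto simp: vt_eq_iff mod10_distinct)

lemma steps_mod_inj: "x \<in> steps \<Longrightarrow> y \<in> steps \<Longrightarrow> x mod 10 = y mod 10 \<Longrightarrow> x = y"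
  unfolding steps_def by (elim insertE emptyE) simp_all

lemma delaunay_iff:
  assumes v: "has_disp \<phi> e" and o: "positively_oriented e"
  shows "delaunay Lam T10 \<phi> \<longleftrightarrow> locally_delaunay_disp e"
proof
  assume D: "delaunay Lam T10 \<phi>"
  show "locally_delaunay_disp e"
    unfolding locally_delaunay_disp_def
  proof (intro allI ballI, clarify)
    fix k x l r assume f: "(x, l, r) \<in> flank"
    note p = flank_pair[OF f]
    show "locally_delaunay 0 (disp e k x) (disp e k l) (disp e k r)"
      unfolding delaunay_expr_iff[OF v o f, symmetric]
      using D[unfolded delaunay_def, rule_format, of "vt k" "vt (k + x)" "vt (k + l)" "vt (k + r)"]
        edge_in_T10[OF p(4)] triangle_in_T10[OF p(1)] triangle_in_T10[OF p(2)] p(3) by simp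
  qed
next
  assume L: "locally_delaunay_disp e"
  show "delaunay Lam T10 \<phi>"
    unfolding delaunay_def
  proof (intro allI impI, elim conjE)
    fix u v' w w'
    assume ne: "w \<noteq> w'" and t: "convex hull {u, v', w} \<in> triangles T10" "convex hull {u, v', w'} \<in> triangles T10"
    obtain k x y where w: "(x, y) \<in> link" "u = vt k" "v' = vt (k + x)" "w = vt (k + y)"
      using triangles_T10D[OF t(1)] .
    obtain k' x' y' where w': "(x', y') \<in> link" "u = vt k'" "v' = vt (k' + x')" "w' = vt (k' + y')"
      using triangles_T10D[OF t(2)] .
    \<comment> \<open>The two triangles arrive with unrelated integer labels; steps are determined
      by their residues mod 10, so both can be based at \<open>k\<close>.\<close>
    have kk: "k' mod 10 = k mod 10" using w(2) w'(2) by (simp add: vt_eq_iff)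
    have "vt (k + x') = vt (k + x)" using vt_cong[OF kk] w(3) w'(3) by simp
    then have "x' mod 10 = x mod 10" by (simp add: vt_eq_iff mod10_distinct)
    moreover have "x \<in> steps" "x' \<in> steps" using w(1) w'(1) by (auto simp: link_def steps_def)
    ultimately have xx: "x' = x" using steps_mod_inj by blast
    have y': "w' = vt (k + y')" using w'(4) vt_cong[OF kk] by simp
    have "y \<noteq> y'" using ne w(4) y' by auto
    then have "(x, y, y') \<in> flank \<or> (x, y', y) \<in> flank" using link_flank[OF w(1) w'(1)[unfolded xx]] by simp
    then show "0 < inner_angle Lam \<phi> v' u w + inner_angle Lam \<phi> u v' w + inner_angle Lam \<phi> v' u w' +
              inner_angle Lam \<phi> u v' w' - inner_angle Lam \<phi> u w v' - inner_angle Lam \<phi> u w' v'"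
    proof
      assume f: "(x, y, y') \<in> flank"
      then have "locally_delaunay 0 (disp e k x) (disp e k y) (disp e k y')"
        using L unfolding locally_delaunay_disp_def by blast
      then show ?thesis
        unfolding delaunay_expr_iff[OF v o f, symmetric] w(2,3,4) y' .
    next
      assume f: "(x, y', y) \<in> flank"
      then have "locally_delaunay 0 (disp e k x) (disp e k y') (disp e k y)"
        using L unfolding locally_delaunay_disp_def by blast
      then show ?thesis
        unfolding delaunay_expr_iff[OF v o f, symmetric] w(2,3,4) y' by linarith
    qed
  qed
qed

text \<open>A closed zigzag of edges through all ten vertices, lifted to the plane; ten steps translate by
  \<open>10 * \<i>\<close>.\<close>

definition ring_label :: "int \<Rightarrow> int" where
  "ring_label r = (if even r then - r else 2 - r)"

text \<open>In the model these points are (r/2, -r/2) for even \<open>r\<close> and ((1+r)/2,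
  (1-r)/2) for odd \<open>r\<close>, with labels \<open>- r\<close> and \<open>2 - r\<close> and
  real parts 0 and 50. Moving the odd ones by about -50 aligns all of them vertically.\<close>

definition ring :: "(int \<Rightarrow> complex) \<Rightarrow> int \<Rightarrow> complex" where
  "ring e r = e (ring_label r) + (if even r then 0 else 50) + of_int r * \<i>"

definition crossing_bounds :: "real \<Rightarrow> real \<Rightarrow> complex \<Rightarrow> bool" where
  "crossing_bounds a b z \<longleftrightarrow> \<bar>Re z - 100\<bar> \<le> a \<and> \<bar>Im z\<bar> \<le> b"

text \<open>For \<open>zigzag a\<close> with \<open>a\<close> near -50, the edges of directions 1
  and 3 have real part about 100 when they start at an odd vertex and about 0 when they start at an
  even one; the latter form the ring.\<close>

definition crossings_within :: "real \<Rightarrow> real \<Rightarrow> (int \<Rightarrow> complex) \<Rightarrow> bool" where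
  "crossings_within a b e \<longleftrightarrow> (\<forall>k. crossing_bounds a b (disp e k 4)) \<and>
     (\<forall>k. odd k \<longrightarrow> crossing_bounds a b (disp e k 1) \<and> crossing_bounds a b (disp e k 3))"

text \<open>The bootstrap: the lifted ring satisfies \<open>thin_strip\<close>, whose conclusion
  improves its hypotheses. For even \<open>r\<close> the ring points of index \<open>r\<close> and
  \<open>r + 1\<close> are the vertices \<open>- r\<close> and \<open>1 - r\<close>, which
  identifies each edge of the strip with a displacement.\<close>

lemma crossing_rigidity:
  assumes per: "\<And>k. e (k + 10) = e k" and o: "positively_oriented e" and L: "locally_delaunay_disp e"
    and weak: "crossings_within 50 100 e"
  shows "crossings_within (5 / 4) 14 e"
proof -
  define p where "p = ring e"
  define q where "q r = p (r - 4) + (100 + 4 * \<i>)" for r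
  have per': "e (k - 10) = e k" for k using per[of "k - 10"] by simp
  have comm: "e (- 3 - r) = e (- r - 3)" "e (- 2 - r) = e (- r - 2)" for r
    by (rule arg_cong[of _ _ e], simp)+
  have even_diffs: "q r - p r = disp e (- r) 4" "p (r + 1) - p r = disp e (- r) 1"
    "p (r - 1) - p r = disp e (- r) 3" "p (r + 5) - (100 + 4 * \<i>) - p r = disp e (- r) (-3)" if "even r" for r
    using that comm by (simp_all add: p_def q_def ring_def ring_label_def disp_def stepv_def complex_eq_iff)
  have odd_diffs: "q r - p (r + 1) = disp e (1 - r) 3" "q (r + 1) - p (r + 1) = disp e (1 - r) 4"
    "q (r + 2) - p (r + 1) = disp e (1 - r) 1" "p (r + 2) - p (r + 1) = disp e (1 - r) (-3)"
    "p r - p (r + 1) = disp e (1 - r) (-1)"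
    "p (r + 5) - (100 + 4 * \<i>) - p (r + 1) = disp e (1 - r) (-4)" if "even r" for r
    using that comm by (simp_all add: p_def q_def ring_def ring_label_def disp_def stepv_def complex_eq_iff)
  have f: "(1, -3, 4) \<in> flank" "(4, 1, 3) \<in> flank" "(3, 4, -1) \<in> flank" "(-3, -4, 1) \<in> flank"
    by (simp_all add: flank_def)
  have ld: "locally_delaunay a b c d"
    if "(x, l, r) \<in> flank" "b - a = disp e k x" "c - a = disp e k l" "d - a = disp e k r" for a b c d k x l r
  proof -
    have "locally_delaunay 0 (b - a) (c - a) (d - a)"
      using L that unfolding locally_delaunay_disp_def by auto
    then show ?thesis using locally_delaunay_translate[of 0 a "b - a" "c - a" "d - a"] by simp
  qed
  have c4: "Re (disp e k 4) \<ge> 50 \<and> \<bar>Im (disp e k 4)\<bar> \<le> 100" for k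
    using weak unfolding crossings_within_def crossing_bounds_def by (smt (verit))
  have c13: "Re (disp e k 1) \<ge> 50 \<and> \<bar>Im (disp e k 1)\<bar> \<le> 100"
    "Re (disp e k 3) \<ge> 50 \<and> \<bar>Im (disp e k 3)\<bar> \<le> 100" if "odd k" for k
    using weak that unfolding crossings_within_def crossing_bounds_def by (smt (verit))+
  interpret thin_strip p q
  proof
    show "p (r + 10) = p r + 10 * \<i>" for r
      using per'[of "- r"] per'[of "2 - r"]
      by (simp add: p_def ring_def ring_label_def algebra_simps)
    show "q r = p (r - 4) + (100 + 4 * \<i>)" for r by (fact q_def)
    fix r :: int assume r: "even r"
    show "cross2 (q r - p r) (p (r + 1) - p r) > 0"
      "cross2 (q r - p (r + 1)) (q (r + 1) - p (r + 1)) > 0"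
      "cross2 (q (r + 1) - p (r + 1)) (q (r + 2) - p (r + 1)) > 0"
      using o by (simp_all add: even_diffs[OF r] odd_diffs[OF r] positively_oriented_def)
    show "cross2 (q (r + 2) - p (r + 1)) (p (r + 2) - p (r + 1)) > 0"
      unfolding odd_diffs[OF r] by (rule flank_oriented_left[OF o f(1)])
    show "locally_delaunay (p r) (q r) (p (r + 1)) (p (r - 1))"
      by (rule ld[OF f(2) even_diffs(1,2,3)[OF r]])
    show "locally_delaunay (p (r + 1)) (q r) (q (r + 1)) (p r)"
      by (rule ld[OF f(3) odd_diffs(1,2,5)[OF r]])
    show "locally_delaunay (p (r + 1)) (q (r + 1)) (q (r + 2)) (q r)"
      by (rule ld[OF f(2) odd_diffs(2,3,1)[OF r]])
    show "locally_delaunay (p (r + 1)) (q (r + 2)) (p (r + 2)) (q (r + 1))"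
      by (rule ld[OF f(1) odd_diffs(3,4,2)[OF r]])
    show "locally_delaunay (p r) (p (r + 1)) (p (r + 5) - (100 + 4 * \<i>)) (q r)"
      by (rule ld[OF f(1) even_diffs(2,4,1)[OF r]])
    show "locally_delaunay (p (r + 1)) (p (r + 2)) (p (r + 5) - (100 + 4 * \<i>)) (q (r + 2))"
      by (rule ld[OF f(4) odd_diffs(4,6,3)[OF r]])
    have "odd (1 - r)" using r by simp
    note c = c4 c13[OF this]
    show "Re (q r - p r) \<ge> 50 \<and> \<bar>Im (q r - p r)\<bar> \<le> 100" unfolding even_diffs[OF r] by (rule c)
    show "Re (q r - p (r + 1)) \<ge> 50 \<and> \<bar>Im (q r - p (r + 1))\<bar> \<le> 100" unfolding odd_diffs[OF r] by (rule c)
    show "Re (q (r + 1) - p (r + 1)) \<ge> 50 \<and> \<bar>Im (q (r + 1) - p (r + 1))\<bar> \<le> 100"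
      unfolding odd_diffs[OF r] by (rule c)
    show "Re (q (r + 2) - p (r + 1)) \<ge> 50 \<and> \<bar>Im (q (r + 2) - p (r + 1))\<bar> \<le> 100"
      unfolding odd_diffs[OF r] by (rule c)
  qed
  have 4: "crossing_bounds (5 / 4) 14 (disp e k 4)" for k
  proof (cases "even k")
    case True
    then show ?thesis using crossing_close(1,2)[of "- k"] even_diffs(1)[of "- k"]
      by (simp add: crossing_bounds_def)
  next
    case False
    then have eq: "disp e k 4 = q (1 - k + 1) - p (1 - k + 1)" using odd_diffs(2)[of "1 - k"] by simp
    show ?thesis unfolding eq crossing_bounds_def using crossing_close(1,2)[of "1 - k + 1"] by blast
  qed
  have 13: "crossing_bounds (5 / 4) 14 (disp e k 3)" "crossing_bounds (5 / 4) 14 (disp e k 1)" if "odd k" for k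
  proof -
    have eq: "disp e k 3 = q (1 - k) - p (1 - k + 1)" "disp e k 1 = q (1 - k + 2) - p (1 - k + 1)"
      using odd_diffs(1,3)[of "1 - k"] that by simp_all
    show "crossing_bounds (5 / 4) 14 (disp e k 3)" "crossing_bounds (5 / 4) 14 (disp e k 1)"
      unfolding eq crossing_bounds_def using crossing_close(3-6)[of "1 - k"] by blast+
  qed
  show ?thesis unfolding crossings_within_def using 4 13 by blast
qed

lemma positively_oriented_zigzag: "positively_oriented (zigzag a)"
  by (auto simp: positively_oriented_def disp_def stepv_def zigzag_def cross2_def)

text \<open>The cotangent sum is 100 - 2a or 100 + 2a on slanted edges and (a^2 - 2499) / 50 on
  horizontal ones.\<close>

lemma locally_delaunay_zigzag:
  assumes "\<bar>a\<bar> < 50" "a\<^sup>2 > 2499"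
  shows "locally_delaunay_disp (zigzag a)"
proof (rule locally_delaunay_dispI)
  fix k
  have a: "a * a > 2499" "a < 50" "- 50 < a" using assms by (auto simp: power2_eq_square)
  show "locally_delaunay 0 (disp (zigzag a) k 1) (disp (zigzag a) k (- 3)) (disp (zigzag a) k 4)"
    "locally_delaunay 0 (disp (zigzag a) k 4) (disp (zigzag a) k 1) (disp (zigzag a) k 3)"
    "locally_delaunay 0 (disp (zigzag a) k 3) (disp (zigzag a) k 4) (disp (zigzag a) k (- 1))"
    using a by (cases "even k"; simp add: locally_delaunay_def cot_at_def cross2_def inner_complex_def
        disp_def stepv_def zigzag_def algebra_simps)+
qed

lemma has_disp_phi: "has_disp (phi a) (zigzag a)"
  unfolding has_disp_def using velocity_eq[OF is_lattice_Lam phi_edge] by blast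

lemma phi_in_delaunay_maps:
  assumes "\<bar>a\<bar> < 50" "a\<^sup>2 > 2499"
  shows "phi a \<in> delaunay_maps Lam T10 (phi 0)"
  unfolding delaunay_maps_def
  using phi_in_cfunspace embedding_phi edges_geodesic_phi homotopic_phi
    delaunay_iff[OF has_disp_phi positively_oriented_zigzag] locally_delaunay_zigzag[OF assms]
  by blast

section \<open>Lifting maps homotopic to the marking\<close>

lemma Lam_norm_ge:
  assumes "l \<in> Lam" "l \<noteq> 0"
  shows "norm l \<ge> 10"
proof -
  obtain m n where l: "l = of_int m * (100 + 4 * \<i>) + of_int n * (10 * \<i>)"
    using assms(1) unfolding Lam_def by blast
  show ?thesis
  proof (cases "m = 0")
    case True
    then have "n \<noteq> 0" using assms(2) l by auto
    then have "\<bar>real_of_int n\<bar> \<ge> 1" by linarith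
    then have "\<bar>Im l\<bar> \<ge> 10" using True by (simp add: l abs_mult)
    then show ?thesis using abs_Im_le_cmod[of l] by linarith
  next
    case False
    then have "\<bar>real_of_int m\<bar> \<ge> 1" by linarith
    then have "\<bar>Re l\<bar> \<ge> 100" by (simp add: l abs_mult)
    then show ?thesis using abs_Re_le_cmod[of l] by linarith
  qed
qed

text \<open>The difference of two lifts is continuous with values in a discrete lattice, hence
  constant.\<close>

lemma lift_displacement_unique:
  fixes f g :: "real \<Rightarrow> complex"
  assumes "continuous_on {0..1} f" "continuous_on {0..1} g"
    and "\<And>t. t \<in> {0..1} \<Longrightarrow> proj (f t) = proj (g t)"
  shows "f 1 - f 0 = g 1 - g 0"
proof -
  have "(\<lambda>t. f t - g t) constant_on {0..1}"
  proof (rule continuous_discrete_range_constant)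
    show "continuous_on {0..1} (\<lambda>t. f t - g t)" by (intro continuous_intros assms)
    fix s :: real assume s: "s \<in> {0..1}"
    have "10 \<le> norm ((f t - g t) - (f s - g s))" if "t \<in> {0..1}" "f t - g t \<noteq> f s - g s" for t
    proof (rule Lam_norm_ge)
      have "f t - g t \<in> Lam" "g s - f s \<in> Lam"
        using assms(3)[OF that(1)] assms(3)[OF s] by (metis proj_eq_iff)+
      from is_lattice_add_closed(2)[OF is_lattice_Lam this]
      show "(f t - g t) - (f s - g s) \<in> Lam" by (simp add: algebra_simps)
    qed (use that in simp)
    then show "\<exists>e>0. \<forall>t. t \<in> {0..1} \<and> f t - g t \<noteq> f s - g s \<longrightarrow> e \<le> norm (f t - g t - (f s - g s))"
      by (intro exI[of _ 10]) simp
  qed simp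
  then obtain c where "\<And>t. t \<in> {0..1} \<Longrightarrow> f t - g t = c" unfolding constant_on_def by blast
  from this[of 0] this[of 1] show ?thesis by (simp add: algebra_simps)
qed

text \<open>Lifting to the plane amounts to taking continuous logarithms of the two circle-valued
  coordinates of the torus.\<close>

definition torus_char :: "(complex \<Rightarrow> real) \<Rightarrow> complex set \<Rightarrow> complex" where
  "torus_char \<xi> X = cis (2 * pi * \<xi> (SOME z. z \<in> X))"

lemma cis_2pi_eq_iff: "cis (2 * pi * x) = cis (2 * pi * y) \<longleftrightarrow> x - y \<in> \<int>"
proof -
  have "cis (2 * pi * x) = cis (2 * pi * y) \<longleftrightarrow> cis (2 * pi * (x - y)) = 1"
    by (simp add: right_diff_distrib cis_divide[symmetric] divide_eq_1_iff)
  also have "\<dots> \<longleftrightarrow> x - y \<in> \<int>"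
  proof -
    have "cis (2 * pi * u) = 1 \<longleftrightarrow> u \<in> \<int>" for u
    proof -
      have "cis (2 * pi * u) = 1 \<longleftrightarrow> (\<exists>n::int. 2 * pi * u = of_int (2 * n) * pi)"
        by (simp add: cis_conv_exp exp_eq_1)
      also have "\<dots> \<longleftrightarrow> (\<exists>n::int. u = of_int n)" by (simp add: mult.commute)
      finally show ?thesis by (simp add: Ints_def image_def)
    qed
    then show ?thesis .
  qed
  finally show ?thesis .
qed

definition xi1 :: "complex \<Rightarrow> real" where "xi1 z = Re z / 100"
definition xi2 :: "complex \<Rightarrow> real" where "xi2 z = (Im z - 4 * (Re z / 100)) / 10"

lemma xi_expand: "z = xi1 z *\<^sub>R (100 + 4 * \<i>) + xi2 z *\<^sub>R (10 * \<i>)"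
  by (simp add: complex_eq_iff xi1_def xi2_def field_simps)

lemma xi_combine:
  "xi1 (s *\<^sub>R (100 + 4 * \<i>) + t *\<^sub>R (10 * \<i>)) = s" "xi2 (s *\<^sub>R (100 + 4 * \<i>) + t *\<^sub>R (10 * \<i>)) = t"
  by (simp_all add: xi1_def xi2_def)

lemma xi_diff: "xi1 (z - w) = xi1 z - xi1 w" "xi2 (z - w) = xi2 z - xi2 w"
  by (simp_all add: xi1_def xi2_def field_simps)

lemma Lam_iff_xi: "z \<in> Lam \<longleftrightarrow> xi1 z \<in> \<int> \<and> xi2 z \<in> \<int>"
proof
  assume "z \<in> Lam"
  then obtain m n where "z = of_int m *\<^sub>R (100 + 4 * \<i>) + of_int n *\<^sub>R (10 * \<i>)"
    unfolding Lam_def by (auto simp: scaleR_conv_of_real)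
  then show "xi1 z \<in> \<int> \<and> xi2 z \<in> \<int>" by (simp add: xi_combine)
next
  assume "xi1 z \<in> \<int> \<and> xi2 z \<in> \<int>"
  then obtain m n where "xi1 z = of_int m" "xi2 z = of_int n" by (auto elim!: Ints_cases)
  then have "z = of_int m * (100 + 4 * \<i>) + of_int n * (10 * \<i>)"
    using xi_expand[of z] by (simp add: scaleR_conv_of_real)
  then show "z \<in> Lam" unfolding Lam_def by blast
qed

lemma torus_char_proj:
  assumes "\<xi> = xi1 \<or> \<xi> = xi2"
  shows "torus_char \<xi> (proj z) = cis (2 * pi * \<xi> z)"
proof -
  have "z \<in> proj z" using is_lattice_add_closed(1)[OF is_lattice_Lam] by (simp add: proj_mem_iff)
  then have "(SOME w. w \<in> proj z) \<in> proj z" by (rule someI)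
  then show ?thesis
    unfolding torus_char_def cis_2pi_eq_iff using assms by (auto simp: proj_mem_iff Lam_iff_xi xi_diff)
qed

lemma continuous_torus_char:
  assumes "\<xi> = xi1 \<or> \<xi> = xi2"
  shows "continuous_map torus euclidean (torus_char \<xi>)"
proof -
  have "continuous_on UNIV \<xi>" using assms unfolding xi1_def xi2_def by (auto intro!: continuous_intros)
  then have "continuous_on UNIV (\<lambda>z. cis (2 * pi * \<xi> z))" by (intro continuous_intros)
  then have "continuous_map euclidean euclidean (torus_char \<xi> \<circ> proj)"
    by (simp add: o_def torus_char_proj[OF assms])
  then show ?thesis
    using continuous_compose_quotient_map_eq[OF quotient_map_torus_proj[OF is_lattice_Lam]] by blast
qed

lemma torus_lift:
  fixes S :: "'a :: real_normed_vector set"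
  assumes K: "continuous_map (top_of_set S) torus K" and S: "convex S"
  obtains L where "continuous_on S L" "\<And>s. s \<in> S \<Longrightarrow> proj (L s) = K s"
proof -
  have lift: "\<exists>u. continuous_on S u \<and> (\<forall>s\<in>S. torus_char \<xi> (K s) = cis (2 * pi * u s))"
    if \<xi>: "\<xi> = xi1 \<or> \<xi> = xi2" for \<xi>
  proof -
    have "continuous_on S (\<lambda>s. torus_char \<xi> (K s))"
      using continuous_map_compose[OF K continuous_torus_char[OF \<xi>]] by (simp add: o_def)
    moreover have "torus_char \<xi> (K s) \<noteq> 0" for s by (simp add: torus_char_def)
    ultimately obtain g where g: "continuous_on S g" "\<And>s. s \<in> S \<Longrightarrow> torus_char \<xi> (K s) = exp (g s)"
      using continuous_logarithm_on_contractible convex_imp_contractible[OF S] by metis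
    have "torus_char \<xi> (K s) = cis (2 * pi * (Im (g s) / (2 * pi)))" if "s \<in> S" for s
    proof -
      have "norm (exp (g s)) = 1" unfolding g(2)[OF that, symmetric] by (simp add: torus_char_def)
      then have "Re (g s) = 0" by (simp add: norm_exp_eq_Re)
      then show ?thesis unfolding g(2)[OF that] exp_eq_polar[of "g s"] by simp
    qed
    moreover have "continuous_on S (\<lambda>s. Im (g s) / (2 * pi))" by (intro continuous_intros g) simp
    ultimately show ?thesis by blast
  qed
  obtain u where u: "continuous_on S u" "\<forall>s\<in>S. torus_char xi1 (K s) = cis (2 * pi * u s)"
    using lift[of xi1] by blast
  obtain v where v: "continuous_on S v" "\<forall>s\<in>S. torus_char xi2 (K s) = cis (2 * pi * v s)"
    using lift[of xi2] by blast
  let ?L = "\<lambda>s. u s *\<^sub>R (100 + 4 * \<i>) + v s *\<^sub>R (10 * \<i>)"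
  show ?thesis
  proof
    show "continuous_on S ?L" by (intro continuous_intros u v)
    fix s assume s: "s \<in> S"
    have "K s \<in> range proj"
      using continuous_map_image_subset_topspace[OF K] s topspace_torus by auto
    then obtain z where z: "K s = proj z" by blast
    have "cis (2 * pi * xi1 z) = cis (2 * pi * u s)" "cis (2 * pi * xi2 z) = cis (2 * pi * v s)"
      using bspec[OF u(2) s] bspec[OF v(2) s] by (simp_all add: z torus_char_proj)
    then have "xi1 z - u s \<in> \<int>" "xi2 z - v s \<in> \<int>" by (simp_all only: cis_2pi_eq_iff)
    then show "proj (?L s) = K s"
      unfolding z proj_eq_iff Lam_iff_xi xi_diff xi_combine by simp
  qed
qed

text \<open>The homotopy is lifted over every vertex and over every edge times the time interval.
  Around the lifted square the four sides cancel: one is the model edge, one the geodesic edge of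
  \<open>\<phi>\<close>, the other two are the paths of the end vertices.\<close>

lemma displacement_exists:
  assumes hom: "homotopic_with (\<lambda>_. True) (top_of_set skel) torus \<phi> (phi 0)"
    and geo: "edges_geodesic Lam T10 \<phi>"
  obtains e where "\<forall>k. e (k + 10) = e k" "has_disp \<phi> e"
proof -
  from hom[unfolded homotopic_with_def]
  obtain h where h: "continuous_map (prod_topology (top_of_set {0..1::real}) (top_of_set skel)) torus h"
    and h01: "\<forall>x. h (0, x) = \<phi> x" "\<forall>x. h (1, x) = phi 0 x" by (elim exE conjE) (rule that, assumption+)
  have h0: "h (0, x) = \<phi> x" and h1: "h (1, x) = phi 0 x" for x using h01 by simp_all
  have edge: "linepath (vt k) (vt (k + x)) t \<in> skel" if "x \<in> steps" "t \<in> {0..1}" for k x t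
    using linepath_in_skel[OF that] .
  have vskel: "vt k \<in> skel" for k using edge[of 1 0 k] by (simp add: steps_def linepath_0')
  have "\<exists>l. continuous_on {0..1::real} l \<and> (\<forall>t\<in>{0..1}. proj (l t) = h (t, v))" if "v \<in> skel" for v
  proof -
    have "continuous_map (top_of_set {0..1}) torus (h \<circ> (\<lambda>t. (t, v)))"
      by (rule continuous_map_compose[OF _ h]) (use that in \<open>auto simp: continuous_map_pairwise o_def intro!: continuous_intros\<close>)
    then obtain l where "continuous_on {0..1::real} l" "\<And>t. t \<in> {0..1} \<Longrightarrow> proj (l t) = (h \<circ> (\<lambda>t. (t, v))) t"
      using torus_lift[OF _ convex_closed_interval] by metis
    then show ?thesis by auto
  qed
  then obtain l where l: "\<And>v. v \<in> skel \<Longrightarrow> continuous_on {0..1::real} (l v)"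
    "\<And>v t. v \<in> skel \<Longrightarrow> t \<in> {0..1} \<Longrightarrow> proj (l v t) = h (t, v)" by metis
  \<comment> \<open>The lift \<open>l\<close> is chosen per point, not per integer label, which
    makes \<open>e\<close> periodic.\<close>
  define e where "e k = l (vt k) 0 - l (vt k) 1" for k
  show ?thesis
  proof
    show "\<forall>k. e (k + 10) = e k"
    proof
      fix k
      have "vt (k + 10) = vt k" by (simp add: vt_eq_iff)
      then show "e (k + 10) = e k" by (simp add: e_def)
    qed
    show "has_disp \<phi> e"
      unfolding has_disp_def
    proof (intro allI ballI)
      fix k x assume x: "x \<in> steps"
      let ?\<gamma> = "linepath (vt k) (vt (k + x))"
      obtain p d where d: "geodesic_from Lam (\<phi> \<circ> ?\<gamma>) p d"
        using geo edge_in_T10[OF x, of k] unfolding edges_geodesic_def is_geodesic_def by blast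
      let ?S = "{0..1::real} \<times> {0..1::real}"
      have "continuous_map (top_of_set ?S) torus (h \<circ> (\<lambda>(t, s). (t, ?\<gamma> s)))"
      proof (rule continuous_map_compose[OF _ h])
        have "continuous_on ?S (\<lambda>p. ?\<gamma> (snd p))" unfolding linepath_def by (intro continuous_intros)
        moreover have "continuous_on ?S fst" by (intro continuous_intros)
        ultimately show "continuous_map (top_of_set ?S) (prod_topology (top_of_set {0..1}) (top_of_set skel)) (\<lambda>(t, s). (t, ?\<gamma> s))"
          using edge[OF x] by (auto simp: continuous_map_pairwise o_def case_prod_beta intro!: continuous_on_Pair)
      qed
      then obtain L where L: "continuous_on ?S L"
        "\<And>q. q \<in> ?S \<Longrightarrow> proj (L q) = (h \<circ> (\<lambda>(t, s). (t, ?\<gamma> s))) q"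
        using torus_lift[OF _ convex_Times[OF convex_closed_interval convex_closed_interval]] by metis
      have L': "proj (L (t, s)) = h (t, ?\<gamma> s)" if "t \<in> {0..1}" "s \<in> {0..1}" for t s
        using L(2)[of "(t, s)"] that by simp
      have cont: "continuous_on {0..1} (\<lambda>s. L (t, s))" "continuous_on {0..1} (\<lambda>s. L (s, t))" if "t \<in> {0..1}" for t
        by (rule continuous_on_compose2[OF L(1)]; use that in \<open>auto intro!: continuous_intros\<close>)+
      have "L (0, 1) - L (0, 0) = (p + 1 *\<^sub>R d) - (p + 0 *\<^sub>R d)"
        by (rule lift_displacement_unique[OF cont(1)])
          (use L' h0 edge[OF x] d in \<open>auto intro!: continuous_intros simp: geodesic_from_def\<close>)
      then have 1: "d = L (0, 1) - L (0, 0)" by simp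
      have 2: "L (1, 1) - L (1, 0) = (plane (of_int k) 0 + 1 *\<^sub>R stepv x) - (plane (of_int k) 0 + 0 *\<^sub>R stepv x)"
        by (rule lift_displacement_unique[OF cont(1)])
          (use L' h1 edge[OF x] marking_edge[OF x] in \<open>auto intro!: continuous_intros simp: phi_def bend_0\<close>)
      have 3: "L (1, 0) - L (0, 0) = l (vt k) 1 - l (vt k) 0"
        by (rule lift_displacement_unique[OF cont(2) l(1)]) (use L'[of _ 0] vskel l(2) in \<open>auto simp: linepath_def\<close>)
      have 4: "L (1, 1) - L (0, 1) = l (vt (k + x)) 1 - l (vt (k + x)) 0"
        by (rule lift_displacement_unique[OF cont(2) l(1)]) (use L'[of _ 1] vskel l(2) in \<open>auto simp: linepath_def\<close>)
      have "d = (L (1, 1) - L (1, 0)) + (L (1, 0) - L (0, 0)) - (L (1, 1) - L (0, 1))"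
        unfolding 1 by simp
      then have "d = disp e k x" unfolding 2 3 4 disp_def e_def by (simp add: algebra_simps)
      then show "velocity Lam (\<phi> \<circ> ?\<gamma>) = disp e k x"
        using velocity_eq[OF is_lattice_Lam d] by simp
    qed
  qed
qed

section \<open>Nondegenerate triangles from injectivity\<close>

lemma edge_point:
  assumes geo: "edges_geodesic Lam T10 \<phi>" and v: "has_disp \<phi> e" and x: "x \<in> steps"
    and z: "proj z = \<phi> (vt k)" and t: "t \<in> {0..1}"
  shows "\<phi> (linepath (vt k) (vt (k + x)) t) = proj (z + t *\<^sub>R disp e k x)"
proof -
  let ?\<gamma> = "linepath (vt k) (vt (k + x))"
  obtain p d where d: "geodesic_from Lam (\<phi> \<circ> ?\<gamma>) p d"
    using geo edge_in_T10[OF x, of k] unfolding edges_geodesic_def is_geodesic_def by blast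
  have "d = disp e k x" using velocity_eq[OF is_lattice_Lam d] v x by (simp add: has_disp_def)
  then have *: "\<phi> (?\<gamma> s) = proj (p + s *\<^sub>R disp e k x)" if "s \<in> {0..1}" for s
    using d that by (simp add: geodesic_from_def)
  have "proj p = proj z" using *[of 0] z by (simp add: linepath_def)
  then have "proj (p + t *\<^sub>R disp e k x) = proj (z + t *\<^sub>R disp e k x)"
    by (simp add: proj_eq_iff)
  then show ?thesis using *[OF t] by simp
qed

lemma link_rotate:
  assumes "(x, y) \<in> link"
  shows "(- x, y - x) \<in> link" "(- y, x - y) \<in> link" "x \<in> steps" "y \<in> steps" "y - x \<in> steps"
proof -
  have "(- x, y - x) \<in> link \<and> (- y, x - y) \<in> link \<and> x \<in> steps \<and> y \<in> steps \<and> y - x \<in> steps"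
    using assms unfolding link_def by (elim insertE emptyE) (simp_all add: steps_def)
  then show "(- x, y - x) \<in> link" "(- y, x - y) \<in> link" "x \<in> steps" "y \<in> steps" "y - x \<in> steps" by auto
qed

lemma vertex_not_on_edge:
  assumes geo: "edges_geodesic Lam T10 \<phi>" and v: "has_disp \<phi> e" and inj: "inj_on \<phi> skel"
    and img: "\<phi> ` skel \<subseteq> range proj" and l: "(x, y) \<in> link"
  shows "0 \<notin> closed_segment (disp e k x) (disp e k y)"
proof
  assume "0 \<in> closed_segment (disp e k x) (disp e k y)"
  then obtain t where t: "t \<in> {0..1}" "0 = (1 - t) *\<^sub>R disp e k x + t *\<^sub>R disp e k y"
    by (auto simp: in_segment)
  note s = link_rotate(3-5)[OF l]
  have vskel: "vt j \<in> skel" for j using linepath_in_skel[of 1 0 j] by (simp add: steps_def linepath_0')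
  then obtain z where z: "proj z = \<phi> (vt k)" using img by (metis image_subset_iff rangeE)
  have "\<phi> (vt (k + x)) = proj (z + disp e k x)"
    using edge_point[OF geo v s(1) z, of 1] by (simp add: linepath_def)
  from edge_point[OF geo v s(3) this[symmetric] t(1)]
  have "\<phi> (linepath (vt (k + x)) (vt (k + y)) t) = proj (z + (disp e k x + t *\<^sub>R (disp e k y - disp e k x)))"
    by (simp add: disp_link[OF l] add.assoc)
  also have "disp e k x + t *\<^sub>R (disp e k y - disp e k x) = 0" using t(2) by (simp add: algebra_simps)
  finally have eq: "\<phi> (linepath (vt (k + x)) (vt (k + y)) t) = \<phi> (vt k)" using z by simp
  have "linepath (vt (k + x)) (vt (k + y)) t \<in> skel"
    using linepath_in_skel[OF s(3) t(1), of "k + x"] by simp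
  from inj_onD[OF inj eq this vskel]
  have "vt k \<in> closed_segment (vt (k + x)) (vt (k + y))"
    using t(1) by (auto simp: in_segment linepath_def intro!: exI[of _ t])
  then show False using vt_not_in_opposite_edge[OF l] by blast
qed

lemma noncollinear:
  assumes geo: "edges_geodesic Lam T10 \<phi>" and v: "has_disp \<phi> e" and inj: "inj_on \<phi> skel"
    and img: "\<phi> ` skel \<subseteq> range proj" and l: "(x, y) \<in> link"
  shows "cross2 (disp e k x) (disp e k y) \<noteq> 0"
proof
  assume c: "cross2 (disp e k x) (disp e k y) = 0"
  let ?X = "disp e k x" and ?Y = "disp e k y"
  note no = vertex_not_on_edge[OF geo v inj img]
  have n1: "0 \<notin> closed_segment ?X ?Y" by (rule no[OF l])
  have n2: "0 \<notin> closed_segment (- ?X) (?Y - ?X)"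
    using no[OF link_rotate(1)[OF l], of "k + x"] link_rotate(3)[OF l] by (simp add: disp_neg disp_link[OF l])
  have l': "(y, x) \<in> link" using l by (auto simp: link_def)
  have n3: "0 \<notin> closed_segment (- ?Y) (?X - ?Y)"
    using no[OF link_rotate(2)[OF l], of "k + y"] link_rotate(4)[OF l] by (simp add: disp_neg disp_link[OF l'])
  have "?X \<noteq> 0" using n1 by auto
  then have "\<exists>s. ?Y = s *\<^sub>R ?X"
  proof (cases "Re ?X = 0")
    case True
    then have "Im ?X \<noteq> 0" "Re ?Y = 0" using \<open>?X \<noteq> 0\<close> c by (auto simp: complex_eq_iff cross2_def)
    then show ?thesis using True by (intro exI[of _ "Im ?Y / Im ?X"]) (simp add: complex_eq_iff)
  next
    case False
    then show ?thesis using c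
      by (intro exI[of _ "Re ?Y / Re ?X"]) (simp add: complex_eq_iff cross2_def field_simps)
  qed
  then obtain s where s: "?Y = s *\<^sub>R ?X" by blast
  have zero: "0 \<in> closed_segment (a *\<^sub>R ?X) (b *\<^sub>R ?X)" if "a \<le> 0" "0 \<le> b" "a < b" for a b
    unfolding in_segment
  proof (intro exI conjI)
    have "(1 - (- a) / (b - a)) * a + (- a) / (b - a) * b = 0"
      using that by (simp add: field_simps)
    then show "0 = (1 - (- a) / (b - a)) *\<^sub>R a *\<^sub>R ?X + ((- a) / (b - a)) *\<^sub>R b *\<^sub>R ?X"
      by (simp only: scaleR_scaleR scaleR_left_distrib[symmetric]) simp
  qed (use that in \<open>simp_all add: field_simps\<close>)
  \<comment> \<open>The ratio \<open>s\<close> tells which of the three collinear points is in the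
    middle: the vertex \<open>k\<close>, then \<open>k + y\<close>, then \<open>k + x\<close>. That
    vertex would lie on the image of the opposite edge.\<close>
  consider "s \<le> 0" | "0 < s" "s \<le> 1" | "1 < s" by linarith
  then show False
  proof cases
    case 1
    then show False using zero[of s 1] n1 by (simp add: s closed_segment_commute)
  next
    case 2
    then show False using zero[of "- s" "1 - s"] n3 by (simp add: s scaleR_left_diff_distrib)
  next
    case 3
    then show False using zero[of "- 1" "s - 1"] n2 by (simp add: s scaleR_left_diff_distrib)
  qed
qed

section \<open>Continuity of the edge vectors\<close>

text \<open>With lifts starting close together, the distance \<open>F\<close> is below \<delta> or
  above 10 - \<delta> at each time, since distinct lattice points are at least 10 apart. As \<delta>
  < 5, continuity forbids passing from one range to the other, so the ends are close too.\<close>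

lemma geodesic_close:
  assumes g: "geodesic_from Lam \<gamma> p d" "geodesic_from Lam \<gamma>' p' d'"
    and close: "\<And>t. t \<in> {0..1} \<Longrightarrow> setdist (\<gamma> t) (\<gamma>' t) < \<delta>" and \<delta>: "\<delta> < 5"
  shows "norm (d' - d) < 2 * \<delta>"
proof -
  have \<gamma>: "\<gamma> t = proj (p + t *\<^sub>R d)" "\<gamma>' t = proj (p' + t *\<^sub>R d')" if "t \<in> {0..1}" for t
    using g that by (auto simp: geodesic_from_def)
  have "setdist (proj p) (proj p') < \<delta>" using close[of 0] \<gamma>[of 0] by simp
  then obtain c where c: "proj c = proj p'" "dist p c < \<delta>" by (rule setdist_proj_lessD)
  have c': "\<gamma>' t = proj (c + t *\<^sub>R d')" if "t \<in> {0..1}" for t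
    using \<gamma>(2)[OF that] c(1) by (metis translate_proj)
  define F where "F t = norm ((c + t *\<^sub>R d') - (p + t *\<^sub>R d))" for t
  have gap: "F t < \<delta> \<or> F t > \<delta>" if "t \<in> {0..1}" for t
  proof -
    have "setdist (proj (p + t *\<^sub>R d)) (proj (c + t *\<^sub>R d')) < \<delta>"
      using close[OF that] by (simp only: \<gamma>(1)[OF that] c'[OF that])
    then obtain w where w: "proj w = proj (c + t *\<^sub>R d')" "dist (p + t *\<^sub>R d) w < \<delta>"
      by (rule setdist_proj_lessD)
    show ?thesis
    proof (cases "w = c + t *\<^sub>R d'")
      case True
      then show ?thesis using w(2) by (simp add: F_def dist_norm norm_minus_commute)
    next
      case False
      then have "norm (c + t *\<^sub>R d' - w) \<ge> 10"
        using Lam_norm_ge w(1) unfolding proj_eq_iff by simp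
      moreover have "norm (c + t *\<^sub>R d' - w) \<le> F t + dist (p + t *\<^sub>R d) w"
        unfolding F_def dist_norm
        using norm_triangle_ineq[of "(c + t *\<^sub>R d') - (p + t *\<^sub>R d)" "(p + t *\<^sub>R d) - w"]
        by (simp only: diff_add_cancel add_diff_eq)
      ultimately show ?thesis using w(2) \<delta> by linarith
    qed
  qed
  have F0: "F 0 < \<delta>" using c(2) by (simp add: F_def dist_norm norm_minus_commute)
  have "F 1 < \<delta>"
  proof (rule ccontr)
    assume "\<not> F 1 < \<delta>"
    moreover have "continuous_on {0..1} F" unfolding F_def by (intro continuous_intros)
    ultimately have "\<exists>t\<ge>0. t \<le> 1 \<and> F t = \<delta>" using F0 by (intro IVT') auto
    then show False using gap by force
  qed
  moreover have "norm (d' - d) \<le> F 1 + F 0"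
    unfolding F_def using norm_triangle_ineq4[of "c + 1 *\<^sub>R d' - (p + 1 *\<^sub>R d)" "c + 0 *\<^sub>R d' - (p + 0 *\<^sub>R d)"]
    by (simp add: algebra_simps)
  ultimately show ?thesis using F0 by linarith
qed

lemma continuous_velocity:
  assumes x: "x \<in> steps"
  shows "continuous_map (delaunay_space Lam T10 \<psi>) euclidean (\<lambda>\<phi>. velocity Lam (\<phi> \<circ> linepath (vt k) (vt (k + x))))"
proof -
  let ?\<gamma> = "linepath (vt k) (vt (k + x))"
  let ?C = "cfunspace (top_of_set skel) (flat_torus Lam)"
  let ?v = "\<lambda>\<phi>. velocity Lam (\<phi> \<circ> ?\<gamma>)"
  interpret C: Metric_space "mspace ?C" "mdist ?C" by (rule Metric_space_mspace_mdist)
  have top: "topspace (delaunay_space Lam T10 \<psi>) = delaunay_maps Lam T10 \<psi>"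
    by (auto simp: delaunay_space_def delaunay_maps_def)
  have "\<exists>U. openin (delaunay_space Lam T10 \<psi>) U \<and> \<phi> \<in> U \<and> (\<forall>\<phi>'\<in>U. ?v \<phi>' \<in> ball (?v \<phi>) \<epsilon>)"
    if \<phi>: "\<phi> \<in> delaunay_maps Lam T10 \<psi>" and \<epsilon>: "\<epsilon> > 0" for \<phi> \<epsilon>
  proof -
    define \<delta> where "\<delta> = min 1 (\<epsilon> / 2)"
    have \<delta>: "\<delta> > 0" "\<delta> < 5" "2 * \<delta> \<le> \<epsilon>" using \<epsilon> by (auto simp: \<delta>_def)
    let ?U = "delaunay_maps Lam T10 \<psi> \<inter> C.mball \<phi> \<delta>"
    have "openin (delaunay_space Lam T10 \<psi>) ?U"
      unfolding delaunay_space_def mtopology_of_def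
      by (subst Int_commute) (intro openin_subtopology_Int C.openin_mball)
    moreover have "\<phi> \<in> ?U" using \<phi> \<delta>(1) by (auto simp: delaunay_maps_def simp del: mspace_cfunspace)
    moreover have "?v \<phi>' \<in> ball (?v \<phi>) \<epsilon>" if \<phi>': "\<phi>' \<in> ?U" for \<phi>'
    proof -
      have mem: "\<phi> \<in> mspace ?C" "\<phi>' \<in> mspace ?C" "mdist ?C \<phi> \<phi>' < \<delta>"
        using \<phi>' by (auto simp del: mspace_cfunspace)
      have geo: "edges_geodesic Lam T10 \<phi>" "edges_geodesic Lam T10 \<phi>'"
        using \<phi> \<phi>' by (auto simp: delaunay_maps_def)
      obtain p d where d: "geodesic_from Lam (\<phi> \<circ> ?\<gamma>) p d"
        using geo(1) edge_in_T10[OF x, of k] unfolding edges_geodesic_def is_geodesic_def by blast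
      obtain p' d' where d': "geodesic_from Lam (\<phi>' \<circ> ?\<gamma>) p' d'"
        using geo(2) edge_in_T10[OF x, of k] unfolding edges_geodesic_def is_geodesic_def by blast
      have "setdist ((\<phi> \<circ> ?\<gamma>) t) ((\<phi>' \<circ> ?\<gamma>) t) < \<delta>" if "t \<in> {0..1}" for t
        using mdist_cfunspace_imp_mdist_le[OF mem(1,2) order_refl, of "?\<gamma> t"] linepath_in_skel[OF x that, of k] mem(3)
        by (simp add: mdist_flat_torus[OF is_lattice_Lam])
      from geodesic_close[OF d d' this \<delta>(2)]
      show ?thesis
        using \<delta>(3) by (simp add: velocity_eq[OF is_lattice_Lam d] velocity_eq[OF is_lattice_Lam d'] dist_norm norm_minus_commute)
    qed
    ultimately show ?thesis by blast
  qed
  then have "continuous_map (delaunay_space Lam T10 \<psi>) Met_TC.mtopology ?v"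
    unfolding Met_TC.continuous_map_to_metric top by simp
  then show ?thesis by simp
qed

section \<open>The disconnection\<close>

text \<open>Representatives mod 10 keep the family of tests finite; periodicity of the displacements
  extends the bounds to all labels.\<close>

definition crossing_edges :: "(int \<times> int) set" where
  "crossing_edges = (\<lambda>k. (k, 4)) ` {0..<10} \<union> (\<lambda>k. (k, 1)) ` ({0..<10} \<inter> {k. odd k})
     \<union> (\<lambda>k. (k, 3)) ` ({0..<10} \<inter> {k. odd k})"

definition edge_velocity :: "int \<Rightarrow> int \<Rightarrow> (real ^ 5 \<Rightarrow> complex set) \<Rightarrow> complex" where
  "edge_velocity k x \<phi> = velocity Lam (\<phi> \<circ> linepath (vt k) (vt (k + x)))"

text \<open>Functions whose positivity says that all triangles are positively oriented and that the
  crossing edges satisfy the rough bounds.\<close>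

definition tests :: "((real ^ 5 \<Rightarrow> complex set) \<Rightarrow> real) set" where
  "tests = (\<lambda>k \<phi>. cross2 (edge_velocity k 4 \<phi>) (edge_velocity k 1 \<phi>)) ` {0..<10}
     \<union> (\<lambda>k \<phi>. cross2 (edge_velocity k 3 \<phi>) (edge_velocity k 4 \<phi>)) ` {0..<10}
     \<union> (\<lambda>(k, x) \<phi>. 50 - \<bar>Re (edge_velocity k x \<phi>) - 100\<bar>) ` crossing_edges
     \<union> (\<lambda>(k, x) \<phi>. 100 - \<bar>Im (edge_velocity k x \<phi>)\<bar>) ` crossing_edges"

lemma finite_tests: "finite tests"
  by (simp add: tests_def crossing_edges_def)

lemma continuous_tests:
  assumes "c \<in> tests"
  shows "continuous_map (delaunay_space Lam T10 \<psi>) euclideanreal c"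
proof -
  let ?X = "delaunay_space Lam T10 \<psi>"
  have v: "continuous_map ?X euclidean (edge_velocity k x)" if "x \<in> steps" for k x
    using continuous_velocity[OF that] by (simp add: edge_velocity_def[abs_def])
  have re: "continuous_map ?X euclideanreal (\<lambda>\<phi>. Re (edge_velocity k x \<phi>))"
    and im: "continuous_map ?X euclideanreal (\<lambda>\<phi>. Im (edge_velocity k x \<phi>))" if "x \<in> steps" for k x
    using continuous_map_compose[OF v[OF that], of euclideanreal Re]
      continuous_map_compose[OF v[OF that], of euclideanreal Im]
    by (simp_all add: o_def continuous_on_Re continuous_on_Im)
  have s: "1 \<in> steps" "3 \<in> steps" "4 \<in> steps" by (simp_all add: steps_def)
  have e: "x \<in> steps" if "(k, x) \<in> crossing_edges" for k x
    using that s by (auto simp: crossing_edges_def)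
  show ?thesis
    using assms unfolding tests_def cross2_def
    by (auto intro!: continuous_map_diff continuous_map_real_mult continuous_map_real_abs re im s e)
qed

text \<open>Weak inequalities define a closed set and strict ones an open set; where weak implies
  strict, the two coincide.\<close>

lemma clopen_of_strict:
  assumes fin: "finite C" and cont: "\<And>c. c \<in> C \<Longrightarrow> continuous_map X euclideanreal c"
    and strict: "\<forall>x\<in>topspace X. (\<forall>c\<in>C. c x \<ge> 0) \<longrightarrow> (\<forall>c\<in>C. c x > (0::real))"
  shows "openin X {x \<in> topspace X. \<forall>c\<in>C. c x > 0}" "closedin X {x \<in> topspace X. \<forall>c\<in>C. c x > 0}"
proof -
  show "openin X {x \<in> topspace X. \<forall>c\<in>C. c x > 0}"
    using fin cont
  proof (induction C)
    case empty
    then show ?case by simp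
  next
    case (insert c C)
    have "openin X {x \<in> topspace X. c x \<in> {0<..}}"
      by (rule openin_continuous_map_preimage[OF insert.prems]) auto
    moreover have "{x \<in> topspace X. \<forall>c\<in>insert c C. c x > 0} =
      {x \<in> topspace X. c x \<in> {0<..}} \<inter> {x \<in> topspace X. \<forall>c\<in>C. c x > 0}" by auto
    moreover have "openin X {x \<in> topspace X. \<forall>c\<in>C. c x > 0}"
      by (rule insert.IH) (use insert.prems in auto)
    ultimately show ?case by (simp only: openin_Int)
  qed
  have "closedin X {x \<in> topspace X. \<forall>c\<in>C. c x \<ge> 0}"
    using fin cont
  proof (induction C)
    case empty
    then show ?case by simp
  next
    case (insert c C)
    have "closedin X {x \<in> topspace X. c x \<in> {0..}}"
      by (rule closedin_continuous_map_preimage[OF insert.prems]) auto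
    moreover have "{x \<in> topspace X. \<forall>c\<in>insert c C. c x \<ge> 0} =
      {x \<in> topspace X. c x \<in> {0..}} \<inter> {x \<in> topspace X. \<forall>c\<in>C. c x \<ge> 0}" by auto
    moreover have "closedin X {x \<in> topspace X. \<forall>c\<in>C. c x \<ge> 0}"
      by (rule insert.IH) (use insert.prems in auto)
    ultimately show ?case by (simp only: closedin_Int)
  qed
  moreover have "{x \<in> topspace X. \<forall>c\<in>C. c x \<ge> 0} = {x \<in> topspace X. \<forall>c\<in>C. c x > 0}"
    using strict by (auto intro: less_imp_le)
  ultimately show "closedin X {x \<in> topspace X. \<forall>c\<in>C. c x > 0}" by simp
qed

lemma disp_periodic: "(\<And>k. e (k + 10) = e k) \<Longrightarrow> disp e (k mod 10) x = disp e k x"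
proof -
  assume per: "\<And>k. e (k + 10) = e k"
  have e: "e (k + 10 * int n) = e k" for k n
  proof (induction n)
    case (Suc n)
    then show ?case using per[of "k + 10 * int n"] by (simp add: algebra_simps)
  qed simp
  have e': "e (k + 10 * j) = e k" for k j
    using e[of k "nat j"] e[of "k + 10 * j" "nat (- j)"] by (cases "j \<ge> 0") auto
  have k: "k = k mod 10 + 10 * (k div 10)" by simp
  have "e k = e (k mod 10)" "e (k + x) = e (k mod 10 + x)"
    using e'[of "k mod 10" "k div 10"] e'[of "k mod 10 + x" "k div 10"] by (simp_all add: algebra_simps)
  then show ?thesis by (simp add: disp_def)
qed

lemma tests_nonneg_imp:
  assumes v: "has_disp \<phi> e" and per: "\<And>k. e (k + 10) = e k" and nn: "\<forall>c\<in>tests. c \<phi> \<ge> 0"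
  shows "cross2 (disp e k 4) (disp e k 1) \<ge> 0" "cross2 (disp e k 3) (disp e k 4) \<ge> 0"
    "crossings_within 50 100 e"
proof -
  have s: "1 \<in> steps" "3 \<in> steps" "4 \<in> steps" by (simp_all add: steps_def)
  have ev: "edge_velocity k x \<phi> = disp e k x" if "x \<in> steps" for k x
    using v that by (simp add: has_disp_def edge_velocity_def)
  have m: "k mod 10 \<in> {0..<10}" for k :: int by simp
  have "(\<lambda>\<phi>. cross2 (edge_velocity (k mod 10) 4 \<phi>) (edge_velocity (k mod 10) 1 \<phi>)) \<in> tests"
    "(\<lambda>\<phi>. cross2 (edge_velocity (k mod 10) 3 \<phi>) (edge_velocity (k mod 10) 4 \<phi>)) \<in> tests"
    unfolding tests_def using m[of k] by blast+
  from bspec[OF nn this(1)] bspec[OF nn this(2)]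
  show "cross2 (disp e k 4) (disp e k 1) \<ge> 0" "cross2 (disp e k 3) (disp e k 4) \<ge> 0"
    by (simp_all add: ev s disp_periodic[of e, OF per])
  have b: "crossing_bounds 50 100 (disp e k x)" if "(k mod 10, x) \<in> crossing_edges" for k x
  proof -
    have x: "x \<in> steps" using that by (auto simp: crossing_edges_def steps_def)
    have "(\<lambda>\<phi>. 50 - \<bar>Re (edge_velocity (k mod 10) x \<phi>) - 100\<bar>) \<in> tests"
      "(\<lambda>\<phi>. 100 - \<bar>Im (edge_velocity (k mod 10) x \<phi>)\<bar>) \<in> tests"
      unfolding tests_def using that by force+
    from bspec[OF nn this(1)] bspec[OF nn this(2)] show ?thesis
      by (simp add: ev x disp_periodic[of e, OF per] crossing_bounds_def)
  qed
  have "(k mod 10, 4) \<in> crossing_edges" for k by (simp add: crossing_edges_def)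
  moreover have "(k mod 10, 1) \<in> crossing_edges" "(k mod 10, 3) \<in> crossing_edges" if "odd k" for k
  proof -
    have "odd (k mod 10)" using that by presburger
    then show "(k mod 10, 1) \<in> crossing_edges" "(k mod 10, 3) \<in> crossing_edges"
      by (auto simp: crossing_edges_def)
  qed
  ultimately show "crossings_within 50 100 e" unfolding crossings_within_def using b by blast
qed

lemma tests_posI:
  assumes v: "has_disp \<phi> e" and o: "positively_oriented e" and b: "crossings_within (5 / 4) 14 e"
    and c: "c \<in> tests"
  shows "c \<phi> > 0"
proof -
  have s: "1 \<in> steps" "3 \<in> steps" "4 \<in> steps" by (simp_all add: steps_def)
  have ev: "edge_velocity k x \<phi> = disp e k x" if "x \<in> steps" for k x
    using v that by (simp add: has_disp_def edge_velocity_def)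
  have "x \<in> steps \<and> crossing_bounds (5 / 4) 14 (disp e k x)" if "(k, x) \<in> crossing_edges" for k x
    using that b by (auto simp: crossing_edges_def crossings_within_def s)
  note b' = this[unfolded crossing_bounds_def]
  have cb: "x \<in> steps" "\<bar>Re (disp e k x) - 100\<bar> < 50" "\<bar>Im (disp e k x)\<bar> < 100"
    if "(k, x) \<in> crossing_edges" for k x using b'[OF that] by auto
  show ?thesis
    using c o unfolding tests_def positively_oriented_def by (auto simp: ev s cb)
qed

lemma topspace_delaunay_space: "topspace (delaunay_space Lam T10 \<psi>) = delaunay_maps Lam T10 \<psi>"
  by (auto simp: delaunay_space_def delaunay_maps_def)

lemma delaunay_maps_strict:
  assumes \<phi>: "\<phi> \<in> delaunay_maps Lam T10 (phi 0)" and nn: "\<forall>c\<in>tests. c \<phi> \<ge> 0" and c: "c \<in> tests"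
  shows "c \<phi> > 0"
proof -
  have emb: "embedding_map (top_of_set skel) torus \<phi>" and geo: "edges_geodesic Lam T10 \<phi>"
    and hom: "homotopic_with (\<lambda>_. True) (top_of_set skel) torus \<phi> (phi 0)" and del: "delaunay Lam T10 \<phi>"
    using \<phi> by (simp_all add: delaunay_maps_def)
  obtain e where "\<forall>k. e (k + 10) = e k" and v: "has_disp \<phi> e"
    by (rule displacement_exists[OF hom geo])
  then have per: "e (k + 10) = e k" for k by blast
  have inj: "inj_on \<phi> skel" using homeomorphic_imp_injective_map[OF emb[unfolded embedding_map_def]] by simp
  have img: "\<phi> ` skel \<subseteq> range proj"
    using \<phi> by (auto simp: delaunay_maps_def mspace_flat_torus is_lattice_Lam)
  note t = tests_nonneg_imp[OF v per nn]
  \<comment> \<open>Orientation has to be settled before \<open>delaunay_iff\<close>, which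
    translates unsigned angles under that assumption.\<close>
  have o: "positively_oriented e"
    unfolding positively_oriented_def
    using t(1,2) noncollinear[OF geo v inj img, of 4 1] noncollinear[OF geo v inj img, of 3 4]
    by (simp add: link_def less_le)
  have "locally_delaunay_disp e" using del delaunay_iff[OF v o] by blast
  from tests_posI[OF v o crossing_rigidity[OF per o this t(3)] c] show ?thesis .
qed

theorem mainTheorem5:
  shows "\<exists>(\<Lambda> :: complex set) (T :: (real ^ 5) set set) (\<psi> :: real ^ 5 \<Rightarrow> complex set).
    is_lattice \<Lambda> \<and>
    two_dim_complex T \<and>
    top_of_set (\<Union>T) homeomorphic_space mtopology_of (flat_torus \<Lambda>) \<and>
    (\<exists>h. homeomorphic_map (top_of_set (\<Union>T)) (mtopology_of (flat_torus \<Lambda>)) h \<and>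
         \<psi> = restrict h (one_skeleton T)) \<and>
    \<not> connected_space (delaunay_space \<Lambda> T \<psi>)"
proof (intro exI conjI)
  show "is_lattice Lam" "two_dim_complex T10" by (fact is_lattice_Lam two_dim_complex_T10)+
  show "homeomorphic_map (top_of_set (\<Union>T10)) torus marking" by (fact homeomorphic_map_marking)
  then show "top_of_set (\<Union>T10) homeomorphic_space torus" by (rule homeomorphic_map_imp_homeomorphic_space)
  show "phi 0 = restrict marking skel" by (simp add: phi_def bend_0)
  let ?X = "delaunay_space Lam T10 (phi 0)"
  let ?U = "{\<phi> \<in> topspace ?X. \<forall>c\<in>tests. c \<phi> > 0}"
  have strict: "\<forall>\<phi>\<in>topspace ?X. (\<forall>c\<in>tests. c \<phi> \<ge> 0) \<longrightarrow> (\<forall>c\<in>tests. c \<phi> > 0)"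
    using delaunay_maps_strict by (simp only: topspace_delaunay_space) blast
  note clopen = clopen_of_strict[OF finite_tests continuous_tests strict]
  \<comment> \<open>A value just inside the narrow window: 49.99^2 = 2499.0001.\<close>
  define a :: real where "a = 4999 / 100"
  have a: "\<bar>a\<bar> < 50" "\<bar>- a\<bar> < 50" "a\<^sup>2 > 2499" "(- a)\<^sup>2 > 2499"
    by (simp_all add: a_def power2_eq_square)
  have "crossings_within (5 / 4) 14 (zigzag (- a))"
    by (auto simp: crossings_within_def crossing_bounds_def disp_def stepv_def zigzag_def a_def)
  then have "phi (- a) \<in> ?U"
    using phi_in_delaunay_maps[OF a(2,4)] tests_posI[OF has_disp_phi positively_oriented_zigzag]
    by (simp add: topspace_delaunay_space)
  moreover have "phi a \<in> topspace ?X" "phi a \<notin> ?U"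
  proof -
    show "phi a \<in> topspace ?X" using phi_in_delaunay_maps[OF a(1,3)] by (simp add: topspace_delaunay_space)
    \<comment> \<open>For the positive sign, direction 1 out of the odd vertex 1 is a ring edge: its
      real part is 50 - a = 1/100, far from 100.\<close>
    have "(1, 1) \<in> crossing_edges" by (simp add: crossing_edges_def image_iff)
    then have t: "(\<lambda>\<phi>. 50 - \<bar>Re (edge_velocity 1 1 \<phi>) - 100\<bar>) \<in> tests" unfolding tests_def by force
    have "edge_velocity 1 1 (phi a) = disp (zigzag a) 1 1"
      using has_disp_phi[of a] unfolding has_disp_def edge_velocity_def by (simp only: steps_def insertCI)
    then have "50 - \<bar>Re (edge_velocity 1 1 (phi a)) - 100\<bar> < 0"
      by (simp add: disp_def stepv_def zigzag_def a_def)
    then have "\<not> (\<forall>c\<in>tests. c (phi a) > 0)" using bspec[OF _ t, of "\<lambda>c. c (phi a) > 0"] by auto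
    then show "phi a \<notin> ?U" by blast
  qed
  ultimately show "\<not> connected_space ?X"
    unfolding connected_space_clopen_in using clopen by (intro notI, elim allE[of _ ?U]) auto
qed

end
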